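(* Let $\boldsymbol s=(s_1,s_2)\in S_{1|1}$ and $\tilde{\boldsymbol s}=(s_2,s_1)$. Let $M$ be a finite-dimensional irreducible $\mathrm Y(\mathfrak{gl}_{1|1})$-module with $q$-character $\chi^{\boldsymbol s}(M)$ with respect to $\boldsymbol s$. Start with $\mathscr Q^{\boldsymbol s}=\chi^{\boldsymbol s}(M)=\sum_{\boldsymbol\xi}a_{\boldsymbol\xi}[\boldsymbol\xi]$ and $\mathscr Q^{\tilde{\boldsymbol s}}=0$ in $\mathbb Z[\mathfrak B]$, and perform the following procedure. (1) Pick an $\ell^{\boldsymbol s}$-weight $\boldsymbol\zeta=(\zeta_1(u),\zeta_2(u))$ which is maximal with respect to the partial order $>^{\boldsymbol s}$ among those having coefficient $a_{\boldsymbol\zeta}>0$ in the current $\mathscr Q^{\boldsymbol s}$. Let $\varphi(u),\psi(u)$ be coprime monic polynomials with $\zeta_1(u)/\zeta_2(u)=\varphi(u)/\psi(u)$ and let $k=\deg\varphi(u)$. (2) Replace $\mathscr Q^{\boldsymbol s}$ by $$\mathscr Q^{\boldsymbol s}-\sum_{J\subset\{1,\dots,k\}}[\boldsymbol\zeta]\cdot\Big[\Big(\frac{\varphi_J(u-s_1)}{\varphi_J(u)},\frac{\varphi_J(u-s_1)}{\varphi_J(u)}\Big)\Big]$$ and $\mathscr Q^{\tilde{\boldsymbol s}}$ by $$\mathscr Q^{\tilde{\boldsymbol s}}+\sum_{J\subset\{1,\dots,k\}}\Big[\Big(\zeta_2(u)\frac{\psi(u-s_1)}{\psi(u)},\zeta_1(u)\frac{\varphi(u-s_1)}{\varphi(u)}\Big)\Big]\cdot\Big[\Big(\frac{\psi_J(u)}{\psi_J(u-s_1)},\frac{\psi_J(u)}{\psi_J(u-s_1)}\Big)\Big].$$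 (3) Repeat Steps (1) and (2) until $\mathscr Q^{\boldsymbol s}=0$. Then, at the end of the procedure, $\chi^{\tilde{\boldsymbol s}}(M)=\mathscr Q^{\tilde{\boldsymbol s}}$.
   Context: Everything is over $\mathbb C$; superalgebras and modules are $\mathbb Z_2$-graded. $S_{1|1}=\{(1,-1),(-1,1)\}$; for $\boldsymbol s\in S_{1|1}$ define $|i|\in\mathbb Z_2$ by $s_i=(-1)^{|i|}$. The super Yangian $\mathrm Y(\mathfrak{gl}_{1|1}^{\boldsymbol s})$ has generators $t_{ij}^{(r)}$ ($i,j\in\{1,2\}$, $r\ge1$) of parity $|i|+|j|$ and, with $t_{ij}(u)=\delta_{ij}+\sum_{r\ge1}t_{ij}^{(r)}u^{-r}$, relations $(u_1-u_2)[t_{ij}(u_1),t_{kl}(u_2)]=(-1)^{|i||j|+|i||k|+|j||k|}(t_{kj}(u_1)t_{il}(u_2)-t_{kj}(u_2)t_{il}(u_1))$ (supercommutator). The series $d_1^{\boldsymbol s}(u),d_2^{\boldsymbol s}(u)$ are defined by $t_{11}(u)=d_1(u)$, $t_{12}(u)=d_1(u)e(u)$, $t_{21}(u)=f(u)d_1(u)$, $t_{22}(u)=d_2(u)+f(u)d_1(u)e(u)$; write $d_i^{\boldsymbol s}(u)=1+\sum_{r\ge1}d_{i,r}^{\boldsymbol s}u^{-r}$. The super Yangians for $\boldsymbol s$ and $\tilde{\boldsymbol s}$ are identified via $t_{ij}^{\boldsymbol s}(u)\mapsto t_{3-i,3-j}^{\tilde{\boldsymbol s}}(u)$, so a module over one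 is a module over the other, written simply as a $\mathrm Y(\mathfrak{gl}_{1|1})$-module. $\mathfrak B$ is the multiplicative group of pairs $\boldsymbol\zeta=(\zeta_1(u),\zeta_2(u))$ ($\ell$-weights), $\zeta_i(u)=1+\sum_{r\ge1}\zeta_{i,r}u^{-r}\in1+u^{-1}\mathbb C[[u^{-1}]]$, with componentwise multiplication, and $\mathbb Z[\mathfrak B]$ is its group ring with basis $[\boldsymbol\zeta]$. Rational functions are expanded at $u=\infty$. The $q$-character of a finite-dimensional module $M$ with respect to $\boldsymbol s$ is $\chi^{\boldsymbol s}(M)=\sum_{\boldsymbol\zeta}\dim(M^{\boldsymbol s}_{\boldsymbol\zeta})[\boldsymbol\zeta]$, where $M^{\boldsymbol s}_{\boldsymbol\zeta}=\{v\in M:(d_{i,r}^{\boldsymbol s}-\zeta_{i,r})^{\dim M}v=0\text{ for }i=1,2,\ r\ge1\}$; $\chi^{\tilde{\boldsymbol s}}(M)$ is defined in the same way with $d_{i,r}^{\tilde{\boldsymbol s}}$. Partial order: for $a\in\mathbb C$ let $A_a^{\boldsymbol s}=\big(\frac{u-a}{u-a-s_1},\frac{u-a}{u-a-s_1}\big)\in\mathfrak B$; then $\boldsymbol\nu>^{\boldsymbol s}\boldsymbol\mu$ if $\boldsymbol\nu=\boldsymbol\mu A_{a_1}^{\boldsymbol s}\cdots A_{a_r}^{\boldsymbol s}$ for some $r\in\mathbb Z_{>0}$ and $a_1,\dots,a_r\in\mathbb C$. If $\varphi(u)=\prod_{i=1}^k(u+a_i)$ and $\psi(u)=\prod_{i=1}^k(u-b_i)$,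 then for $J\subset\{1,\dots,k\}$ one sets $\varphi_J(u)=\prod_{i\in J}(u+a_i)$ and $\psi_J(u)=\prod_{i\in J}(u-b_i)$, with $\varphi_\emptyset=\psi_\emptyset=1$. *)

theory Defs
  imports
    "HOL-Computational_Algebra.Computational_Algebra"
    "HOL-Library.Poly_Mapping"
    "HOL-Library.Z2"
begin

datatype ix = One | Two

fun flip :: "ix \<Rightarrow> ix" where
  "flip One = Two"
| "flip Two = One"

lemma flip_flip [simp]: "flip (flip i) = i"
  by (cases i) auto

definition S11 :: "(ix \<Rightarrow> int) set" where
  "S11 = {s. (s One, s Two) \<in> {(1, -1), (-1, 1)}}"

definition msign :: "bit \<Rightarrow> 'a::ring_1"  \<comment> \<open>\<open>(-1)\<close> to the power \<open>p\<close>\<close>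
  where "msign p = (if p = 0 then 1 else -1)"

definition par :: "(ix \<Rightarrow> int) \<Rightarrow> ix \<Rightarrow> bit" where
  "par s i = (if s i = 1 then 0 else 1)"

lemma msign_par: "s \<in> S11 \<Longrightarrow> s i = msign (par s i)"
  by (cases i) (auto simp: S11_def par_def msign_def)

text \<open>
  A module over \<open>Y(gl\<^sub>1\<^sub>|\<^sub>1)\<close> (for the parity sequence \<open>s\<close>) is a complex vector space with a
  \<open>Z\<^sub>2\<close>-grading \<open>gr\<close> and operators \<open>t i j r\<close>, the coefficients of \<open>u\<close> to the power \<open>-r\<close> in
  \<open>t\<^sub>i\<^sub>j(u)\<close>, which have the parities of the generators and satisfy the defining relations.
  The relation below is the coefficient of \<open>u\<^sub>1\<close> to the power \<open>-r\<close> times \<open>u\<^sub>2\<close> to the power \<open>-m\<close>;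
  the coefficients in which \<open>u\<^sub>1\<close> or \<open>u\<^sub>2\<close> has exponent \<open>1\<close> vanish on both sides, because the
  operators \<open>t i j 0\<close> are scalars.
\<close>

definition scomm :: "(complex \<Rightarrow> 'v \<Rightarrow> 'v) \<Rightarrow> bit \<Rightarrow> bit \<Rightarrow> ('v \<Rightarrow> 'v) \<Rightarrow> ('v \<Rightarrow> 'v) \<Rightarrow> 'v \<Rightarrow> 'v::ab_group_add"
  where "scomm scale p q A B v = A (B v) - scale (msign (p * q)) (B (A v))"

locale yangian_module = vector_space scale
  for scale :: "complex \<Rightarrow> 'v::ab_group_add \<Rightarrow> 'v" +
  fixes s :: "ix \<Rightarrow> int"
    and gr :: "bit \<Rightarrow> 'v set"
    and t :: "ix \<Rightarrow> ix \<Rightarrow> nat \<Rightarrow> 'v \<Rightarrow> 'v"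
  assumes subspace_gr: "subspace (gr p)"
    and gr_disjoint: "gr 0 \<inter> gr 1 = {0}"
    and gr_sum: "\<exists>x\<in>gr 0. \<exists>y\<in>gr 1. v = x + y"
    and linear_t: "Vector_Spaces.linear scale scale (t i j r)"
    and parity_t: "v \<in> gr p \<Longrightarrow> t i j r v \<in> gr (par s i + par s j + p)"
    and t_0: "t i j 0 v = (if i = j then v else 0)"
    and rtt: "scomm scale (par s i + par s j) (par s k + par s l) (t i j (Suc r)) (t k l m) v
            - scomm scale (par s i + par s j) (par s k + par s l) (t i j r) (t k l (Suc m)) v
            = scale (msign (par s i * par s j + par s i * par s k + par s j * par s k))
                (t k j r (t i l m v) - t k j m (t i l r v))"

text \<open>
  The identification of the super Yangians for \<open>s\<close> and \<open>s \<circ> flip\<close>: the operators \<open>relabel t\<close>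
  are the generators of the super Yangian for \<open>s \<circ> flip\<close> acting on the same module.
\<close>

definition relabel :: "(ix \<Rightarrow> ix \<Rightarrow> nat \<Rightarrow> 'v \<Rightarrow> 'v) \<Rightarrow> ix \<Rightarrow> ix \<Rightarrow> nat \<Rightarrow> 'v \<Rightarrow> 'v"
  where "relabel t i j = t (flip i) (flip j)"

lemma (in yangian_module) yangian_module_relabel:
  "yangian_module scale (s \<circ> flip) gr (relabel t)"
proof -
  have par_flip: "par (s \<circ> flip) i = par s (flip i)" for i
    by (simp add: par_def)
  have flip_eq: "flip i = flip j \<longleftrightarrow> i = j" for i j
    by (cases i; cases j) auto
  show ?thesis
    unfolding yangian_module_def yangian_module_axioms_def relabel_def par_flip
    using vector_space_axioms subspace_gr gr_disjoint gr_sum linear_t parity_t rtt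
    by (intro conjI allI impI) (simp_all only: t_0 flip_eq)
qed

definition finite_dim :: "(complex \<Rightarrow> 'v::ab_group_add \<Rightarrow> 'v) \<Rightarrow> bool" where
  "finite_dim scale \<longleftrightarrow> (\<exists>B. finite B \<and> module.span scale B = UNIV)"

text \<open>Submodules are \<open>Z\<^sub>2\<close>-graded.\<close>

definition is_submodule ::
  "(complex \<Rightarrow> 'v::ab_group_add \<Rightarrow> 'v) \<Rightarrow> (bit \<Rightarrow> 'v set) \<Rightarrow> (ix \<Rightarrow> ix \<Rightarrow> nat \<Rightarrow> 'v \<Rightarrow> 'v) \<Rightarrow> 'v set \<Rightarrow> bool"
  where "is_submodule scale gr t N \<longleftrightarrow>
    module.subspace scale N \<and>
    (\<forall>v\<in>N. \<exists>x\<in>N \<inter> gr 0. \<exists>y\<in>N \<inter> gr 1. v = x + y) \<and>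
    (\<forall>i j r. \<forall>v\<in>N. t i j r v \<in> N)"

definition irreducible_module ::
  "(complex \<Rightarrow> 'v::ab_group_add \<Rightarrow> 'v) \<Rightarrow> (bit \<Rightarrow> 'v set) \<Rightarrow> (ix \<Rightarrow> ix \<Rightarrow> nat \<Rightarrow> 'v \<Rightarrow> 'v) \<Rightarrow> bool"
  where "irreducible_module scale gr t \<longleftrightarrow>
    (UNIV :: 'v set) \<noteq> {0} \<and> (\<forall>N. is_submodule scale gr t N \<longrightarrow> N = {0} \<or> N = UNIV)"

text \<open>
  Series in the inverse of \<open>u\<close> whose coefficients are operators are represented by their
  sequences of coefficients.
\<close>

definition ser_mult :: "(nat \<Rightarrow> 'v \<Rightarrow> 'v) \<Rightarrow> (nat \<Rightarrow> 'v \<Rightarrow> 'v) \<Rightarrow> nat \<Rightarrow> 'v \<Rightarrow> 'v::ab_group_add"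
  where "ser_mult A B n v = (\<Sum>k\<le>n. A k (B (n - k) v))"

definition ser_add :: "(nat \<Rightarrow> 'v \<Rightarrow> 'v) \<Rightarrow> (nat \<Rightarrow> 'v \<Rightarrow> 'v) \<Rightarrow> nat \<Rightarrow> 'v \<Rightarrow> 'v::ab_group_add"
  where "ser_add A B n v = A n v + B n v"

definition gauss_decomp ::
  "(ix \<Rightarrow> ix \<Rightarrow> nat \<Rightarrow> 'v \<Rightarrow> 'v::ab_group_add) \<Rightarrow> (ix \<Rightarrow> nat \<Rightarrow> 'v \<Rightarrow> 'v) \<Rightarrow>
   (nat \<Rightarrow> 'v \<Rightarrow> 'v) \<Rightarrow> (nat \<Rightarrow> 'v \<Rightarrow> 'v) \<Rightarrow> bool"
  where "gauss_decomp t d e f \<longleftrightarrow>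
    t One One = d One \<and>
    t One Two = ser_mult (d One) e \<and>
    t Two One = ser_mult f (d One) \<and>
    t Two Two = ser_add (d Two) (ser_mult (ser_mult f (d One)) e)"

definition gauss_d :: "(ix \<Rightarrow> ix \<Rightarrow> nat \<Rightarrow> 'v \<Rightarrow> 'v::ab_group_add) \<Rightarrow> ix \<Rightarrow> nat \<Rightarrow> 'v \<Rightarrow> 'v"
  where "gauss_d t = (THE d. \<exists>e f. gauss_decomp t d e f)"

lemma ser_right_divide: "\<exists>f. b = ser_mult f a" if "a 0 = id" for a b :: "nat \<Rightarrow> 'v \<Rightarrow> 'v::ab_group_add"
proof -
  define F where "F = (\<lambda>rec n v. b n v - (\<Sum>k<n. (rec k :: 'v \<Rightarrow> 'v) (a (n - k) v)))"
  define f where "f = wfrec {(k, n::nat). k < n} F"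
  have f: "f n = F f n" for n
    unfolding f_def
    by (rule trans[OF wfrec[OF wf_less]]) (auto simp: F_def fun_eq_iff cut_def intro!: sum.cong)
  have "b = ser_mult f a"
  proof (intro ext)
    fix n v
    have "ser_mult f a n v = (\<Sum>k<n. f k (a (n - k) v)) + f n v"
      by (simp add: ser_mult_def that flip: lessThan_Suc_atMost)
    then show "b n v = ser_mult f a n v"
      using f[of n] by (simp add: F_def)
  qed
  then show ?thesis by blast
qed

lemma ser_left_divide: "\<exists>!e. b = ser_mult a e" if "a 0 = id" for a b :: "nat \<Rightarrow> 'v \<Rightarrow> 'v::ab_group_add"
proof -
  have split: "ser_mult a e n v = e n v + (\<Sum>k=1..n. a k (e (n - k) v))" for e n v
    by (simp add: ser_mult_def that atMost_atLeast0 sum.atLeast_Suc_atMost)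
  define F where "F = (\<lambda>rec n v. b n v - (\<Sum>k=1..n. a k ((rec (n - k) :: 'v \<Rightarrow> 'v) v)))"
  define e where "e = wfrec {(k, n::nat). k < n} F"
  have e: "e n = F e n" for n
    unfolding e_def
    by (rule trans[OF wfrec[OF wf_less]]) (auto simp: F_def fun_eq_iff cut_def intro!: sum.cong)
  show ?thesis
  proof
    show "b = ser_mult a e"
    proof (intro ext)
      fix n v show "b n v = ser_mult a e n v"
        unfolding split using e[of n] by (simp add: F_def)
    qed
  next
    fix e' assume e': "b = ser_mult a e'"
    have "e' n = e n" for n
    proof (induction n rule: less_induct)
      case (less n)
      show ?case
      proof
        fix v
        have "(\<Sum>k=1..n. a k (e' (n - k) v)) = (\<Sum>k=1..n. a k (e (n - k) v))"
          by (rule sum.cong) (use less in auto)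
        moreover have "b n v = e' n v + (\<Sum>k=1..n. a k (e' (n - k) v))"
          by (subst e') (rule split)
        ultimately show "e' n v = e n v"
          using e[of n] by (simp add: F_def)
      qed
    qed
    then show "e' = e" ..
  qed
qed

lemma (in yangian_module) gauss_d_unique: "\<exists>!d. \<exists>e f. gauss_decomp t d e f"
proof -
  have id: "t One One 0 = id" by (simp add: t_0 fun_eq_iff)
  have ex1: "\<exists>!e. t One Two = ser_mult (t One One) e"
    by (rule ser_left_divide) (rule id)
  then obtain e where e: "t One Two = ser_mult (t One One) e" by (rule ex1E)
  have "\<exists>f. t Two One = ser_mult f (t One One)"
    by (rule ser_right_divide) (rule id)
  then obtain f where f: "t Two One = ser_mult f (t One One)" by (rule exE)
  define d where "d = case_ix (t One One) (\<lambda>n v. t Two Two n v - ser_mult (t Two One) e n v)"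
  have d: "d One = t One One" "d Two = (\<lambda>n v. t Two Two n v - ser_mult (t Two One) e n v)"
    by (simp_all only: d_def ix.case)
  have "t Two Two = ser_add (d Two) (ser_mult (t Two One) e)"
    by (intro ext) (simp only: ser_add_def d diff_add_cancel)
  then have "gauss_decomp t d e f"
    unfolding gauss_decomp_def d(1) f[symmetric] using e by (intro conjI refl)
  moreover have "d' = d" if "gauss_decomp t d' e' f'" for d' e' f'
  proof -
    have d'1: "d' One = t One One" and e': "t One Two = ser_mult (d' One) e'"
      and f': "t Two One = ser_mult f' (d' One)"
      and d'2: "t Two Two = ser_add (d' Two) (ser_mult (ser_mult f' (d' One)) e')"
      using that unfolding gauss_decomp_def by (elim conjE, simp only:)+
    have "e' = e" using ex1 e e'[unfolded d'1] by blast
    have "d' Two n v = d Two n v" for n v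
      using fun_cong[OF fun_cong[OF d'2], of n v]
      unfolding f'[symmetric] \<open>e' = e\<close> d ser_add_def by (simp only: add_diff_cancel)
    then have "d' Two = d Two" by (intro ext)
    show "d' = d"
    proof
      fix i show "d' i = d i"
        by (cases i) (simp_all only: d'1 d(1) \<open>d' Two = d Two\<close>)
    qed
  qed
  ultimately show ?thesis by blast
qed

text \<open>
  Formal Laurent series are series in the inverse of \<open>u\<close>, so that \<^const>\<open>fls_X_inv\<close> stands
  for \<open>u\<close>. \<open>inf_expand p\<close> is the polynomial \<open>p(u)\<close> as such a series, and a quotient
  of two of these is the expansion of the rational function at infinity.
\<close>

definition inf_expand :: "complex poly \<Rightarrow> complex fls" where
  "inf_expand p = poly (map_poly fls_const p) fls_X_inv"

definition one_plus_series :: "complex fls set" where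
  "one_plus_series = fps_to_fls ` {g. fps_nth g 0 = 1}"

lemma one_plus_series_one: "1 \<in> one_plus_series"
  unfolding one_plus_series_def by (rule image_eqI[of _ _ 1]) auto

lemma one_plus_series_mult:
  "f \<in> one_plus_series \<Longrightarrow> g \<in> one_plus_series \<Longrightarrow> f * g \<in> one_plus_series"
  unfolding one_plus_series_def
  by (auto simp: fls_times_fps_to_fls[symmetric] intro!: imageI)

lemma one_plus_series_nonzero: "f \<in> one_plus_series \<Longrightarrow> f \<noteq> 0"
  unfolding one_plus_series_def by auto

lemma one_plus_series_inverse: "f \<in> one_plus_series \<Longrightarrow> inverse f \<in> one_plus_series"
proof -
  assume "f \<in> one_plus_series"
  then obtain g where g: "f = fps_to_fls g" "fps_nth g 0 = 1"
    unfolding one_plus_series_def by auto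
  have "f * fps_to_fls (inverse g) = 1"
    using g by (simp add: fls_times_fps_to_fls[symmetric] inverse_mult_eq_1')
  then have "inverse f = fps_to_fls (inverse g)"
    by (rule inverse_unique)
  with g show ?thesis
    unfolding one_plus_series_def by auto
qed

typedef lweight = "{\<zeta> :: ix \<Rightarrow> complex fls. \<forall>i. \<zeta> i \<in> one_plus_series}"
  morphisms lcomp Abs_lweight
  by (rule exI[of _ "\<lambda>_. 1"]) (simp add: one_plus_series_one)

setup_lifting type_definition_lweight

text \<open>
  The multiplicative group of \<open>\<ell>\<close>-weights is written additively (\<open>+\<close> is the
  componentwise product), since the group ring with integer coefficients is then the type
  \<^typ>\<open>lweight \<Rightarrow>\<^sub>0 int\<close> with its convolution product; the basis element of \<open>\<zeta>\<close>
  is \<open>Poly_Mapping.single \<zeta> 1\<close>.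
\<close>

instantiation lweight :: ab_group_add
begin

lift_definition zero_lweight :: lweight is "\<lambda>_. 1"
  by (simp add: one_plus_series_one)

lift_definition plus_lweight :: "lweight \<Rightarrow> lweight \<Rightarrow> lweight" is "\<lambda>\<zeta> \<xi> i. \<zeta> i * \<xi> i"
  by (simp add: one_plus_series_mult)

lift_definition uminus_lweight :: "lweight \<Rightarrow> lweight" is "\<lambda>\<zeta> i. inverse (\<zeta> i)"
  by (simp add: one_plus_series_inverse)

lift_definition minus_lweight :: "lweight \<Rightarrow> lweight \<Rightarrow> lweight" is "\<lambda>\<zeta> \<xi> i. \<zeta> i / \<xi> i"
  by (simp add: divide_inverse one_plus_series_mult one_plus_series_inverse)

instance
proof
  fix a b c :: lweight
  show "a + b + c = a + (b + c)" by transfer (simp add: mult.assoc)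
  show "a + b = b + a" by transfer (simp add: mult.commute)
  show "0 + a = a" by transfer simp
  show "- a + a = 0" by transfer (auto simp: fun_eq_iff one_plus_series_nonzero)
  show "a - b = a + - b" by transfer (simp add: divide_inverse)
qed

end

text \<open>The \<open>\<ell>\<close>-weight \<open>(f, g)\<close>; meaningful only if \<open>f\<close> and \<open>g\<close> have constant term 1.\<close>

definition lw :: "complex fls \<Rightarrow> complex fls \<Rightarrow> lweight" where
  "lw f g = Abs_lweight (\<lambda>i. case i of One \<Rightarrow> f | Two \<Rightarrow> g)"

definition basis_elt :: "lweight \<Rightarrow> (lweight \<Rightarrow>\<^sub>0 int)" where
  "basis_elt \<zeta> = Poly_Mapping.single \<zeta> 1"

definition A_weight :: "(ix \<Rightarrow> int) \<Rightarrow> complex \<Rightarrow> lweight" where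
  "A_weight s a =
    (let q = inf_expand [:- a, 1:] / inf_expand [:- a - of_int (s One), 1:] in lw q q)"

definition lw_greater :: "(ix \<Rightarrow> int) \<Rightarrow> lweight \<Rightarrow> lweight \<Rightarrow> bool" where
  "lw_greater s \<nu> \<mu> \<longleftrightarrow> (\<exists>as. as \<noteq> [] \<and> \<nu> = \<mu> + sum_list (map (A_weight s) as))"

text \<open>
  Both notions depend on the parity sequence only through the generators \<open>t\<close> used in the
  Gauss decomposition: for a module with generators \<open>t\<close> with respect to \<open>s\<close>, the
  \<open>q\<close>-character with respect to \<open>s\<close> is \<open>qchar scale t\<close> and the one with respect to \<open>s \<circ> flip\<close>
  is \<open>qchar scale (relabel t)\<close>.
\<close>

definition lweight_space ::
  "(complex \<Rightarrow> 'v::ab_group_add \<Rightarrow> 'v) \<Rightarrow> (ix \<Rightarrow> ix \<Rightarrow> nat \<Rightarrow> 'v \<Rightarrow> 'v) \<Rightarrow> lweight \<Rightarrow> 'v set"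
  where "lweight_space scale t \<zeta> =
    {v. \<forall>i. \<forall>r\<ge>1. ((\<lambda>w. gauss_d t i r w - scale (fls_nth (lcomp \<zeta> i) (int r)) w)
                      ^^ vector_space.dim scale (UNIV :: 'v set)) v = 0}"

definition qchar ::
  "(complex \<Rightarrow> 'v::ab_group_add \<Rightarrow> 'v) \<Rightarrow> (ix \<Rightarrow> ix \<Rightarrow> nat \<Rightarrow> 'v \<Rightarrow> 'v) \<Rightarrow> (lweight \<Rightarrow>\<^sub>0 int)"
  where "qchar scale t =
    (\<Sum>\<zeta> | lweight_space scale t \<zeta> \<noteq> {0}.
       of_nat (vector_space.dim scale (lweight_space scale t \<zeta>)) * basis_elt \<zeta>)"

definition shift_poly :: "complex poly \<Rightarrow> complex \<Rightarrow> complex poly"  \<comment> \<open>\<open>p(u - c)\<close>\<close>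
  where "shift_poly p c = pcompose p [:- c, 1:]"

text \<open>
  One pass through Steps (1) and (2), for any admissible choice of \<open>\<zeta>\<close> and any
  numbering of the roots \<open>- a i\<close> of \<open>\<phi>\<close> and \<open>b i\<close> of \<open>\<psi>\<close>. The degrees of \<open>\<phi>\<close> and \<open>\<psi>\<close> agree
  because the components of \<open>\<zeta>\<close> have constant term 1.
\<close>

inductive q_step ::
  "(ix \<Rightarrow> int) \<Rightarrow> (lweight \<Rightarrow>\<^sub>0 int) \<times> (lweight \<Rightarrow>\<^sub>0 int) \<Rightarrow> (lweight \<Rightarrow>\<^sub>0 int) \<times> (lweight \<Rightarrow>\<^sub>0 int) \<Rightarrow> bool"
  for s :: "ix \<Rightarrow> int"
  where
  "q_step s (Q, R)
     (Q - (\<Sum>J\<in>Pow {1..k}. basis_elt \<zeta> *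
             basis_elt (lw (inf_expand (shift_poly (\<phi>J J) (of_int (s One))) / inf_expand (\<phi>J J))
                           (inf_expand (shift_poly (\<phi>J J) (of_int (s One))) / inf_expand (\<phi>J J)))),
      R + (\<Sum>J\<in>Pow {1..k}.
             basis_elt (lw (lcomp \<zeta> Two * (inf_expand (shift_poly \<psi> (of_int (s One))) / inf_expand \<psi>))
                           (lcomp \<zeta> One * (inf_expand (shift_poly \<phi> (of_int (s One))) / inf_expand \<phi>))) *
             basis_elt (lw (inf_expand (\<psi>J J) / inf_expand (shift_poly (\<psi>J J) (of_int (s One))))
                           (inf_expand (\<psi>J J) / inf_expand (shift_poly (\<psi>J J) (of_int (s One)))))))"
  if "Poly_Mapping.lookup Q \<zeta> > 0"
    and "\<And>\<xi>. Poly_Mapping.lookup Q \<xi> > 0 \<Longrightarrow> \<not> lw_greater s \<xi> \<zeta>"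
    and "lead_coeff \<phi> = 1" and "lead_coeff \<psi> = 1" and "coprime \<phi> \<psi>"
    and "lcomp \<zeta> One / lcomp \<zeta> Two = inf_expand \<phi> / inf_expand \<psi>"
    and "k = degree \<phi>"
    and "\<phi> = (\<Prod>i\<in>{1..k}. [:a i, 1:])" and "\<psi> = (\<Prod>i\<in>{1..k}. [:- b i, 1:])"
    and "\<phi>J = (\<lambda>J. \<Prod>i\<in>J. [:a i, 1:])" and "\<psi>J = (\<lambda>J. \<Prod>i\<in>J. [:- b i, 1:])"
  for \<zeta> :: lweight and \<phi> \<psi> :: "complex poly" and k :: nat and a b :: "nat \<Rightarrow> complex"
    and \<phi>J \<psi>J :: "nat set \<Rightarrow> complex poly"

end

(*
  The Gauss decomposition turns the defining relations into: h = d_1^{-1} d_2 is central, the modes F_j of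
  f and E_i of e are fermions with {E_i, F_j} = s_1 h_{i+j+1}, and d_1(u) f[(u-x)p] = f[(u-s_1-x)p] d_1(u), where
  f[p] = sum_j p_j F_j. On an irreducible module M with highest weight vector v, h is a scalar psi/phi in lowest
  terms and f[phi] = 0, so M is the Fock space of the Newton basis g_i = f[(x-x_1)...(x-x_{i-1})] for the roots
  x_1, ..., x_k of phi, and d_1 is triangular in the monomials g_J v: each g_i multiplies its eigenvalue by
  (u-x_i-s_1)/(u-x_i). This gives the q-character. The lowest vector g_1...g_k v is a highest weight vector for the
  other parity sequence, and solving the t_21-e relation on it gives its weight. As M has a single maximal
  weight, the procedure stops after one step.
*)
theory Submission
  imports Defs
begin

text \<open>The relations are handled as identities between series in two variables over an
  arbitrary ring, where u_1 - u_2, after multiplication by the inverses of u_1 and u_2, is central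
  and can be cancelled; the Gauss decomposition is then a matter of noncommutative polynomial
  identities. The fermionic relations appear only after comparing coefficients, because reordering
  leaves squares of f and e behind. Irreducibility is used to make h a scalar, to make f[phi]
  vanish, and to show that the monomials span. Their independence rests on coprimality instead: psi
  is invertible modulo phi, and this provides annihilation operators dual to the g_i. The Newton
  polynomials are chosen because multiplication by u is triangular on them; phi may have repeated
  roots, so no eigenbasis is assumed, and the dimensions of generalised eigenspaces are counted
  along a flag. The weight of the lowest vector for the other parity sequence involves t_22, which
  is not diagonal on M. It is found from the eigenvalues of t_21(u) E_m for all m together, which
  satisfy a recursion with an explicit rational solution.\<close>

unbundle fps_syntax

section \<open>Noncommutative identities behind the Gauss decomposition\<close>

text \<open>\<open>\<delta>\<close> stands for u_1 - u_2 and \<open>\<eta>\<close> for the sign s_1,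
  both divided by u_1 u_2. In the lemmas below, think of unprimed letters as series in u_1 and of
  primed ones as series in u_2; \<open>a\<close> and \<open>a'\<close> are inverses of
  \<open>A\<close> and \<open>A'\<close>.\<close>

locale central_pair =
  fixes \<delta> \<eta> :: "'a::ring_1"
  assumes delta_central: "x * \<delta> = \<delta> * x"
    and eta_central: "x * \<eta> = \<eta> * x"
begin

text \<open>\<open>NO_MATCH\<close> keeps the rules from permuting the two central elements forever;
  the last two equations put \<open>\<delta>\<close> before \<open>\<eta>\<close>.\<close>

lemma central_moves:
  "NO_MATCH \<delta> x \<Longrightarrow> NO_MATCH \<eta> x \<Longrightarrow> x * \<delta> = \<delta> * x"
  "NO_MATCH \<delta> x \<Longrightarrow> NO_MATCH \<eta> x \<Longrightarrow> x * \<eta> = \<eta> * x"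
  "NO_MATCH \<delta> x \<Longrightarrow> NO_MATCH \<eta> x \<Longrightarrow> x * (\<delta> * y) = \<delta> * (x * y)"
  "NO_MATCH \<delta> x \<Longrightarrow> NO_MATCH \<eta> x \<Longrightarrow> x * (\<eta> * y) = \<eta> * (x * y)"
  "\<eta> * \<delta> = \<delta> * \<eta>" "\<eta> * (\<delta> * y) = \<delta> * (\<eta> * y)"
  by (metis delta_central eta_central mult.assoc)+

lemmas expand = distrib_left distrib_right left_diff_distrib right_diff_distrib mult.assoc central_moves

text \<open>This is the (11,21) relation with t_21 written as \<open>f * A\<close>. Since
  \<open>A\<close> and \<open>A'\<close> commute, every term ends in \<open>A'\<close>, which is
  cancelled on the right.\<close>

lemma d_f_relation:
  assumes r: "\<delta> * (A * (f' * A') - f' * A' * A) = \<eta> * (f * A * A' - f' * A' * A)"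
    and AA: "A' * A = A * A'" and a': "A' * a' = 1"
  shows "\<delta> * (A * f') = (\<delta> - \<eta>) * (f' * A) + \<eta> * (f * A)"
proof -
  have c: "x * A * A' * a' = x * A" for x
    using a' by (simp add: mult.assoc)
  have c': "A * (f' * A') * a' = A * f'"
    using a' by (simp add: mult.assoc)
  have "\<delta> * (A * (f' * A') - f' * A * A') * a' = \<eta> * (f * A * A' - f' * A * A') * a'"
    using r AA by (simp add: mult.assoc)
  then have "\<delta> * (A * f' - f' * A) = \<eta> * (f * A - f' * A)"
    by (simp only: left_diff_distrib mult.assoc[of \<delta>] mult.assoc[of \<eta>] c c')
  then show ?thesis by (simp add: algebra_simps)
qed

text \<open>The mirror image: every term of the (11,12) relation begins with
  \<open>A'\<close>.\<close>

lemma d_e_relation: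
  assumes r: "\<delta> * (A * (A' * e') - A' * e' * A) = \<eta> * (A * (A' * e') - A' * (A * e))"
    and AA: "A' * A = A * A'" and a': "a' * A' = 1"
  shows "\<delta> * (e' * A) = (\<delta> - \<eta>) * (A * e') + \<eta> * (A * e)"
proof -
  have c: "a' * (A' * (A * x)) = A * x" "a' * (A' * (e' * A)) = e' * A" for x
    using a' by (simp_all flip: mult.assoc)
  have "a' * (\<delta> * (A' * (A * e') - A' * (e' * A))) = a' * (\<eta> * (A' * (A * e') - A' * (A * e)))"
    using r AA by (simp flip: mult.assoc)
  then have "\<delta> * (A * e' - e' * A) = \<eta> * (A * e' - A * e)"
    by (simp add: expand c)
  then show ?thesis by (simp add: algebra_simps)
qed

text \<open>Subtracting from the (11,22) relation the \<open>f\<close> relation times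
  \<open>A' * e'\<close> and adding the \<open>e\<close> relation multiplied on the left by
  \<open>f' * A'\<close> leaves nothing but the commutator.\<close>

lemma d1_d2_commute:
  assumes f: "\<delta> * (A * f') = (\<delta> - \<eta>) * (f' * A) + \<eta> * (f * A)"
    and e: "\<delta> * (e' * A) = (\<delta> - \<eta>) * (A * e') + \<eta> * (A * e)"
    and AA: "A' * A = A * A'"
    and r: "\<delta> * (A * (d' + f' * A' * e') - (d' + f' * A' * e') * A)
      = \<eta> * (f * A * (A' * e') - f' * A' * (A * e))"
  shows "\<delta> * (A * d' - d' * A) = 0"
proof -
  have AA3: "A' * (A * x) = A * (A' * x)" for x
    using AA by (metis mult.assoc)
  have "\<delta> * (A * d' - d' * A) =
    (\<delta> * (A * (d' + f' * A' * e') - (d' + f' * A' * e') * A)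
      - \<eta> * (f * A * (A' * e') - f' * A' * (A * e)))
    - (\<delta> * (A * f') - (\<delta> - \<eta>) * (f' * A) - \<eta> * (f * A)) * (A' * e')
    + f' * A' * (\<delta> * (e' * A) - (\<delta> - \<eta>) * (A * e') - \<eta> * (A * e))"
    by (simp add: expand AA3)
  also have "\<dots> = 0" using f e r by simp
  finally show ?thesis .
qed

text \<open>Moving \<open>A\<close> past \<open>f'\<close> or \<open>e'\<close> is possible only in
  the presence of a factor \<open>\<delta>\<close>, so the (12,21) relation is multiplied by
  \<open>\<delta>\<close> once more before it is simplified; \<open>cancel\<close> removes the
  surplus factor.\<close>

lemma e_f_anticommutator:
  assumes f: "\<delta> * (A * f') = (\<delta> - \<eta>) * (f' * A) + \<eta> * (f * A)"
    and e: "\<delta> * (e' * A) = (\<delta> - \<eta>) * (A * e') + \<eta> * (A * e)"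
    and e': "\<delta> * (e * A') = (\<delta> + \<eta>) * (A' * e) - \<eta> * (A' * e')"
    and AA: "A' * A = A * A'"
    and d': "d' * A = A * d'" and dd: "d' * A' = A' * d'"
    and r: "\<delta> * (A * e * (f' * A') + f' * A' * (A * e))
      = - (\<eta> * ((d + f * A * e) * A' - (d' + f' * A' * e') * A))"
    and a: "a * A = 1" and a': "A' * a' = 1" "a' * A' = 1"
    and cancel: "\<And>x. \<delta> * x = 0 \<Longrightarrow> x = 0"
  shows "\<delta> * (e * f' + f' * e) = - (\<eta> * (a * d - a' * d'))"
proof -
  have AA3: "A' * (A * x) = A * (A' * x)" for x
    using AA by (metis mult.assoc)
  have "\<delta> * (\<delta> * (A * (e * f' + f' * e) * A') + \<eta> * (d * A' - d' * A)) =
    \<delta> * (\<delta> * (A * e * (f' * A') + f' * A' * (A * e))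
      + \<eta> * ((d + f * A * e) * A' - (d' + f' * A' * e') * A))
    + \<eta> * (f' * A' * (\<delta> * (e' * A) - (\<delta> - \<eta>) * (A * e') - \<eta> * (A * e)))
    + \<delta> * ((\<delta> * (A * f') - (\<delta> - \<eta>) * (f' * A) - \<eta> * (f * A)) * (e * A'))
    + (\<delta> - \<eta>) * (f' * A * (\<delta> * (e * A') - (\<delta> + \<eta>) * (A' * e) + \<eta> * (A' * e')))"
    by (simp add: expand AA3)
  also have "\<dots> = 0" using f e e' r by simp
  finally have "\<delta> * (A * (e * f' + f' * e) * A') + \<eta> * (d * A' - d' * A) = 0"
    by (rule cancel)
  then have "a * (\<delta> * (A * (e * f' + f' * e) * A') + \<eta> * (d * A' - A * d')) * a' = 0"
    using d' by simp
  moreover have "a * (\<delta> * (A * x * A') + \<eta> * (d * A' - A * d')) * a'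
      = \<delta> * x + \<eta> * (a * d - d' * a')" for x
  proof -
    have "a * (A * y) = y" for y using a by (simp flip: mult.assoc)
    then show ?thesis using a' by (simp add: expand)
  qed
  moreover have "d' * a' = a' * d'"
    using a' dd by (metis mult.assoc mult_1 mult.right_neutral)
  ultimately show ?thesis by (simp add: add_eq_0_iff)
qed

text \<open>Reordering produces the squares of \<open>f\<close> and \<open>f'\<close> next to the
  anticommutator. Getting rid of them is left to the comparison of coefficients in
  \<open>series_anticommute_nth\<close>.\<close>

lemma f_f_relation:
  assumes f: "\<delta> * (A * f') = (\<delta> - \<eta>) * (f' * A) + \<eta> * (f * A)"
    and f': "\<delta> * (A' * f) = (\<delta> + \<eta>) * (f * A') - \<eta> * (f' * A')"
    and AA: "A' * A = A * A'"
    and r: "\<delta> * (f * A * (f' * A') + f' * A' * (f * A)) = - (\<eta> * (f * A * (f' * A') - f' * A' * (f * A)))"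
    and a: "A * a = 1" "A' * a' = 1"
  shows "(\<delta> * \<delta> - \<eta> * \<eta>) * (f * f' + f' * f) + \<eta> * (\<delta> + \<eta>) * (f * f) - \<eta> * (\<delta> - \<eta>) * (f' * f') = 0"
proof -
  have AA3: "A' * (A * x) = A * (A' * x)" for x
    using AA by (metis mult.assoc)
  let ?T = "(\<delta> * \<delta> - \<eta> * \<eta>) * (f * f' + f' * f) + \<eta> * (\<delta> + \<eta>) * (f * f) - \<eta> * (\<delta> - \<eta>) * (f' * f')"
  have "?T * A * A' =
    \<delta> * (\<delta> * (f * A * (f' * A') + f' * A' * (f * A)) + \<eta> * (f * A * (f' * A') - f' * A' * (f * A)))
    - (\<delta> + \<eta>) * (f * (\<delta> * (A * f') - (\<delta> - \<eta>) * (f' * A) - \<eta> * (f * A)) * A')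
    - (\<delta> - \<eta>) * (f' * (\<delta> * (A' * f) - (\<delta> + \<eta>) * (f * A') + \<eta> * (f' * A')) * A)"
    by (simp add: expand AA3 AA)
  also have "\<dots> = 0" using f f' r by simp
  finally have "?T * A * A' * a' * a = 0" by simp
  moreover have "x * A * A' * a' * a = x" for x
    using a by (metis mult.assoc mult.right_neutral)
  ultimately show ?thesis by simp
qed

lemma e_e_relation:
  assumes e: "\<delta> * (e' * A) = (\<delta> - \<eta>) * (A * e') + \<eta> * (A * e)"
    and e': "\<delta> * (e * A') = (\<delta> + \<eta>) * (A' * e) - \<eta> * (A' * e')"
    and AA: "A' * A = A * A'"
    and r: "\<delta> * (A * e * (A' * e') + A' * e' * (A * e)) = \<eta> * (A * e * (A' * e') - A' * e' * (A * e))"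
    and a: "a * A = 1" "a' * A' = 1"
  shows "(\<delta> * \<delta> - \<eta> * \<eta>) * (e * e' + e' * e) + \<eta> * (\<delta> + \<eta>) * (e * e) - \<eta> * (\<delta> - \<eta>) * (e' * e') = 0"
proof -
  have AA3: "A' * (A * x) = A * (A' * x)" for x
    using AA by (metis mult.assoc)
  let ?T = "(\<delta> * \<delta> - \<eta> * \<eta>) * (e * e' + e' * e) + \<eta> * (\<delta> + \<eta>) * (e * e) - \<eta> * (\<delta> - \<eta>) * (e' * e')"
  have "A * (A' * ?T) =
    \<delta> * (\<delta> * (A * e * (A' * e') + A' * e' * (A * e)) - \<eta> * (A * e * (A' * e') - A' * e' * (A * e)))
    - (\<delta> - \<eta>) * (A * (\<delta> * (e * A') - (\<delta> + \<eta>) * (A' * e) + \<eta> * (A' * e')) * e')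
    - (\<delta> + \<eta>) * (A' * (\<delta> * (e' * A) - (\<delta> - \<eta>) * (A * e') - \<eta> * (A * e)) * e)"
    by (simp add: expand AA3 AA)
  also have "\<dots> = 0" using e e' r by simp
  finally have "a' * (a * (A * (A' * ?T))) = 0" by simp
  moreover have "a' * (a * (A * (A' * x))) = x" for x
    using a by (metis mult.assoc mult_1)
  ultimately show ?thesis by simp
qed

text \<open>Here \<open>C\<close> is kept whole instead of being factored, so that the result can be
  evaluated on a vector killed by t_21. The (21,11) relation, multiplied by \<open>e'\<close>,
  eliminates \<open>C'\<close>.\<close>

lemma t21_e_relation:
  assumes r: "\<delta> * (C * (A' * e') + A' * e' * C) = \<eta> * (A * (d' + C' * e') - A' * D)"
    and r': "\<delta> * (C * A' - A' * C) = \<eta> * (A * C' - A' * C)"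
    and d': "d' * A = A * d'" and a': "a' * A' = 1"
  shows "(\<delta> - \<eta>) * (C * e') + \<delta> * (e' * C) = \<eta> * (a' * d' * A - D)"
proof -
  have "A' * ((\<delta> - \<eta>) * (C * e') + \<delta> * (e' * C) + \<eta> * D) - \<eta> * (A * d') =
    (\<delta> * (C * (A' * e') + A' * e' * C) - \<eta> * (A * (d' + C' * e') - A' * D))
    - (\<delta> * (C * A' - A' * C) - \<eta> * (A * C' - A' * C)) * e'"
    by (simp add: expand)
  also have "\<dots> = 0" using r r' by simp
  finally have "a' * (A' * ((\<delta> - \<eta>) * (C * e') + \<delta> * (e' * C) + \<eta> * D)) = a' * (\<eta> * (A * d'))"
    by simp
  moreover have "a' * (A' * x) = x" for x
    using a' by (simp flip: mult.assoc)
  ultimately show ?thesis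
    by (simp add: expand d' eq_diff_eq)
qed

end

section \<open>Formal series in two variables\<close>

text \<open>
  Series in \<open>X = u\<^sub>1\<^sup>-\<^sup>1\<close> and \<open>Y = u\<^sub>2\<^sup>-\<^sup>1\<close>: the outer variable is \<open>Y\<close>. The factor
  \<open>u\<^sub>1 - u\<^sub>2\<close> becomes \<open>Y - X\<close> after multiplication by \<open>XY\<close>.
\<close>

definition outer_series :: "'r::ring_1 fps \<Rightarrow> 'r fps fps" where
  "outer_series a = Abs_fps (\<lambda>m. fps_const (a $ m))"

lemma outer_series_nth [simp]: "(outer_series a) $ m = fps_const (a $ m)"
  by (simp add: outer_series_def)

lemma outer_series_1: "outer_series 1 = 1"
  by (rule fps_ext) simp

lemma outer_series_add: "outer_series (a + b) = outer_series a + outer_series b"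
  by (rule fps_ext) simp

lemma outer_series_mult: "outer_series (a * b) = outer_series a * outer_series b"
proof (rule fps_ext)
  fix n
  have "fps_const (sum f {0..n}) = (\<Sum>i=0..n. fps_const (f i))" for f :: "nat \<Rightarrow> 'a"
    by (induction n) (simp_all flip: fps_const_add)
  then show "(outer_series (a * b)) $ n = (outer_series a * outer_series b) $ n"
    by (simp add: fps_mult_nth fps_const_mult)
qed

lemma fps_const_mult_outer_nth [simp]:
  "((fps_const a * outer_series b) $ m) $ r = a $ r * b $ m"
  "((outer_series b * fps_const a) $ m) $ r = b $ m * a $ r"
  by simp_all

definition series_diff :: "'r::ring_1 fps fps" where
  "series_diff = fps_X - fps_const fps_X"

definition series_eta :: "int \<Rightarrow> 'r::ring_1 fps fps" where
  "series_eta \<epsilon> = of_int \<epsilon> * (fps_const fps_X * fps_X)"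

lemma of_int_mult_comm: "x * of_int k = of_int k * (x::'a::ring_1)"
  by (metis mult_of_int_commute)

lemma fps_const_X_central: "x * fps_const fps_X = fps_const fps_X * (x::'r::ring_1 fps fps)"
  by (simp add: fps_eq_iff flip: fps_mult_fps_X_commute)

interpretation series: central_pair series_diff "series_eta \<epsilon>" for \<epsilon>
proof
  fix x :: "'r::ring_1 fps fps"
  show "x * series_diff = series_diff * x"
    by (simp add: series_diff_def algebra_simps fps_const_X_central fps_mult_fps_X_commute)
  have "x * (fps_const fps_X * fps_X) = fps_const fps_X * fps_X * x"
    by (metis fps_const_X_central fps_mult_fps_X_commute mult.assoc)
  then show "x * series_eta \<epsilon> = series_eta \<epsilon> * x"
    unfolding series_eta_def by (metis of_int_mult_comm mult.assoc)
qed

text \<open>Exchanging u_1 and u_2 negates u_1 - u_2. With this pair the identities above also give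
  the relations with primed and unprimed letters interchanged.\<close>

lemma central_pair_swap: "central_pair (- series_diff) (series_eta \<epsilon>)"
  by unfold_locales (simp_all add: series.delta_central series.eta_central)

lemma series_diff_nth:
  "((series_diff * x) $ m) $ r =
    (if m = 0 then 0 else (x $ (m - 1)) $ r) - (if r = 0 then 0 else (x $ m) $ (r - 1))"
  by (simp add: series_diff_def left_diff_distrib)

lemma series_eta_nth:
  "((series_eta \<epsilon> * x) $ m) $ r =
    (if m = 0 \<or> r = 0 then 0 else of_int \<epsilon> * (x $ (m - 1)) $ (r - 1))"
  by (simp add: series_eta_def mult.assoc)

text \<open>Multiplication by \<open>series_diff\<close> and \<open>series_eta\<close> shifts the
  indices by one, so the coefficientwise relation gives all equations with positive indices; the
  vanishing border of \<open>G\<close> takes care of the others.\<close>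

lemma series_relationI:
  assumes "\<And>m. (G $ m) $ 0 = 0" "\<And>r. (G $ 0) $ r = 0"
    and "\<And>m r. (G $ m) $ Suc r - (G $ Suc m) $ r = of_int \<epsilon> * (K $ m) $ r"
  shows "series_diff * G = series_eta \<epsilon> * (K :: 'r::ring_1 fps fps)"
proof (intro fps_ext)
  fix m r
  show "((series_diff * G) $ m) $ r = ((series_eta \<epsilon> * K) $ m) $ r"
    using assms(1)[of "m - 1"] assms(2)[of "r - 1"] assms(3)[of "m - 1" "r - 1"]
    by (cases m; cases r) (auto simp: series_diff_nth series_eta_nth simp del: fps_mult_nth_0)
qed

text \<open>Each row of \<open>x\<close> is the preceding row shifted by one place, and row 0 has no
  predecessor.\<close>

lemma series_diff_cancel:
  assumes "series_diff * x = (0 :: 'r::ring_1 fps fps)" shows "x = 0"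
proof -
  have "\<forall>r. (x $ m) $ r = 0" for m
  proof (induction m)
    case 0
    have "(x $ 0) $ r = 0" for r
      using arg_cong[OF assms, of "\<lambda>y. (y $ 0) $ Suc r"] by (simp add: series_diff_nth del: fps_mult_nth_0)
    then show ?case by blast
  next
    case (Suc m)
    have "(x $ Suc m) $ r = 0" for r
      using arg_cong[OF assms, of "\<lambda>y. (y $ Suc m) $ Suc r"] Suc by (simp add: series_diff_nth del: fps_mult_nth_0)
    then show ?case by blast
  qed
  then show ?thesis by (intro fps_ext) simp
qed

section \<open>The defining relations and the Gauss generators in a ring\<close>

text \<open>\<open>\<sigma>\<close> is 1 for a commutator and -1 for an anticommutator, which occurs
  when both series are odd.\<close>

definition rtt_bracket :: "int \<Rightarrow> 'r::ring_1 fps \<Rightarrow> 'r fps \<Rightarrow> nat \<Rightarrow> nat \<Rightarrow> 'r" where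
  "rtt_bracket \<sigma> p q r m = p $ Suc r * q $ m - of_int \<sigma> * (q $ m * p $ Suc r)
    - (p $ r * q $ Suc m - of_int \<sigma> * (q $ Suc m * p $ r))"

text \<open>The defining relations for \<open>A = t\<^sub>1\<^sub>1\<close>, \<open>B = t\<^sub>1\<^sub>2\<close>, \<open>C = t\<^sub>2\<^sub>1\<close>, \<open>D = t\<^sub>2\<^sub>2\<close>.\<close>

locale rtt_algebra =
  fixes \<epsilon> :: int and A B C D :: "'r::ring_1 fps"
  assumes eps_sq: "\<epsilon> * \<epsilon> = 1"
    and two_cancel: "\<And>x :: 'r. x + x = 0 \<Longrightarrow> x = 0"
    and nth_0: "A $ 0 = 1" "B $ 0 = 0" "C $ 0 = 0" "D $ 0 = 1"
    and AA: "rtt_bracket 1 A A r m = of_int \<epsilon> * (A $ r * A $ m - A $ m * A $ r)"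
    and AB: "rtt_bracket 1 A B r m = of_int \<epsilon> * (A $ r * B $ m - A $ m * B $ r)"
    and AC: "rtt_bracket 1 A C r m = of_int \<epsilon> * (C $ r * A $ m - C $ m * A $ r)"
    and CA: "rtt_bracket 1 C A r m = of_int \<epsilon> * (A $ r * C $ m - A $ m * C $ r)"
    and BB: "rtt_bracket (- 1) B B r m = of_int \<epsilon> * (B $ r * B $ m - B $ m * B $ r)"
    and CC: "rtt_bracket (- 1) C C r m = of_int (- \<epsilon>) * (C $ r * C $ m - C $ m * C $ r)"
    and BC: "rtt_bracket (- 1) B C r m = of_int (- \<epsilon>) * (D $ r * A $ m - D $ m * A $ r)"
    and CB: "rtt_bracket (- 1) C B r m = of_int \<epsilon> * (A $ r * D $ m - A $ m * D $ r)"
    and AD: "rtt_bracket 1 A D r m = of_int \<epsilon> * (C $ r * B $ m - C $ m * B $ r)"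
begin

text \<open>The coefficients do not commute, so \<open>a\<close> is built as a right inverse;
  \<open>a_A\<close> shows that it is two-sided.\<close>

definition "a = fps_right_inverse A 1"
definition "e = a * B"
definition "f = C * a"
definition "d = D - C * a * B"
definition "h = a * d"

lemma A_a: "A * a = 1" and a_A: "a * A = 1"
  using nth_0 by (auto simp: a_def intro!: fps_right_inverse fps_left_inverse'[of 1])

lemma B_eq: "B = A * e" and C_eq: "C = f * A" and D_eq: "D = d + f * A * e" and d_eq: "d = A * h"
  by (simp_all add: e_def f_def d_def h_def mult.assoc a_A A_a flip: mult.assoc[of A a])

lemma a_nth_0: "a $ 0 = 1"
  by (simp add: a_def)

lemma ef_nth_0: "e $ 0 = 0" "f $ 0 = 0" "h $ 0 = 1"
  by (simp_all add: e_def f_def h_def d_def nth_0 a_nth_0)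

text \<open>The relation lowers \<open>m\<close> at the price of raising \<open>r\<close>, and at
  \<open>m = 0\<close> the coefficient is 1.\<close>

lemma A_commute_nth: "A $ r * A $ m = A $ m * A $ r"
proof (induction m arbitrary: r)
  case 0
  then show ?case by (simp add: nth_0)
next
  case (Suc m)
  show ?case using AA[of r m, unfolded rtt_bracket_def] Suc[of "Suc r"] Suc[of r] by simp
qed

abbreviation "\<delta> \<equiv> series_diff :: 'r fps fps"
abbreviation "\<eta> \<equiv> series_eta \<epsilon> :: 'r fps fps"
abbreviation "in1 \<equiv> fps_const :: 'r fps \<Rightarrow> 'r fps fps"
abbreviation "in2 \<equiv> outer_series :: 'r fps \<Rightarrow> 'r fps fps"

lemma A_commute: "in2 A * in1 A = in1 A * in2 A"
  by (intro fps_ext) (simp add: A_commute_nth)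

lemma inverses:
  "in1 A * in1 a = 1" "in1 a * in1 A = 1" "in2 A * in2 a = 1" "in2 a * in2 A = 1"
  by (simp_all add: A_a a_A outer_series_1 flip: outer_series_mult)

lemma AC_series: "\<delta> * (in1 A * in2 C - in2 C * in1 A) = \<eta> * (in1 C * in2 A - in2 C * in1 A)"
  using AC[unfolded rtt_bracket_def] by (intro series_relationI) (simp_all add: nth_0)

text \<open>The same relations read with the two variables exchanged, as input for
  \<open>central_pair_swap\<close>.\<close>

lemma AC_series_swap: "- \<delta> * (in2 A * in1 C - in1 C * in2 A) = \<eta> * (in2 C * in1 A - in1 C * in2 A)"
proof -
  have "\<delta> * (in1 C * in2 A - in2 A * in1 C) = \<eta> * (in2 C * in1 A - in1 C * in2 A)"
  proof (intro series_relationI)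
    fix m r
    show "((in1 C * in2 A - in2 A * in1 C) $ m) $ Suc r
        - ((in1 C * in2 A - in2 A * in1 C) $ Suc m) $ r
        = of_int \<epsilon> * ((in2 C * in1 A - in1 C * in2 A) $ m) $ r"
      using AC[of m r, unfolded rtt_bracket_def] by (simp add: algebra_simps)
  qed (simp_all add: nth_0)
  then show ?thesis by (simp add: algebra_simps)
qed

lemma AB_series: "\<delta> * (in1 A * in2 B - in2 B * in1 A) = \<eta> * (in1 A * in2 B - in2 A * in1 B)"
  using AB[unfolded rtt_bracket_def] by (intro series_relationI) (simp_all add: nth_0)

lemma AB_series_swap: "- \<delta> * (in2 A * in1 B - in1 B * in2 A) = \<eta> * (in2 A * in1 B - in1 A * in2 B)"
proof -
  have "\<delta> * (in1 B * in2 A - in2 A * in1 B) = \<eta> * (in2 A * in1 B - in1 A * in2 B)"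
  proof (intro series_relationI)
    fix m r
    show "((in1 B * in2 A - in2 A * in1 B) $ m) $ Suc r
        - ((in1 B * in2 A - in2 A * in1 B) $ Suc m) $ r
        = of_int \<epsilon> * ((in2 A * in1 B - in1 A * in2 B) $ m) $ r"
      using AB[of m r, unfolded rtt_bracket_def] by (simp add: algebra_simps)
  qed (simp_all add: nth_0)
  then show ?thesis by (simp add: algebra_simps)
qed

lemma AD_series: "\<delta> * (in1 A * in2 D - in2 D * in1 A) = \<eta> * (in1 C * in2 B - in2 C * in1 B)"
  using AD[unfolded rtt_bracket_def] by (intro series_relationI) (simp_all add: nth_0)

lemma BC_series: "\<delta> * (in1 B * in2 C + in2 C * in1 B) = - (\<eta> * (in1 D * in2 A - in2 D * in1 A))"
proof -
  have "\<delta> * (in1 B * in2 C + in2 C * in1 B) = \<eta> * - (in1 D * in2 A - in2 D * in1 A)"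
    using BC[unfolded rtt_bracket_def] by (intro series_relationI) (simp_all add: nth_0 algebra_simps)
  then show ?thesis by (simp only: mult_minus_right)
qed

lemma CB_series: "\<delta> * (in1 C * in2 B + in2 B * in1 C) = \<eta> * (in1 A * in2 D - in2 A * in1 D)"
  using CB[unfolded rtt_bracket_def] by (intro series_relationI) (simp_all add: nth_0)

lemma CA_series: "\<delta> * (in1 C * in2 A - in2 A * in1 C) = \<eta> * (in1 A * in2 C - in2 A * in1 C)"
  using CA[unfolded rtt_bracket_def] by (intro series_relationI) (simp_all add: nth_0)

lemma BB_series: "\<delta> * (in1 B * in2 B + in2 B * in1 B) = \<eta> * (in1 B * in2 B - in2 B * in1 B)"
  using BB[unfolded rtt_bracket_def] by (intro series_relationI) (simp_all add: nth_0)

lemma CC_series: "\<delta> * (in1 C * in2 C + in2 C * in1 C) = - (\<eta> * (in1 C * in2 C - in2 C * in1 C))"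
proof -
  have "\<delta> * (in1 C * in2 C + in2 C * in1 C) = \<eta> * - (in1 C * in2 C - in2 C * in1 C)"
    using CC[unfolded rtt_bracket_def] by (intro series_relationI) (simp_all add: nth_0 algebra_simps)
  then show ?thesis by (simp only: mult_minus_right)
qed

lemmas two_series_relations = AC_series AC_series_swap AB_series AB_series_swap AD_series BC_series
  CB_series CA_series BB_series CC_series

lemmas parts1 =
  arg_cong[OF B_eq, of in1, unfolded fps_const_mult[symmetric]]
  arg_cong[OF C_eq, of in1, unfolded fps_const_mult[symmetric]]
  arg_cong[OF D_eq, of in1, unfolded fps_const_mult[symmetric] fps_const_add[symmetric]]

lemmas parts2 =
  arg_cong[OF B_eq, of in2, unfolded outer_series_mult]
  arg_cong[OF C_eq, of in2, unfolded outer_series_mult]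
  arg_cong[OF D_eq, of in2, unfolded outer_series_mult outer_series_add]

lemmas two_series = two_series_relations[unfolded parts1 parts2]

lemma A_f: "\<delta> * (in1 A * in2 f) = (\<delta> - \<eta>) * (in2 f * in1 A) + \<eta> * (in1 f * in1 A)"
  using series.d_f_relation[OF two_series(1) A_commute inverses(3)] .

lemma A_f': "\<delta> * (in2 A * in1 f) = (\<delta> + \<eta>) * (in1 f * in2 A) - \<eta> * (in2 f * in2 A)"
  using central_pair.d_f_relation[OF central_pair_swap two_series(2) A_commute[symmetric] inverses(1)]
  by (simp add: algebra_simps)

lemma A_e: "\<delta> * (in2 e * in1 A) = (\<delta> - \<eta>) * (in1 A * in2 e) + \<eta> * (in1 A * in1 e)"
  using series.d_e_relation[OF two_series(3) A_commute inverses(4)] .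

lemma A_e': "\<delta> * (in1 e * in2 A) = (\<delta> + \<eta>) * (in2 A * in1 e) - \<eta> * (in2 A * in2 e)"
  using central_pair.d_e_relation[OF central_pair_swap two_series(4) A_commute[symmetric] inverses(2)]
  by (simp add: algebra_simps)

lemma A_d2: "in2 d * in1 A = in1 A * in2 d"
  using series_diff_cancel[OF series.d1_d2_commute[OF A_f A_e A_commute two_series(5)]] by simp

lemma A_d_nth: "A $ r * d $ m = d $ m * A $ r"
  using arg_cong[OF A_d2, of "\<lambda>x. (x $ m) $ r"] by simp

lemma A_d: "d * A = A * d"
proof (rule fps_ext)
  fix n
  have "(d * A) $ n = (\<Sum>i=0..n. A $ (n - i) * d $ i)"
    by (simp add: fps_mult_nth A_d_nth)
  also have "\<dots> = (A * d) $ n"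
    unfolding fps_mult_nth by (rule sum.reindex_bij_witness[of _ "\<lambda>i. n - i" "\<lambda>i. n - i"]) auto
  finally show "(d * A) $ n = (A * d) $ n" .
qed

lemma A_d2': "in2 d * in2 A = in2 A * in2 d"
  by (simp add: A_d flip: outer_series_mult)

lemma h1_eq: "in1 h = in1 a * in1 d"
  by (simp add: h_def)

lemma h2_eq: "in2 h = in2 a * in2 d"
  by (simp add: h_def outer_series_mult)

lemma e_f: "\<delta> * (in1 e * in2 f + in2 f * in1 e) = - (\<eta> * (in1 h - in2 h))"
  using series.e_f_anticommutator[OF A_f A_e A_e' A_commute A_d2 A_d2' two_series(6)
      inverses(2-4) series_diff_cancel]
  by (simp add: h2_eq h1_eq)

lemma f_f: "(\<delta> * \<delta> - \<eta> * \<eta>) * (in1 f * in2 f + in2 f * in1 f) + \<eta> * (\<delta> + \<eta>) * (in1 f * in1 f)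
    - \<eta> * (\<delta> - \<eta>) * (in2 f * in2 f) = 0"
  using series.f_f_relation[OF A_f A_f' A_commute two_series(10) inverses(1,3)] .

lemma e_e: "(\<delta> * \<delta> - \<eta> * \<eta>) * (in1 e * in2 e + in2 e * in1 e) + \<eta> * (\<delta> + \<eta>) * (in1 e * in1 e)
    - \<eta> * (\<delta> - \<eta>) * (in2 e * in2 e) = 0"
  using series.e_e_relation[OF A_e A_e' A_commute two_series(9) inverses(2,4)] .

lemma C_e: "(\<delta> - \<eta>) * (in1 C * in2 e) + \<delta> * (in2 e * in1 C) = \<eta> * (in2 h * in1 A - in1 D)"
proof -
  have "\<delta> * (in1 C * (in2 A * in2 e) + in2 A * in2 e * in1 C)
      = \<eta> * (in1 A * (in2 d + in2 C * in2 e) - in2 A * in1 D)"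
    using two_series_relations(7)[unfolded parts2(1,3)] by (simp add: parts2(2))
  from series.t21_e_relation[OF this two_series_relations(8) A_d2 inverses(4)]
  show ?thesis by (simp add: h2_eq mult.assoc)
qed

end

section \<open>Relations between the modes\<close>

context rtt_algebra begin

text \<open>The row \<open>j = 0\<close> is special: \<open>f\<close> has no constant term, and the
  product of f and d_1 in the same variable, which is t_21, contributes only there. This row
  expresses t_21 as a commutator (\<open>C_nth\<close>).\<close>

lemma A_f_coefficient:
  "(if j = 0 then 0 else A $ Suc r * f $ j) - A $ r * f $ Suc j
    = (if j = 0 then 0 else f $ j * A $ Suc r) - f $ Suc j * A $ r
      - of_int \<epsilon> * (f $ j * A $ r) + (if j = 0 then of_int \<epsilon> * C $ r else 0)"
proof -
  define P Q R where "P = in1 A * in2 f" and "Q = in2 f * in1 A" and "R = in1 f * in1 A"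
  have nths: "(P $ i) $ k = A $ k * f $ i"
    "(Q $ i) $ k = f $ i * A $ k"
    "(R $ i) $ k = (if i = 0 then C $ k else 0)" for i k
    by (simp_all add: P_def Q_def R_def flip: C_eq)
  have "\<delta> * P = \<delta> * Q - \<eta> * Q + \<eta> * R"
    using A_f by (simp add: P_def Q_def R_def left_diff_distrib)
  from arg_cong[OF this, of "\<lambda>x. (x $ Suc j) $ Suc r"]
  show ?thesis
    by (simp add: series_diff_nth series_eta_nth nths ef_nth_0 del: fps_mult_nth_0 fps_mult_nth_1' split: if_splits)
qed

lemma A_f_nth:
  "A $ Suc r * f $ Suc j - A $ r * f $ (Suc (Suc j))
    = f $ Suc j * A $ Suc r - f $ (Suc (Suc j)) * A $ r
      - of_int \<epsilon> * (f $ Suc j * A $ r)"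
  using A_f_coefficient[of "Suc j" r] by simp

lemma C_nth: "f $ Suc 0 * A $ r = A $ r * f $ Suc 0 + of_int \<epsilon> * C $ r"
  using A_f_coefficient[of 0 r] by (simp add: ef_nth_0 algebra_simps)

lemma A_e_coefficient:
  "(if j = 0 then 0 else e $ j * A $ Suc r) - e $ Suc j * A $ r
    = (if j = 0 then 0 else A $ Suc r * e $ j) - A $ r * e $ Suc j
      - of_int \<epsilon> * (A $ r * e $ j) + (if j = 0 then of_int \<epsilon> * B $ r else 0)"
proof -
  define P Q R where "P = in2 e * in1 A" and "Q = in1 A * in2 e" and "R = in1 A * in1 e"
  have nths: "(P $ i) $ k = e $ i * A $ k"
    "(Q $ i) $ k = A $ k * e $ i"
    "(R $ i) $ k = (if i = 0 then B $ k else 0)" for i k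
    by (simp_all add: P_def Q_def R_def flip: B_eq)
  have "\<delta> * P = \<delta> * Q - \<eta> * Q + \<eta> * R"
    using A_e by (simp add: P_def Q_def R_def left_diff_distrib)
  from arg_cong[OF this, of "\<lambda>x. (x $ Suc j) $ Suc r"]
  show ?thesis
    by (simp add: series_diff_nth series_eta_nth nths ef_nth_0 del: fps_mult_nth_0 fps_mult_nth_1' split: if_splits)
qed

lemma A_e_nth:
  "e $ Suc j * A $ Suc r - e $ (Suc (Suc j)) * A $ r
    = A $ Suc r * e $ Suc j - A $ r * e $ (Suc (Suc j))
      - of_int \<epsilon> * (A $ r * e $ Suc j)"
  using A_e_coefficient[of "Suc j" r] by simp

text \<open>The right-hand side of \<open>e_f\<close> lives on the border, so away from it the
  anticommutator depends only on \<open>r + s\<close>. Its value is read off in the first row, where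
  \<open>f $ 0 = 0\<close>.\<close>

lemma e_f_nth:
  "e $ Suc r * f $ Suc s + f $ Suc s * e $ Suc r = of_int \<epsilon> * h $ (r + s + 1)"
proof -
  define P S1 S2 where "P = in1 e * in2 f + in2 f * in1 e" and "S1 = in1 h" and "S2 = in2 h"
  have nths: "(P $ j) $ i = e $ i * f $ j + f $ j * e $ i"
    "(S1 $ j) $ i = (if j = 0 then h $ i else 0)"
    "(S2 $ j) $ i = (if i = 0 then h $ j else 0)" for i j
    by (simp_all add: P_def S1_def S2_def del: fps_mult_nth_0 fps_mult_nth_1')
  have "\<delta> * P = \<eta> * S2 - \<eta> * S1"
    using e_f by (simp add: P_def S1_def S2_def right_diff_distrib)
  note rel = arg_cong[OF this, of "\<lambda>x. (x $ Suc j) $ (Suc (Suc i))" for i j]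
  show ?thesis
  proof (induction s arbitrary: r)
    case 0
    have "- (e $ Suc r * f $ Suc 0 + f $ Suc 0 * e $ Suc r) = - (of_int \<epsilon> * h $ Suc r)"
      using rel[of 0 r] by (simp add: series_diff_nth series_eta_nth nths ef_nth_0 del: fps_mult_nth_0 fps_mult_nth_1')
    then show ?case
      by (simp only: neg_equal_iff_equal add_0 Suc_eq_plus1[symmetric] add_0_right)
  next
    case (Suc s)
    show ?case
      using rel[of "Suc s" r] Suc[of "Suc r"]
      by (simp add: series_diff_nth series_eta_nth nths ef_nth_0 del: fps_mult_nth_0 fps_mult_nth_1')
  qed
qed

text \<open>Induction on \<open>r + s\<close>, then on \<open>r\<close>. The square of
  \<open>\<delta>\<close> contributes \<open>G r s\<close>, minus twice
  \<open>G (r - 1) (s + 1)\<close>, plus \<open>G (r - 2) (s + 2)\<close>; every term with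
  \<open>\<eta>\<close> has smaller total degree. In those degrees the square of \<open>g\<close>
  vanishes, since twice its coefficient is a sum of anticommutators.\<close>

lemma series_anticommute_nth:
  assumes g: "(\<delta> * \<delta> - \<eta> * \<eta>) * (in1 g * in2 g + in2 g * in1 g) + \<eta> * (\<delta> + \<eta>) * (in1 g * in1 g)
    - \<eta> * (\<delta> - \<eta>) * (in2 g * in2 g) = 0"
  shows "g $ r * g $ s + g $ s * g $ r = 0"
proof -
  let ?G = "in1 g * in2 g + in2 g * in1 g"
  define S1 S2 where "S1 = in1 (g * g)" and "S2 = in2 (g * g)"
  have S_nth: "(S1 $ j) $ i = (if j = 0 then (g * g) $ i else 0)"
    "(S2 $ j) $ i = (if i = 0 then (g * g) $ j else 0)" for i j
    by (simp_all add: S1_def S2_def del: fps_mult_nth_0 fps_mult_nth_1')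
  have rel: "\<delta> * (\<delta> * ?G) - \<eta> * (\<eta> * ?G) + \<eta> * (\<delta> * S1) + \<eta> * (\<eta> * S1)
      - \<eta> * (\<delta> * S2) + \<eta> * (\<eta> * S2) = 0"
    using g by (simp add: S1_def S2_def algebra_simps outer_series_mult flip: fps_const_mult)
  define G where "G i j = g $ i * g $ j + g $ j * g $ i" for i j
  have G: "(?G $ j) $ i = G i j" for i j by (simp only: G_def fps_add_nth fps_const_mult_outer_nth)
  have "r + s = N \<Longrightarrow> G r s = 0" for N
  proof (induction N arbitrary: r s rule: less_induct)
    case (less N)
    have sq: "(g * g) $ n = 0" if "n < N" for n
    proof (rule two_cancel)
      have "(g * g) $ n = (\<Sum>i=0..n. g $ (n - i) * g $ i)"
        unfolding fps_mult_nth by (rule sum.reindex_bij_witness[of _ "\<lambda>i. n - i" "\<lambda>i. n - i"]) auto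
      then have "(g * g) $ n + (g * g) $ n = (\<Sum>i=0..n. G i (n - i))"
        by (simp add: fps_mult_nth G_def sum.distrib)
      also have "\<dots> = 0" using that by (intro sum.neutral) (auto intro!: less.IH)
      finally show "(g * g) $ n + (g * g) $ n = 0" .
    qed
    note rel_nth = arg_cong[OF rel, of "\<lambda>x. (x $ (Suc (Suc s))) $ r" for s r]
    note nth_simps = series_diff_nth series_eta_nth G S_nth
    show ?case using \<open>r + s = N\<close>
    proof (induction r arbitrary: s rule: less_induct)
      case inner: (less r)
      consider "r = 0" | "r = Suc 0" | k where "r = Suc (Suc k)" by (metis not0_implies_Suc)
      then show ?case
      proof cases
        case 1
        then show ?thesis
          using rel_nth[of s 0] by (simp add: nth_simps G_def del: fps_mult_nth_0 fps_mult_nth_1' fps_const_mult)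
      next
        case 2
        have "G 0 (Suc s) = 0" "(g * g) $ s = 0"
          using inner 2 by (auto intro!: sq)
        moreover have "s = 0 \<Longrightarrow> (g * g) $ 0 = 0"
          using inner.prems 2 by (intro sq) simp
        ultimately show ?thesis
          using rel_nth[of s "Suc 0"] 2
          by (cases s) (simp_all add: nth_simps G_def del: fps_mult_nth_0 fps_mult_nth_1' fps_const_mult)
      next
        case (3 k)
        have G0: "G (Suc k) (Suc s) = 0" "G k (Suc (Suc s)) = 0" "G k s = 0"
          using inner.prems 3 inner.IH[of "Suc k" "Suc s"] inner.IH[of k "Suc (Suc s)"] less.IH[OF _ refl, of k s]
          by auto
        have "s = 0 \<Longrightarrow> (g * g) $ Suc k = 0" "s = 0 \<Longrightarrow> (g * g) $ k = 0"
          "k = 0 \<Longrightarrow> (g * g) $ Suc s = 0" "k = 0 \<Longrightarrow> (g * g) $ s = 0"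
          using inner.prems 3 by (auto intro!: sq)
        then show ?thesis
          using rel_nth[of s "Suc (Suc k)"] 3 G0
          by (cases s; cases k) (simp_all add: nth_simps G_def del: fps_mult_nth_0 fps_mult_nth_1' fps_const_mult)
      qed
    qed
  qed
  then show ?thesis by (simp add: G_def)
qed

lemmas f_f_nth = series_anticommute_nth[OF f_f]
lemmas e_e_nth = series_anticommute_nth[OF e_e]

lemma h_nth_eq: "h $ (r + s + 1) =
    of_int \<epsilon> * (e $ Suc r * f $ Suc s + f $ Suc s * e $ Suc r)"
proof -
  have "of_int \<epsilon> * (of_int \<epsilon> * x) = x" for x :: 'r
    using eps_sq by (metis mult.assoc mult_1 of_int_1 of_int_mult)
  then show ?thesis by (simp only: e_f_nth)
qed

text \<open>For \<open>s \<le> n\<close> the choice \<open>r = n - s\<close>, \<open>m = s\<close>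
  makes the value its own negative; \<open>r = 0\<close> exchanges the two arguments and reduces the
  other case to this one.\<close>

lemma antisymmetric_shift_zero:
  fixes K :: "nat \<Rightarrow> nat \<Rightarrow> 'r"
  assumes K: "\<And>r m s. K (r + m) s = - K (r + s) m"
  shows "K n s = 0"
proof -
  have ge: "K n s = 0" if "s \<le> n" for n s
  proof (rule two_cancel)
    have "K n s = - K n s"
      using K[of "n - s" s s] that by (simp only: le_add_diff_inverse2)
    then show "K n s + K n s = 0" by (simp only: eq_neg_iff_add_eq_0)
  qed
  show ?thesis
  proof (cases "s \<le> n")
    case False
    then have "K s n = 0" by (intro ge) simp
    with K[of 0 n s] show ?thesis by (simp only: add_0 minus_zero)
  qed (rule ge)
qed

lemma commutator_of_int:
  "of_int k * x * y - y * (of_int k * x) = of_int k * (x * y - y * (x :: 'r))"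
proof -
  have "y * (of_int k * x) = of_int k * (y * x)"
    by (simp only: mult.assoc[symmetric] of_int_mult_comm[of y])
  then show ?thesis by (simp only: right_diff_distrib mult.assoc)
qed

text \<open>Write h as an anticommutator of e and f. By the super Jacobi identity, and because the f
  modes anticommute, exchanging the two f indices changes the sign of the commutator. As h depends
  only on the sum of the indices, the commutator satisfies
  \<open>antisymmetric_shift_zero\<close>.\<close>

lemma h_f_nth: "h $ Suc n * f $ Suc s = f $ Suc s * h $ Suc n"
proof -
  have ant: "(x * y + y * x) * z - z * (x * y + y * x) = - ((x * z + z * x) * y - y * (x * z + z * x))"
    if "y * z + z * y = 0" for x y z :: 'r
  proof -
    have "(x * y + y * x) * z - z * (x * y + y * x) + ((x * z + z * x) * y - y * (x * z + z * x))
      = x * (y * z + z * y) - (y * z + z * y) * x" by (simp add: algebra_simps)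
    then show ?thesis unfolding eq_neg_iff_add_eq_0 by (simp only: that) simp
  qed
  define K where "K n s = h $ (n + 1) * f $ Suc s - f $ Suc s * h $ (n + 1)" for n s
  have "K (r + m) s = - K (r + s) m" for r m s
    unfolding K_def h_nth_eq commutator_of_int
    by (simp only: ant[OF f_f_nth, of "e $ Suc r" "Suc m" "Suc s"] mult_minus_right)
  from antisymmetric_shift_zero[of K, OF this] show ?thesis by (simp add: K_def)
qed

lemma h_e_nth: "h $ Suc n * e $ Suc s = e $ Suc s * h $ Suc n"
proof -
  have ant: "(y * x + x * y) * z - z * (y * x + x * y) = - ((z * x + x * z) * y - y * (z * x + x * z))"
    if "y * z + z * y = 0" for x y z :: 'r
  proof -
    have "(y * x + x * y) * z - z * (y * x + x * y) + ((z * x + x * z) * y - y * (z * x + x * z))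
      = x * (y * z + z * y) - (y * z + z * y) * x" by (simp add: algebra_simps)
    then show ?thesis unfolding eq_neg_iff_add_eq_0 by (simp only: that) simp
  qed
  define K where "K n s = h $ (n + 1) * e $ Suc s - e $ Suc s * h $ (n + 1)" for n s
  have h_eq: "h $ (r + m + 1) = of_int \<epsilon> *
      (e $ Suc m * f $ Suc r + f $ Suc r * e $ Suc m)" for r m
    using h_nth_eq[of m r] by (simp only: add.commute[of r m])
  have "K (r + m) s = - K (r + s) m" for r m s
    unfolding K_def h_eq commutator_of_int
    by (simp only: ant[OF e_e_nth, of "Suc m" "f $ Suc r" "Suc s"] mult_minus_right)
  from antisymmetric_shift_zero[of K, OF this] show ?thesis by (simp add: K_def)
qed

lemma A_h_nth: "A $ r * h $ n = h $ n * A $ r"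
proof -
  have "in1 A * in2 a = in2 a * in1 A"
  proof -
    have "in2 a * (in2 A * in1 A) * in2 a = in2 a * (in1 A * in2 A) * in2 a"
      by (simp only: A_commute)
    moreover have "in2 a * (in2 A * in1 A) * in2 a = in1 A * in2 a" "in2 a * (in1 A * in2 A) * in2 a = in2 a * in1 A"
      by (simp_all only: mult.assoc[symmetric] inverses mult_1) (simp_all only: mult.assoc inverses mult_1_right)
    ultimately show ?thesis by simp
  qed
  then have "in1 A * in2 h = in2 h * in1 A"
    by (simp only: h2_eq mult.assoc A_d2) (simp only: mult.assoc[symmetric])
  from arg_cong[OF this, of "\<lambda>x. (x $ n) $ r"] show ?thesis by simp
qed

lemma C_e_nth:
  "(if j = 0 then 0 else C $ Suc r * e $ j) - C $ r * e $ Suc j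
    - of_int \<epsilon> * (C $ r * e $ j)
    + ((if j = 0 then 0 else e $ j * C $ Suc r) - e $ Suc j * C $ r)
    = of_int \<epsilon> * (h $ j * A $ r - (if j = 0 then D $ r else 0))"
proof -
  define P Q R S where "P = in1 C * in2 e" and "Q = in2 e * in1 C" and "R = in2 h * in1 A" and "S = in1 D"
  have nths: "(P $ i) $ k = C $ k * e $ i"
    "(Q $ i) $ k = e $ i * C $ k"
    "(R $ i) $ k = h $ i * A $ k"
    "(S $ i) $ k = (if i = 0 then D $ k else 0)" for i k
    by (simp_all add: P_def Q_def R_def S_def)
  have "\<delta> * P - \<eta> * P + \<delta> * Q = \<eta> * (R - S)"
    using C_e by (simp add: P_def Q_def R_def S_def left_diff_distrib)
  from arg_cong[OF this, of "\<lambda>x. (x $ Suc j) $ Suc r"]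
  show ?thesis
    by (simp add: series_diff_nth series_eta_nth nths ef_nth_0 del: fps_mult_nth_0 fps_mult_nth_1' split: if_splits)
qed

end

section \<open>Additive maps as a ring\<close>

text \<open>The integer component only serves to make \<open>0 \<noteq> 1\<close> hold for the trivial group.\<close>

typedef (overloaded) 'v endo =
  "{p :: ('v::ab_group_add \<Rightarrow> 'v) \<times> int. \<forall>x y. fst p (x + y) = fst p x + fst p y}"
  by (rule exI[of _ "(\<lambda>v. v, 0)"]) simp

setup_lifting type_definition_endo

lift_definition app :: "'v::ab_group_add endo \<Rightarrow> 'v \<Rightarrow> 'v" is fst .
lift_definition lev :: "'v::ab_group_add endo \<Rightarrow> int" is snd .

lemma endo_eqI: "(\<And>v. app x v = app y v) \<Longrightarrow> lev x = lev y \<Longrightarrow> x = y"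
  by transfer (auto simp: prod_eq_iff)

lemma app_add_right: "app x (v + w) = app x v + app x w"
  by transfer simp

instantiation endo :: (ab_group_add) ring_1
begin

lift_definition zero_endo :: "'a endo" is "(\<lambda>_. 0, 0)" by simp
lift_definition one_endo :: "'a endo" is "(\<lambda>v. v, 1)" by simp
lift_definition plus_endo :: "'a endo \<Rightarrow> 'a endo \<Rightarrow> 'a endo"
  is "\<lambda>p q. (\<lambda>v. fst p v + fst q v, snd p + snd q)" by simp
lift_definition minus_endo :: "'a endo \<Rightarrow> 'a endo \<Rightarrow> 'a endo"
  is "\<lambda>p q. (\<lambda>v. fst p v - fst q v, snd p - snd q)" by (simp add: algebra_simps)
lift_definition uminus_endo :: "'a endo \<Rightarrow> 'a endo"
  is "\<lambda>p. (\<lambda>v. - fst p v, - snd p)" by simp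
lift_definition times_endo :: "'a endo \<Rightarrow> 'a endo \<Rightarrow> 'a endo"
  is "\<lambda>p q. (\<lambda>v. fst p (fst q v), snd p * snd q)" by simp

lemma app_simps [simp]:
  "app (x + y) v = app x v + app y v" "app (x - y) v = app x v - app y v" "app (- x) v = - app x v"
  "app (x * y) v = app x (app y v)" "app 0 v = 0" "app 1 v = v"
  by (transfer; simp)+

lemma lev_simps [simp]:
  "lev (x + y) = lev x + lev y" "lev (x - y) = lev x - lev y" "lev (- x) = - lev x"
  "lev (x * y) = lev x * lev y" "lev 0 = 0" "lev 1 = 1"
  by (transfer; simp)+

instance
  by standard (rule endo_eqI; simp add: algebra_simps app_add_right; fail | metis lev_simps(5,6) zero_neq_one)+

end

lemma app_sum [simp]: "app (sum g I) v = (\<Sum>i\<in>I. app (g i) v)"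
  by (induction I rule: infinite_finite_induct) simp_all

lemma lev_of_int [simp]: "lev (of_int k) = k"
  by (induction k rule: int_induct[where k = 0]) simp_all

definition endo_of :: "('v::ab_group_add \<Rightarrow> 'v) \<Rightarrow> int \<Rightarrow> 'v endo" where
  "endo_of g n = Abs_endo (g, n)"

lemma app_endo_of: "(\<And>x y. g (x + y) = g x + g y) \<Longrightarrow> app (endo_of g n) = g"
  and lev_endo_of: "(\<And>x y. g (x + y) = g x + g y) \<Longrightarrow> lev (endo_of g n) = n"
  by (simp_all add: endo_of_def app.rep_eq lev.rep_eq Abs_endo_inverse)

context rtt_algebra begin

text \<open>Used for \<open>x\<close> a multiplication by a scalar (\<open>\<sigma> = 1\<close>),
  because elements of \<open>endo\<close> are only known to be additive, and for the parity operator
  (\<open>\<sigma> = - 1\<close>), which shows that the modes of e and f are odd.\<close>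

lemma e_f_commute:
  assumes x: "\<And>r. x * A $ r = A $ r * x"
    "\<And>r. x * B $ r = of_int \<sigma> * (B $ r * x)" "\<And>r. x * C $ r = of_int \<sigma> * (C $ r * x)"
  shows "x * e $ r = of_int \<sigma> * (e $ r * x)" "x * f $ r = of_int \<sigma> * (f $ r * x)"
proof -
  let ?x = "fps_const x"
  have X: "?x * A = A * ?x" "?x * B = of_int \<sigma> * (B * ?x)" "?x * C = of_int \<sigma> * (C * ?x)"
    using x by (auto simp: fps_eq_iff)
  have "a * (?x * A) * a = a * (A * ?x) * a" by (simp only: X(1))
  moreover have "a * (?x * A) * a = a * ?x" by (simp only: mult.assoc A_a mult_1_right)
  moreover have "a * (A * ?x) * a = ?x * a" by (simp only: mult.assoc[symmetric] a_A mult_1)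
  ultimately have a: "?x * a = a * ?x" by simp
  have "?x * e = (?x * a) * B" by (simp only: e_def mult.assoc)
  also have "\<dots> = a * (of_int \<sigma> * (B * ?x))" by (simp only: a mult.assoc X(2))
  also have "\<dots> = of_int \<sigma> * (e * ?x)"
    by (simp only: e_def mult.assoc[symmetric] of_int_mult_comm[of a])
  finally have "?x * e = of_int \<sigma> * (e * ?x)" .
  from arg_cong[OF this, of "\<lambda>y. y $ r"]
  show "x * e $ r = of_int \<sigma> * (e $ r * x)" by simp
  have "?x * f = (?x * C) * a" by (simp only: f_def mult.assoc)
  also have "\<dots> = of_int \<sigma> * (f * ?x)" by (simp only: f_def mult.assoc X(3) a)
  finally have "?x * f = of_int \<sigma> * (f * ?x)" .
  from arg_cong[OF this, of "\<lambda>y. y $ r"]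
  show "x * f $ r = of_int \<sigma> * (f $ r * x)" by simp
qed

lemma d_nth: "d $ n = (\<Sum>k=0..n. A $ k * h $ (n - k))"
  using arg_cong[OF d_eq, of "\<lambda>x. x $ n"] by (simp only: fps_mult_nth)

lemma D_nth: "D $ n = d $ n + (\<Sum>k=0..n. C $ k * e $ (n - k))"
  using arg_cong[OF D_eq, of "\<lambda>x. x $ n"] by (simp only: fps_mult_nth fps_add_nth C_eq[symmetric])

lemma B_nth_sum: "B $ n = (\<Sum>k=0..n. A $ k * e $ (n - k))"
  using arg_cong[OF B_eq, of "\<lambda>x. x $ n"] by (simp only: fps_mult_nth)

lemma C_nth_sum: "C $ n = (\<Sum>k=0..n. f $ k * A $ (n - k))"
  using arg_cong[OF C_eq, of "\<lambda>x. x $ n"] by (simp only: fps_mult_nth)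

end

section \<open>Modules described by Gauss modes\<close>

text \<open>\<open>A\<close>, \<open>C\<close>, \<open>D\<close> are the modes of t_11, t_21, t_22,
  whereas \<open>E r\<close>, \<open>F r\<close>, \<open>H r\<close> are coefficients of u to the
  power -(r + 1). The grading enters through its sign operator \<open>P\<close>, as graded subspaces
  are those stable under \<open>P\<close>.\<close>

locale gauss_module = vector_space scale
  for scale :: "complex \<Rightarrow> 'v::ab_group_add \<Rightarrow> 'v" +
  fixes eps :: complex and A C D E F H :: "nat \<Rightarrow> 'v \<Rightarrow> 'v" and P :: "'v \<Rightarrow> 'v"
  assumes linear_ops: "Vector_Spaces.linear scale scale (A r)" "Vector_Spaces.linear scale scale (C r)"
      "Vector_Spaces.linear scale scale (E r)" "Vector_Spaces.linear scale scale (F r)"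
      "Vector_Spaces.linear scale scale (H r)" "Vector_Spaces.linear scale scale P"
    and eps_sq: "eps * eps = 1"
    and A_0: "A 0 v = v" and C_0: "C 0 v = 0"
    and A_A: "A r (A m v) = A m (A r v)"
    and A_F: "A (Suc r) (F j v) - A r (F (Suc j) v)
      = F j (A (Suc r) v) - F (Suc j) (A r v) - scale eps (F j (A r v))"
    and A_E: "E j (A (Suc r) v) - E (Suc j) (A r v)
      = A (Suc r) (E j v) - A r (E (Suc j) v) - scale eps (A r (E j v))"
    and C_eq: "F 0 (A r v) = A r (F 0 v) + scale eps (C r v)"
    and E_F: "E r (F m v) + F m (E r v) = scale eps (H (r + m) v)"
    and E_E: "E r (E m v) + E m (E r v) = 0"
    and F_F: "F r (F m v) + F m (F r v) = 0"
    and H_E: "H r (E m v) = E m (H r v)" and H_F: "H r (F m v) = F m (H r v)"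
    and A_H: "A r (H m v) = H m (A r v)"
    and C_E_0: "C r (E 0 v) + E 0 (C r v) = scale eps (D r v - A r v)"
    and C_E: "C (Suc r) (E m v) - C r (E (Suc m) v) - scale eps (C r (E m v))
        + (E m (C (Suc r) v) - E (Suc m) (C r v)) = scale eps (H m (A r v))"
    and P_A: "P (A r v) = A r (P v)"
    and P_E: "P (E r v) = - E r (P v)" and P_F: "P (F r v) = - F r (P v)"
    and fin_dim: "finite_dim scale" and nontrivial: "\<exists>v :: 'v. v \<noteq> 0"
    and irreducible: "subspace N \<Longrightarrow> (\<And>v. v \<in> N \<Longrightarrow> P v \<in> N) \<Longrightarrow> (\<And>r v. v \<in> N \<Longrightarrow> A r v \<in> N) \<Longrightarrow>
      (\<And>r v. v \<in> N \<Longrightarrow> E r v \<in> N) \<Longrightarrow> (\<And>r v. v \<in> N \<Longrightarrow> F r v \<in> N) \<Longrightarrow> N = {0} \<or> N = UNIV"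

section \<open>From Yangian modules to Gauss modes\<close>

locale irreducible_yangian_module = yangian_module scale s gr t
  for scale :: "complex \<Rightarrow> 'v::ab_group_add \<Rightarrow> 'v" and s gr t +
  assumes s_S11: "s \<in> S11" and fin_dim: "finite_dim scale" and irreducible: "irreducible_module scale gr t"
begin

text \<open>The integer component is set so that the constant terms of \<open>T One One\<close> and
  \<open>T Two Two\<close> are the unit of the ring \<open>endo\<close>.\<close>

definition T :: "ix \<Rightarrow> ix \<Rightarrow> 'v endo fps" where
  "T i j = Abs_fps (\<lambda>r. endo_of (t i j r) (if r = 0 \<and> i = j then 1 else 0))"

lemma t_add: "t i j r (x + y) = t i j r x + t i j r y"
  using linear_t[of i j r] by (simp add: Vector_Spaces.linear_iff)

lemma t_scale: "t i j r (scale c x) = scale c (t i j r x)"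
  using linear_t[of i j r] by (simp add: Vector_Spaces.linear_iff)

lemma app_T [simp]: "app ((T i j) $ r) = t i j r"
  and lev_T [simp]: "lev ((T i j) $ r) = (if r = 0 \<and> i = j then 1 else 0)"
  by (simp_all add: T_def app_endo_of lev_endo_of t_add)

lemma sign_cases:
  obtains "s One = 1" "par s One = 0" "par s Two = 1" | "s One = - 1" "par s One = 1" "par s Two = 0"
  using s_S11 by (auto simp: S11_def par_def)

lemma app_of_int [simp]: "app (of_int k) v = scale (of_int k) v"
  by (induction k rule: int_induct[where k = 0])
     (simp_all add: scale_left_distrib scale_left_diff_distrib)

lemma rtt_endo:
  fixes \<sigma> \<tau> :: int
  assumes \<sigma>_eq: "\<sigma> = msign ((par s i + par s j) * (par s k + par s l))"
    and \<tau>_eq: "\<tau> = msign (par s i * par s j + par s i * par s k + par s j * par s k)"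
  shows "rtt_bracket \<sigma> (T i j) (T k l) r m
    = of_int \<tau> * ((T k j) $ r * (T i l) $ m - (T k j) $ m * (T i l) $ r)"
proof -
  have "of_int (msign p) = (msign p :: complex)" for p
    by (simp add: msign_def)
  note msign = this
  show ?thesis unfolding rtt_bracket_def
  proof (rule endo_eqI, goal_cases)
    case (1 v)
    show ?case
      using rtt[where i = i and j = j and k = k and l = l and r = r and m = m and v = v, unfolded scomm_def]
      by (simp only: \<sigma>_eq \<tau>_eq msign app_simps app_of_int app_T)
  next
    case 2
    show ?case by simp
  qed
qed

sublocale Y: rtt_algebra "s One" "T One One" "T One Two" "T Two One" "T Two Two"
proof
  fix x :: "'v endo" assume "x + x = 0"
  then have x: "app x v + app x v = 0" "lev x + lev x = 0" for v
    by (metis app_simps(1,5), metis lev_simps(1,5))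
  have "app x v = 0" for v
  proof -
    have "scale 2 (app x v) = 0" using x(1)[of v] scale_left_distrib[of 1 1 "app x v"] by simp
    then show ?thesis by simp
  qed
  with x(2) show "x = 0" by (intro endo_eqI) auto
next
  show "s One * s One = 1" by (rule sign_cases) simp_all
  show "(T One One) $ 0 = 1" "(T One Two) $ 0 = 0" "(T Two One) $ 0 = 0" "(T Two Two) $ 0 = 1"
    by (rule endo_eqI; simp add: t_0)+
qed (rule rtt_endo; rule sign_cases; simp add: msign_def)+

definition "E_op r = app (Y.e $ Suc r)"
definition "F_op r = app (Y.f $ Suc r)"
definition "H_op r = app (Y.h $ Suc r)"

text \<open>The sign operator of the grading; \<open>gr_disjoint\<close> makes the chosen value
  unique (\<open>parity_eq\<close>).\<close>

definition parity :: "'v \<Rightarrow> 'v" where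
  "parity v = (SOME w. \<exists>x\<in>gr 0. \<exists>y\<in>gr 1. v = x + y \<and> w = x - y)"

lemma parity_eq:
  assumes "x \<in> gr 0" "y \<in> gr 1" shows "parity (x + y) = x - y"
proof -
  have "\<exists>w. \<exists>x'\<in>gr 0. \<exists>y'\<in>gr 1. x + y = x' + y' \<and> w = x' - y'"
    using assms by blast
  from someI_ex[OF this] obtain x' y' where
    xy': "x' \<in> gr 0" "y' \<in> gr 1" "x + y = x' + y'" "parity (x + y) = x' - y'"
    unfolding parity_def by blast
  have "x - x' \<in> gr 0" "y' - y \<in> gr 1" "x - x' = y' - y"
    using assms xy' subspace_gr by (auto intro: subspace_diff simp: algebra_simps)
  then have "x - x' \<in> gr 0 \<inter> gr 1" by simp
  then have "x - x' = 0" unfolding gr_disjoint by simp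
  with xy' show ?thesis by simp
qed

lemma parity_cases:
  obtains x y where "x \<in> gr 0" "y \<in> gr 1" "v = x + y"
  using gr_sum[of v] by blast

lemma linear_parity: "Vector_Spaces.linear scale scale parity"
  unfolding Vector_Spaces.linear_iff
proof (intro conjI vector_space_axioms allI)
  fix v w c
  obtain x y where v: "x \<in> gr 0" "y \<in> gr 1" "v = x + y" by (rule parity_cases)
  obtain x' y' where w: "x' \<in> gr 0" "y' \<in> gr 1" "w = x' + y'" by (rule parity_cases)
  have "parity ((x + x') + (y + y')) = (x + x') - (y + y')"
    using v w subspace_gr by (intro parity_eq subspace_add)
  then show "parity (v + w) = parity v + parity w"
    using v w by (simp add: parity_eq algebra_simps)
  have "parity (scale c x + scale c y) = scale c x - scale c y"
    using v subspace_gr by (intro parity_eq subspace_scale)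
  then show "parity (scale c v) = scale c (parity v)"
    using v by (simp add: parity_eq scale_right_distrib scale_right_diff_distrib)
qed

lemma parity_t: "parity (t i j r v) = scale (msign (par s i + par s j)) (t i j r (parity v))"
proof -
  obtain x y where v: "x \<in> gr 0" "y \<in> gr 1" "v = x + y" by (rule parity_cases)
  have tx: "t i j r x \<in> gr (par s i + par s j)" and ty: "t i j r y \<in> gr (par s i + par s j + 1)"
    using parity_t[OF v(1), of i j r] parity_t[OF v(2), of i j r] by simp_all
  have t_diff: "t i j r (x - y) = t i j r x - t i j r y"
    using t_add[of i j r "x - y" y] by (simp add: algebra_simps)
  show ?thesis
  proof (cases "par s i + par s j = 0")
    case True
    then show ?thesis using tx ty v by (simp add: parity_eq t_add t_diff msign_def)
  next
    case False
    then have "par s i + par s j = 1" by (cases "par s i + par s j") auto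
    then show ?thesis using tx ty v parity_eq[of "t i j r y" "t i j r x"]
      by (simp add: parity_eq t_add t_diff msign_def add.commute)
  qed
qed

lemma parity_add: "parity (v + w) = parity v + parity w"
  using linear_parity by (simp add: Vector_Spaces.linear_iff)

end

context irreducible_yangian_module begin

lemma app_e_f_commute:
  assumes g_add: "\<And>v w. g (v + w) = g v + g w"
    and A: "\<And>r v. g (t One One r v) = t One One r (g v)"
    and B: "\<And>r v. g (t One Two r v) = scale (of_int \<sigma>) (t One Two r (g v))"
    and C: "\<And>r v. g (t Two One r v) = scale (of_int \<sigma>) (t Two One r (g v))"
  shows "g (E_op r v) = scale (of_int \<sigma>) (E_op r (g v))" "g (F_op r v) = scale (of_int \<sigma>) (F_op r (g v))"
proof -
  let ?x = "endo_of g 1"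
  note g = app_endo_of[of g, OF g_add] lev_endo_of[of g, OF g_add]
  have "?x * (T One One) $ r = (T One One) $ r * ?x" for r
    by (rule endo_eqI) (simp_all add: g A)
  moreover have "?x * (T One Two) $ r = of_int \<sigma> * ((T One Two) $ r * ?x)"
    "?x * (T Two One) $ r = of_int \<sigma> * ((T Two One) $ r * ?x)" for r
    by (rule endo_eqI; simp add: g B C)+
  ultimately have "?x * Y.e $ Suc r = of_int \<sigma> * (Y.e $ Suc r * ?x)"
    "?x * Y.f $ Suc r = of_int \<sigma> * (Y.f $ Suc r * ?x)"
    using Y.e_f_commute[of ?x \<sigma>] by blast+
  from this[THEN arg_cong[of _ _ "\<lambda>y. app y v"]]
  show "g (E_op r v) = scale (of_int \<sigma>) (E_op r (g v))" "g (F_op r v) = scale (of_int \<sigma>) (F_op r (g v))"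
    by (simp_all add: g E_op_def F_op_def)
qed

lemma sum_split_last: "(\<Sum>k=0..n. g k) = g n + (\<Sum>k<n. g k)" for g :: "nat \<Rightarrow> 'v"
  by (simp add: atLeast0AtMost add.commute flip: lessThan_Suc_atMost)

lemma op_nth:
  "k < n \<Longrightarrow> app (Y.h $ (n - k)) = H_op (n - 1 - k)"
  "k < n \<Longrightarrow> app (Y.e $ (n - k)) = E_op (n - 1 - k)"
  by (simp_all add: H_op_def E_op_def Suc_diff_Suc)

lemma H_op_0: "app (Y.h $ 0) v = v" and E_op_0: "app (Y.e $ 0) v = 0"
  and F_op_0: "app (Y.f $ 0) v = 0"
  by (simp_all add: Y.ef_nth_0)

lemma app_d: "app (Y.d $ n) v = t One One n v + (\<Sum>k<n. t One One k (H_op (n - 1 - k) v))"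
  by (simp add: Y.d_nth sum_split_last op_nth H_op_0 del: One_nat_def)

lemma t_Two_Two: "t Two Two n v = t One One n v + (\<Sum>k<n. t One One k (H_op (n - 1 - k) v))
    + (\<Sum>k<n. t Two One k (E_op (n - 1 - k) v))"
proof -
  have "t Two One n 0 = 0" using t_add[of Two One n 0 0] by simp
  then show ?thesis
    using arg_cong[OF Y.D_nth[of n], of "\<lambda>x. app x v"]
    by (simp add: app_d sum_split_last op_nth E_op_0 del: One_nat_def)
qed

lemma t_One_Two: "t One Two n v = (\<Sum>k<n. t One One k (E_op (n - 1 - k) v))"
proof -
  have "t One One n 0 = 0" using t_add[of One One n 0 0] by simp
  then show ?thesis
    using arg_cong[OF Y.B_nth_sum[of n], of "\<lambda>x. app x v"]
    by (simp add: sum_split_last op_nth E_op_0 del: One_nat_def)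
qed

lemma t_Two_One: "t Two One n v = (\<Sum>k<n. F_op k (t One One (n - 1 - k) v))"
proof -
  have "t Two One n v = (\<Sum>k=0..n. app (Y.f $ k) (t One One (n - k) v))"
    using arg_cong[OF Y.C_nth_sum[of n], of "\<lambda>x. app x v"] by simp
  also have "\<dots> = (\<Sum>k<n. F_op k (t One One (n - 1 - k) v))"
    by (simp only: sum.atLeast_Suc_atMost[of 0 n, simplified] F_op_0 add_0
          sum.atLeast1_atMost_eq[of _ n, unfolded One_nat_def]) (simp add: F_op_def)
  finally show ?thesis .
qed

lemma linear_opsI:
  assumes "\<And>v w. g (v + w) = g v + g w" "\<And>c v. scale c (g v) = g (scale c v)"
  shows "Vector_Spaces.linear scale scale g"
  using assms vector_space_axioms by (simp add: Vector_Spaces.linear_iff)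

lemma E_op_add: "E_op r (v + w) = E_op r v + E_op r w"
  and F_op_add: "F_op r (v + w) = F_op r v + F_op r w"
  and H_op_add: "H_op r (v + w) = H_op r v + H_op r w"
  by (simp_all add: E_op_def F_op_def H_op_def app_add_right)

lemma E_op_scale: "scale c (E_op r v) = E_op r (scale c v)"
  and F_op_scale: "scale c (F_op r v) = F_op r (scale c v)"
  using app_e_f_commute[of "scale c" 1 r v]
  by (simp_all add: scale_right_distrib t_scale)

lemma H_op_eq: "H_op (r + m) v = scale (of_int (s One)) (E_op r (F_op m v) + F_op m (E_op r v))"
  using arg_cong[OF Y.h_nth_eq[of r m], of "\<lambda>x. app x v"] by (simp add: H_op_def E_op_def F_op_def)

lemma parity_E: "parity (E_op r v) = - E_op r (parity v)"
  and parity_F: "parity (F_op r v) = - F_op r (parity v)"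
proof -
  have "parity (t One One r v) = t One One r (parity v)"
    "parity (t One Two r v) = scale (of_int (- 1)) (t One Two r (parity v))"
    "parity (t Two One r v) = scale (of_int (- 1)) (t Two One r (parity v))" for r v
    by (rule sign_cases; simp add: parity_t msign_def)+
  from app_e_f_commute[of parity, OF parity_add this]
  show "parity (E_op r v) = - E_op r (parity v)" "parity (F_op r v) = - F_op r (parity v)"
    by simp_all
qed

sublocale gauss_module scale "of_int (s One)" "t One One" "t Two One" "t Two Two" E_op F_op H_op parity
proof (intro gauss_module.intro gauss_module_axioms.intro vector_space_axioms)
  note eqs = arg_cong[where f = "\<lambda>x. app x v" for v]
  show "Vector_Spaces.linear scale scale (t One One r)" "Vector_Spaces.linear scale scale (t Two One r)"
    for r by (fact linear_t)+
  show "Vector_Spaces.linear scale scale (E_op r)" "Vector_Spaces.linear scale scale (F_op r)" for r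
    by (rule linear_opsI; simp add: E_op_add F_op_add E_op_scale F_op_scale)+
  show "Vector_Spaces.linear scale scale (H_op r)" for r
    using H_op_eq[of r 0] E_op_scale F_op_scale
    by (intro linear_opsI H_op_add) (simp add: scale_right_distrib mult.commute)
  show "Vector_Spaces.linear scale scale parity" by (rule linear_parity)
  show "of_int (s One) * of_int (s One) = (1 :: complex)" by (rule sign_cases) simp_all
  fix r m j :: nat and v :: 'v
  show "t One One 0 v = v" "t Two One 0 v = 0" by (simp_all add: t_0)
  show "t One One r (t One One m v) = t One One m (t One One r v)"
    using Y.A_commute_nth[of r m, THEN eqs, of v] by simp
  show "t One One (Suc r) (F_op j v) - t One One r (F_op (Suc j) v)
      = F_op j (t One One (Suc r) v) - F_op (Suc j) (t One One r v) - scale (of_int (s One)) (F_op j (t One One r v))"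
    using Y.A_f_nth[of r j, THEN eqs, of v] by (simp add: F_op_def)
  show "E_op j (t One One (Suc r) v) - E_op (Suc j) (t One One r v)
      = t One One (Suc r) (E_op j v) - t One One r (E_op (Suc j) v) - scale (of_int (s One)) (t One One r (E_op j v))"
    using Y.A_e_nth[of j r, THEN eqs, of v] by (simp add: E_op_def)
  show "F_op 0 (t One One r v) = t One One r (F_op 0 v) + scale (of_int (s One)) (t Two One r v)"
    using Y.C_nth[of r, THEN eqs, of v] by (simp add: F_op_def)
  show "E_op r (F_op m v) + F_op m (E_op r v) = scale (of_int (s One)) (H_op (r + m) v)"
    using Y.e_f_nth[of r m, THEN eqs, of v] by (simp add: F_op_def E_op_def H_op_def)
  show "E_op r (E_op m v) + E_op m (E_op r v) = 0"
    using Y.e_e_nth[of "Suc r" "Suc m", THEN eqs, of v] by (simp add: E_op_def)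
  show "F_op r (F_op m v) + F_op m (F_op r v) = 0"
    using Y.f_f_nth[of "Suc r" "Suc m", THEN eqs, of v] by (simp add: F_op_def)
  show "H_op r (E_op m v) = E_op m (H_op r v)"
    using Y.h_e_nth[of r m, THEN eqs, of v] by (simp add: E_op_def H_op_def)
  show "H_op r (F_op m v) = F_op m (H_op r v)"
    using Y.h_f_nth[of r m, THEN eqs, of v] by (simp add: F_op_def H_op_def)
  show "t One One r (H_op m v) = H_op m (t One One r v)"
    using Y.A_h_nth[of r "Suc m", THEN eqs, of v] by (simp add: H_op_def)
  show "t Two One r (E_op 0 v) + E_op 0 (t Two One r v) = scale (of_int (s One)) (t Two Two r v - t One One r v)"
    using Y.C_e_nth[of 0 r, THEN eqs, of v]
    by (simp add: E_op_def Y.ef_nth_0 scale_right_diff_distrib) (simp add: algebra_simps)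
  show "t Two One (Suc r) (E_op m v) - t Two One r (E_op (Suc m) v) - scale (of_int (s One)) (t Two One r (E_op m v))
      + (E_op m (t Two One (Suc r) v) - E_op (Suc m) (t Two One r v)) = scale (of_int (s One)) (H_op m (t One One r v))"
    using Y.C_e_nth[of "Suc m" r, THEN eqs, of v] by (simp add: E_op_def H_op_def)
  show "parity (t One One r v) = t One One r (parity v)" by (simp add: parity_t msign_def)
  show "parity (E_op r v) = - E_op r (parity v)" "parity (F_op r v) = - F_op r (parity v)"
    by (rule parity_E, rule parity_F)
  show "finite_dim scale" by (rule fin_dim)
  show "\<exists>v :: 'v. v \<noteq> 0" using irreducible by (auto simp: irreducible_module_def)
next
  fix N assume N: "subspace N" "\<And>v. v \<in> N \<Longrightarrow> parity v \<in> N" "\<And>r v. v \<in> N \<Longrightarrow> t One One r v \<in> N"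
    "\<And>r v. v \<in> N \<Longrightarrow> E_op r v \<in> N" "\<And>r v. v \<in> N \<Longrightarrow> F_op r v \<in> N"
  \<comment> \<open>Stability under the remaining generators follows: \<open>H\<close> is an
    anticommutator of \<open>E\<close> and \<open>F\<close>, and the Gauss decomposition rebuilds
    all \<open>t i j\<close>.\<close>
  have H: "H_op r v \<in> N" if "v \<in> N" for r v
    using H_op_eq[of r 0 v] that N by (simp add: subspace_scale subspace_add)
  have C: "t Two One r v \<in> N" if "v \<in> N" for r v
    unfolding t_Two_One using that N by (intro subspace_sum) auto
  have t: "t i j r v \<in> N" if "v \<in> N" for i j r v
    using that N C H
    by (cases i; cases j) (auto simp: t_One_Two t_Two_Two intro!: subspace_sum subspace_add)
  have "\<exists>x\<in>N \<inter> gr 0. \<exists>y\<in>N \<inter> gr 1. v = x + y" if v: "v \<in> N" for v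
  proof -
    obtain x y where xy: "x \<in> gr 0" "y \<in> gr 1" "v = x + y" by (rule parity_cases)
    \<comment> \<open>Half the sum of \<open>v\<close> and its image under the sign operator is the
      even component of \<open>v\<close>.\<close>
    have "scale (1 / 2) (v + parity v) \<in> N"
      using N(1,2) v by (simp add: subspace_scale subspace_add)
    also have "v + parity v = scale 2 x"
      using xy scale_left_distrib[of 1 1 x] by (simp add: parity_eq)
    finally have "x \<in> N" by simp
    moreover from this have "y \<in> N" using v xy N(1) by (metis add_diff_cancel_left' subspace_diff)
    ultimately show ?thesis using xy by blast
  qed
  then have "is_submodule scale gr t N"
    using N(1) t by (simp add: is_submodule_def)
  then show "N = {0} \<or> N = UNIV" using irreducible by (simp add: irreducible_module_def)
qed

text \<open>The ring-theoretic generators satisfy \<open>gauss_decomp\<close>, whose diagonal part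
  is unique, so the definite description in \<open>gauss_d\<close> can be evaluated.\<close>

lemma gauss_d_eq:
  "gauss_d t One = t One One"
  "gauss_d t Two n v = t One One n v + (\<Sum>k<n. t One One k (H_op (n - 1 - k) v))"
proof -
  let ?d = "case_ix (t One One) (\<lambda>n. app (Y.d $ n))"
  have "gauss_decomp t ?d (\<lambda>n. app (Y.e $ n)) (\<lambda>n. app (Y.f $ n))"
  proof -
    have D: "t Two Two n v = app (Y.d $ n) v + (\<Sum>k=0..n. t Two One k (app (Y.e $ (n - k)) v))" for n v
      using arg_cong[OF Y.D_nth[of n], of "\<lambda>x. app x v"] by simp
    have B: "t One Two n v = (\<Sum>k=0..n. t One One k (app (Y.e $ (n - k)) v))" for n v
      using arg_cong[OF Y.B_nth_sum[of n], of "\<lambda>x. app x v"] by simp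
    have C: "t Two One n v = (\<Sum>k=0..n. app (Y.f $ k) (t One One (n - k) v))" for n v
      using arg_cong[OF Y.C_nth_sum[of n], of "\<lambda>x. app x v"] by simp
    have C': "ser_mult (\<lambda>n. app (Y.f $ n)) (t One One) = t Two One"
      by (intro ext) (simp add: ser_mult_def C atLeast0AtMost)
    show ?thesis
      unfolding gauss_decomp_def ix.case C'
      by (intro conjI ext) (simp_all add: ser_mult_def ser_add_def B D atLeast0AtMost)
  qed
  then have "gauss_d t = ?d"
    unfolding gauss_d_def using gauss_d_unique by (intro the1_equality) blast+
  then show "gauss_d t One = t One One"
    "gauss_d t Two n v = t One One n v + (\<Sum>k<n. t One One k (H_op (n - 1 - k) v))"
    by (simp_all add: app_d)
qed

end

section \<open>Linear algebra in finite dimension\<close>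

locale finite_dim_space = vector_space scale
  for scale :: "complex \<Rightarrow> 'v::ab_group_add \<Rightarrow> 'v" +
  assumes finite_dim: "finite_dim scale"
begin

definition "some_basis = (SOME B. finite B \<and> independent B \<and> span B = UNIV)"

sublocale finite_dimensional_vector_space scale some_basis
proof -
  obtain B where B: "finite B" "span B = UNIV"
    using finite_dim by (auto simp: finite_dim_def)
  obtain B' where B': "B' \<subseteq> B" "independent B'" "B \<subseteq> span B'"
    by (rule maximal_independent_subset)
  have "span B \<subseteq> span B'" using span_minimal[OF B'(3) subspace_span] .
  with B B' have "finite B' \<and> independent B' \<and> span B' = UNIV"
    by (auto intro: finite_subset)
  then have "\<exists>B. finite B \<and> independent B \<and> span B = UNIV" by blast
  from someI_ex[OF this] show "finite_dimensional_vector_space scale some_basis"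
    unfolding some_basis_def by unfold_locales auto
qed

abbreviation "operator \<equiv> Vector_Spaces.linear scale scale"

lemma linear_op:
  assumes "operator g"
  shows "g (x + y) = g x + g y" "g (x - y) = g x - g y" "g (- x) = - g x" "g 0 = 0"
    "g (scale c x) = scale c (g x)" "g (sum k I) = (\<Sum>i\<in>I. g (k i))"
proof -
  have add: "g (x + y) = g x + g y" for x y using assms by (simp add: Vector_Spaces.linear_iff)
  show "g (x + y) = g x + g y" by (rule add)
  show diff: "g (x - y) = g x - g y" for x y using add[of "x - y" y] by (simp add: algebra_simps)
  show "g 0 = 0" using diff[of 0 0] by simp
  then show "g (- x) = - g x" using diff[of 0 x] by simp
  show "g (scale c x) = scale c (g x)" using assms by (simp add: Vector_Spaces.linear_iff)
  show "g (sum k I) = (\<Sum>i\<in>I. g (k i))"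
    by (induction I rule: infinite_finite_induct) (simp_all add: add \<open>g 0 = 0\<close>)
qed

lemma subspace_preimage:
  "operator g \<Longrightarrow> subspace S \<Longrightarrow> subspace {v. g v \<in> S}"
  by (auto simp: subspace_def linear_op)

text \<open>The linear extension to polynomials of the map sending the i-th power of the variable to
  \<open>g i\<close>. For modes this is f[p]; for the powers of an operator applied to a vector it
  is p(T) w.\<close>

definition comb :: "(nat \<Rightarrow> 'v) \<Rightarrow> complex poly \<Rightarrow> 'v" where
  "comb g p = (\<Sum>i\<le>degree p. scale (coeff p i) (g i))"

lemma comb_eq: "degree p \<le> n \<Longrightarrow> comb g p = (\<Sum>i\<le>n. scale (coeff p i) (g i))"
  unfolding comb_def by (rule sum.mono_neutral_left) (auto simp: coeff_eq_0)

lemma comb_0 [simp]: "comb g 0 = 0"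
  by (simp add: comb_def)

lemma comb_add: "comb g (p + q) = comb g p + comb g q"
proof -
  let ?n = "max (degree p) (degree q)"
  have "comb g (p + q) = (\<Sum>i\<le>?n. scale (coeff (p + q) i) (g i))"
    by (rule comb_eq) (rule degree_add_le_max)
  also have "\<dots> = comb g p + comb g q"
    by (simp add: comb_eq[of p ?n] comb_eq[of q ?n] scale_left_distrib sum.distrib)
  finally show ?thesis .
qed

lemma comb_smult: "comb g (smult c p) = scale c (comb g p)"
  by (simp add: comb_eq[of "smult c p" "degree p"] comb_def scale_sum_right)

lemma comb_diff: "comb g (p - q) = comb g p - comb g q"
  using comb_add[of g "p - q" q] by (simp add: algebra_simps)

lemma comb_pCons: "comb g (pCons a p) = scale a (g 0) + comb (\<lambda>i. g (Suc i)) p"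
proof -
  have "comb g (pCons a p) = (\<Sum>i\<le>Suc (degree p). scale (coeff (pCons a p) i) (g i))"
    by (rule comb_eq) (rule degree_pCons_le)
  also have "\<dots> = scale a (g 0) + comb (\<lambda>i. g (Suc i)) p"
    by (simp add: sum.atMost_Suc_shift comb_def del: sum.atMost_Suc)
  finally show ?thesis .
qed

lemma comb_monom: "comb g (monom c i) = scale c (g i)"
proof -
  have "comb g (monom c i) = (\<Sum>j\<le>i. if i = j then scale c (g j) else 0)"
    unfolding comb_eq[OF degree_monom_le] by (rule sum.cong) auto
  then show ?thesis by simp
qed

lemma comb_sum: "comb g (sum p I) = (\<Sum>i\<in>I. comb g (p i))"
  by (induction I rule: infinite_finite_induct) (simp_all add: comb_add)

lemma linear_comb:
  "operator T \<Longrightarrow> T (comb g p) = comb (\<lambda>i. T (g i)) p"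
  by (simp add: comb_def linear_op)

lemma comb_in_subspace: "subspace S \<Longrightarrow> (\<And>i. g i \<in> S) \<Longrightarrow> comb g p \<in> S"
  unfolding comb_def by (intro subspace_sum subspace_scale)

lemma ex_comb_eq_0: obtains p where "p \<noteq> 0" "comb g p = 0"
proof (cases "inj_on g {..dimension}")
  case True
  let ?S = "g ` {..dimension}"
  have "dim ?S < card ?S"
    using dim_subset_UNIV[of ?S] by (simp add: card_image[OF True])
  then have "dependent ?S" by (intro dependent_biggerset_general)
  then obtain u v where u: "v \<in> ?S" "u v \<noteq> 0" "(\<Sum>v\<in>?S. scale (u v) v) = 0"
    by (auto simp: dependent_finite)
  let ?p = "\<Sum>i\<le>dimension. monom (u (g i)) i"
  have "comb g ?p = (\<Sum>v\<in>?S. scale (u v) v)"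
    by (simp add: comb_sum comb_monom sum.reindex[OF True])
  moreover obtain i where i: "i \<le> dimension" "v = g i" using u(1) by auto
  have "coeff ?p i = u v"
    using i by (simp add: coeff_sum)
  then have "?p \<noteq> 0" using u(2) by auto
  ultimately show ?thesis using that u(3) by metis
next
  case False
  \<comment> \<open>A set of values would hide this repetition; the difference of two monomials is
    the relation sought.\<close>
  then obtain i j where ij: "i \<noteq> j" "g i = g j" by (auto simp: inj_on_def)
  have "comb g (monom 1 i - monom 1 j) = 0"
    using ij by (simp add: comb_diff comb_monom)
  moreover have "coeff (monom 1 i - monom (1::complex) j) i = 1" using ij by simp
  then have "monom 1 i - monom (1::complex) j \<noteq> 0" by (metis coeff_0 zero_neq_one)
  ultimately show ?thesis using that by blast
qed

text \<open>Take a nonzero polynomial of least degree that annihilates \<open>w\<close> and remove a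
  linear factor \<open>T - c\<close>: the cofactor applied to \<open>w\<close> is a nonzero
  eigenvector.\<close>

lemma ex_eigenvector:
  assumes T: "operator T" and W: "subspace W" "\<And>v. v \<in> W \<Longrightarrow> T v \<in> W"
    and w: "w \<in> W" "w \<noteq> 0"
  obtains v c where "v \<in> W" "v \<noteq> 0" "T v = scale c v"
proof -
  define g where "g i = (T ^^ i) w" for i
  have gW: "g i \<in> W" for i by (induction i) (simp_all add: g_def w W)
  obtain p where p: "p \<noteq> 0" "comb g p = 0" by (rule ex_comb_eq_0)
  define P where "P q \<longleftrightarrow> q \<noteq> 0 \<and> comb g q = 0" for q
  have "P p" using p by (simp add: P_def)
  then have "\<exists>q. P q \<and> (\<forall>r. P r \<longrightarrow> degree q \<le> degree r)"
    using ex_has_least_nat[of P p degree] by blast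
  then obtain q where q: "P q" "\<And>r. P r \<Longrightarrow> degree q \<le> degree r" by blast
  have "degree q \<noteq> 0"
  proof
    assume "degree q = 0"
    then have "comb g q = scale (coeff q 0) w" "coeff q 0 \<noteq> 0"
      using q(1) leading_coeff_0_iff[of q] by (auto simp: comb_def g_def P_def)
    then show False using q(1) w by (simp add: P_def)
  qed
  then obtain c where "poly q c = 0"
    using fundamental_theorem_of_algebra[of q] by (auto simp: constant_degree)
  then obtain r where r: "q = [:- c, 1:] * r" by (auto simp: poly_eq_0_iff_dvd)
  have r0: "r \<noteq> 0" using q(1) r by (auto simp: P_def)
  then have "degree q = Suc (degree r)" unfolding r by (subst degree_mult_eq) auto
  then have "comb g r \<noteq> 0" using q(2)[of r] r0 by (auto simp: P_def)
  moreover have "T (comb g r) = scale c (comb g r)"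
  proof -
    have "comb g q = T (comb g r) - scale c (comb g r)"
      using T by (simp add: r comb_add comb_smult comb_diff comb_pCons linear_comb g_def)
    then show ?thesis using q(1) by (simp add: P_def)
  qed
  ultimately show ?thesis by (rule that[OF comb_in_subspace[OF W(1) gW]])
qed

text \<open>The family may be infinite, hence the induction on the dimension of \<open>W\<close>: an
  operator that is not scalar on \<open>W\<close> has a proper nonzero eigenspace there, which all
  the others preserve.\<close>

lemma ex_joint_eigenvector:
  assumes T: "\<And>i. operator (T i)" and comm: "\<And>i j v. T i (T j v) = T j (T i v)"
    and W: "subspace W" "\<And>i v. v \<in> W \<Longrightarrow> T i v \<in> W" "w \<in> W" "w \<noteq> 0"
  obtains v c where "v \<in> W" "v \<noteq> 0" "\<And>i. T i v = scale (c i) v"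
proof -
  have "\<exists>v\<in>W. v \<noteq> 0 \<and> (\<forall>i. \<exists>c. T i v = scale c v)"
    using W
  proof (induction "dim W" arbitrary: W w rule: less_induct)
    case less
    show ?case
    proof (cases "\<forall>i. \<exists>c. \<forall>v\<in>W. T i v = scale c v")
      case True
      with less.prems show ?thesis by metis
    next
      case False
      then obtain i where i: "\<And>c. \<exists>v\<in>W. T i v \<noteq> scale c v" by blast
      obtain u c where u: "u \<in> W" "u \<noteq> 0" "T i u = scale c u"
        using ex_eigenvector[OF T less.prems] by metis
      define W' where "W' = {v \<in> W. T i v = scale c v}"
      have sub: "subspace W'"
        using less.prems(1) unfolding W'_def subspace_def
        by (auto simp: linear_op[OF T] scale_right_distrib mult.commute)
      have "W' \<subset> W" using i[of c] by (auto simp: W'_def)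
      then have "dim W' < dim W"
        using less.prems(1) sub by (intro dim_psubset) (metis span_eq_iff)
      moreover have "T j v \<in> W'" if "v \<in> W'" for j v
        using that less.prems(2) comm[of i j v] by (simp add: W'_def linear_op[OF T])
      moreover have "u \<in> W'" using u by (simp add: W'_def)
      ultimately have "\<exists>v\<in>W'. v \<noteq> 0 \<and> (\<forall>i. \<exists>c. T i v = scale c v)"
        using less.hyps[of W' u] sub u(2) by blast
      then show ?thesis by (auto simp: W'_def)
    qed
  qed
  then obtain v where v: "v \<in> W" "v \<noteq> 0" "\<forall>i. \<exists>c. T i v = scale c v" by blast
  from v(3) obtain c where "\<And>i. T i v = scale (c i) v" by metis
  with v(1,2) show ?thesis by (rule that)
qed

text \<open>The \<open>g i\<close> square to zero, so a nonzero vector killed by the first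
  \<open>n\<close> of them is either killed by \<open>g n\<close> too or sent by it to another such
  vector. These kernels decrease, and one of least dimension is contained in all the others.\<close>

lemma ex_common_kernel:
  assumes g: "\<And>i. operator (g i)"
    and anti: "\<And>i j v. g i (g j v) + g j (g i v) = 0" and nontrivial: "(w :: 'v) \<noteq> 0"
  obtains v where "v \<noteq> 0" "\<And>i :: nat. g i v = 0"
proof -
  define K where "K n = {v. \<forall>i<n. g i v = 0}" for n
  have sub: "subspace (K n)" for n
    by (auto simp: K_def subspace_def linear_op[OF g])
  have nz: "\<exists>v\<in>K n. v \<noteq> 0" for n
  proof (induction n)
    case 0
    then show ?case using nontrivial by (auto simp: K_def)
  next
    case (Suc n)
    then obtain v where v: "v \<in> K n" "v \<noteq> 0" by blast
    have "scale 2 (g n (g n v)) = 0"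
      using anti[of n n v] scale_left_distrib[of 1 1 "g n (g n v)"] by simp
    then have "g n (g n v) = 0" by simp
    moreover have "g i (g n v) = 0" if "i < n" for i
      using anti[of i n v] v(1) that by (simp add: K_def linear_op[OF g])
    ultimately have "g n v \<in> K (Suc n)" by (auto simp: K_def less_Suc_eq)
    moreover have "v \<in> K (Suc n)" if "g n v = 0"
      using v that by (auto simp: K_def less_Suc_eq)
    ultimately show ?case using v(2) by blast
  qed
  obtain n where n: "\<And>m. dim (K n) \<le> dim (K m)"
    using ex_has_least_nat[of "\<lambda>_. True" 0 "\<lambda>n. dim (K n)"] by blast
  obtain v where v: "v \<in> K n" "v \<noteq> 0" using nz by blast
  have "g i v = 0" for i
  proof -
    let ?m = "max n (Suc i)"
    have "K ?m \<subseteq> K n" by (auto simp: K_def)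
    then have "K ?m = K n" by (intro subspace_dim_equal sub n)
    then have "v \<in> K ?m" using v by simp
    then show ?thesis by (simp add: K_def)
  qed
  with v(2) show ?thesis by (rule that)
qed

end

section \<open>Joint generalised eigenspaces of a triangular family\<close>

text \<open>The modes of d_1 and d_2 are only triangular on the monomial basis; the dimensions of
  the \<open>\<ell>\<close>-weight spaces have to be read off from the diagonal
  \<open>mus\<close>.\<close>

locale triangular_family = finite_dim_space scale
  for scale :: "complex \<Rightarrow> 'v::ab_group_add \<Rightarrow> 'v" +
  fixes T :: "'i \<Rightarrow> 'v \<Rightarrow> 'v" and ys :: "'v list" and mus :: "('i \<Rightarrow> complex) list"
  assumes linear_T: "operator (T i)"
    and T_comm: "T i (T j v) = T j (T i v)"
    and len: "length mus = length ys"
    and indep: "n < length ys \<Longrightarrow> ys ! n \<notin> span (set (take n ys))"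
    and triangular: "n < length ys \<Longrightarrow> T i (ys ! n) - scale ((mus ! n) i) (ys ! n) \<in> span (set (take n ys))"
begin

definition "W n = span (set (take n ys))"

definition "shifted i c v = T i v - scale c v"

definition "weight_space N \<zeta> = {v. \<forall>i. (shifted i (\<zeta> i) ^^ N) v = 0}"

lemma linear_shifted: "operator (shifted i c)"
  unfolding Vector_Spaces.linear_iff shifted_def
  by (simp add: vector_space_axioms linear_op[OF linear_T] scale_right_distrib
        scale_right_diff_distrib mult.commute algebra_simps)

lemma shifted_comm: "shifted i c (shifted j c' v) = shifted j c' (shifted i c v)"
  by (simp add: shifted_def linear_op[OF linear_T] T_comm[of i j] scale_right_diff_distrib mult.commute algebra_simps)

lemma linear_power: "operator g \<Longrightarrow> operator (g ^^ n)"
  by (induction n) (simp_all add: Vector_Spaces.linear_iff vector_space_axioms)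

lemma shifted_power_comm: "(shifted i c ^^ n) (shifted j c' v) = shifted j c' ((shifted i c ^^ n) v)"
  by (induction n) (simp_all add: shifted_comm[of i c])

lemma subspace_W: "subspace (W n)" by (simp add: W_def)

lemma W_Suc: "n < length ys \<Longrightarrow> x \<in> W (Suc n) \<longleftrightarrow> (\<exists>k. x - scale k (ys ! n) \<in> W n)"
  by (simp add: W_def take_Suc_conv_app_nth span_breakdown_eq)

lemma W_mono: "W n \<subseteq> W (Suc n)"
  unfolding W_def by (intro span_mono set_take_subset_set_take) simp

lemma shifted_Suc:
  assumes n: "n < length ys" and x: "x - scale k (ys ! n) \<in> W n" and stable: "\<And>v. v \<in> W n \<Longrightarrow> shifted i c v \<in> W n"
  shows "shifted i c x - scale (k * ((mus ! n) i - c)) (ys ! n) \<in> W n"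
proof -
  have "shifted i c x - scale (k * ((mus ! n) i - c)) (ys ! n)
    = shifted i c (x - scale k (ys ! n)) + scale k (T i (ys ! n) - scale ((mus ! n) i) (ys ! n))"
    by (simp add: shifted_def linear_op[OF linear_T] scale_right_diff_distrib scale_left_diff_distrib
         right_diff_distrib mult.commute algebra_simps)
  also have "\<dots> \<in> W n"
    using stable[OF x] triangular[OF n] subspace_W
    by (intro subspace_add subspace_scale) (auto simp: W_def)
  finally show ?thesis .
qed

lemma shifted_W: "n \<le> length ys \<Longrightarrow> v \<in> W n \<Longrightarrow> shifted i c v \<in> W n"
proof (induction n arbitrary: v)
  case 0
  then show ?case by (simp add: W_def shifted_def linear_op[OF linear_T])
next
  case (Suc n)
  then obtain k where "v - scale k (ys ! n) \<in> W n" by (auto simp: W_Suc)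
  from shifted_Suc[OF _ this] Suc show ?case by (auto simp: W_Suc)
qed

lemma shifted_W_same:
  assumes n: "n < length ys" and v: "v \<in> W (Suc n)"
  shows "shifted i ((mus ! n) i) v \<in> W n"
proof -
  obtain k where "v - scale k (ys ! n) \<in> W n" using n v by (auto simp: W_Suc)
  from shifted_Suc[OF n this shifted_W, of i "(mus ! n) i"] n show ?thesis by simp
qed

lemma shifted_W_other:
  assumes n: "n < length ys" and v: "v \<in> W (Suc n)" "v \<notin> W n" and c: "c \<noteq> (mus ! n) i"
  shows "shifted i c v \<in> W (Suc n) \<and> shifted i c v \<notin> W n"
proof -
  obtain k where k: "v - scale k (ys ! n) \<in> W n" using n v by (auto simp: W_Suc)
  have k0: "k \<noteq> 0" using k v(2) by auto
  let ?k = "k * ((mus ! n) i - c)"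
  have *: "shifted i c v - scale ?k (ys ! n) \<in> W n"
    using shifted_Suc[OF n k shifted_W, of i c] n by simp
  have "shifted i c v \<notin> W n"
  proof
    assume "shifted i c v \<in> W n"
    from subspace_diff[OF subspace_W this *]
    have "shifted i c v - (shifted i c v - scale ?k (ys ! n)) \<in> W n" .
    then have "scale ?k (ys ! n) \<in> W n" by simp
    from subspace_scale[OF subspace_W this, of "inverse ?k"]
    have "scale (inverse ?k) (scale ?k (ys ! n)) \<in> W n" .
    moreover have "inverse ?k * ?k = 1" using k0 c by (intro left_inverse) auto
    ultimately have "ys ! n \<in> W n" by (simp only: scale_scale scale_one)
    then show False using indep[OF n] by (simp add: W_def)
  qed
  then show ?thesis using * n by (auto simp: W_Suc)
qed

text \<open>\<open>p\<close> is a product of operators \<open>shifted j ((mus ! l) j)\<close>, one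
  for each \<open>l < m\<close> with \<open>mus ! l \<noteq> \<zeta>\<close>, where \<open>j\<close>
  is an index at which the two differ from \<open>n\<close>'s point of view. Each factor sends
  \<open>W (Suc l)\<close> into \<open>W l\<close> and acts by a nonzero scalar on the quotient of
  \<open>W (Suc n)\<close> by \<open>W n\<close>.\<close>

lemma projection_exists:
  assumes n: "n < length ys" and \<zeta>: "mus ! n = \<zeta>" and m: "m \<le> n"
  shows "\<exists>p. (\<forall>x\<in>W m. \<forall>i. (shifted i (\<zeta> i) ^^ m) (p x) = 0)
    \<and> (\<forall>i c x. p (shifted i c x) = shifted i c (p x)) \<and> (\<forall>x. x \<in> W (Suc n) \<and> x \<notin> W n \<longrightarrow> p x \<in> W (Suc n) \<and> p x \<notin> W n)"
  using m
proof (induction m)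
  case 0
  show ?case by (rule exI[of _ "\<lambda>x. x"]) (simp add: W_def)
next
  case (Suc m)
  then obtain p where "\<forall>x\<in>W m. \<forall>i. (shifted i (\<zeta> i) ^^ m) (p x) = 0"
    "\<forall>i c x. p (shifted i c x) = shifted i c (p x)"
    "\<forall>x. x \<in> W (Suc n) \<and> x \<notin> W n \<longrightarrow> p x \<in> W (Suc n) \<and> p x \<notin> W n"
    using Suc_leD by blast
  then have p: "\<And>x i. x \<in> W m \<Longrightarrow> (shifted i (\<zeta> i) ^^ m) (p x) = 0"
    "\<And>i c x. p (shifted i c x) = shifted i c (p x)"
    "\<And>x. x \<in> W (Suc n) \<Longrightarrow> x \<notin> W n \<Longrightarrow> p x \<in> W (Suc n) \<and> p x \<notin> W n" by blast+
  have m: "m < length ys" using Suc n by simp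
  show ?case
  proof (cases "mus ! m = \<zeta>")
    case True
    have "(shifted i (\<zeta> i) ^^ Suc m) (p x) = 0" if "x \<in> W (Suc m)" for x i
      using p(1)[OF shifted_W_same[OF m that, of i], of i]
      by (simp add: True p(2) shifted_power_comm)
    with p show ?thesis by blast
  next
    case False
    then obtain j where j: "(mus ! m) j \<noteq> \<zeta> j" by (metis ext)
    let ?p = "\<lambda>x. p (shifted j ((mus ! m) j) x)"
    have "(shifted i (\<zeta> i) ^^ Suc m) (?p x) = 0" if "x \<in> W (Suc m)" for x i
      using p(1)[OF shifted_W_same[OF m that, of j], of i] by (simp add: linear_op[OF linear_shifted])
    moreover have "?p (shifted i c x) = shifted i c (?p x)" for i c x
      by (simp add: p(2) shifted_comm)
    moreover have "?p x \<in> W (Suc n) \<and> ?p x \<notin> W n" if "x \<in> W (Suc n)" "x \<notin> W n" for x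
      using p(3) shifted_W_other[OF n that, of _ j] j \<zeta> by blast
    ultimately show ?thesis by (intro exI[of _ ?p]) blast
  qed
qed

lemma weight_space_vector:
  assumes n: "n < length ys" and \<zeta>: "mus ! n = \<zeta>" and N: "length ys \<le> N"
  shows "\<exists>y\<in>weight_space N \<zeta> \<inter> W (Suc n). y \<notin> W n"
proof -
  obtain p where "\<forall>x\<in>W n. \<forall>i. (shifted i (\<zeta> i) ^^ n) (p x) = 0"
    "\<forall>i c x. p (shifted i c x) = shifted i c (p x)"
    "\<forall>x. x \<in> W (Suc n) \<and> x \<notin> W n \<longrightarrow> p x \<in> W (Suc n) \<and> p x \<notin> W n"
    using projection_exists[OF n \<zeta> order_refl] by blast
  then have p: "\<And>x i. x \<in> W n \<Longrightarrow> (shifted i (\<zeta> i) ^^ n) (p x) = 0"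
    "\<And>i c x. p (shifted i c x) = shifted i c (p x)"
    "\<And>x. x \<in> W (Suc n) \<Longrightarrow> x \<notin> W n \<Longrightarrow> p x \<in> W (Suc n) \<and> p x \<notin> W n" by blast+
  have y: "ys ! n \<in> W (Suc n)" "ys ! n \<notin> W n"
    using n indep[OF n] by (auto simp: W_def take_Suc_conv_app_nth intro: span_base)
  have "(shifted i (\<zeta> i) ^^ N) (p (ys ! n)) = 0" for i
  proof -
    have 0: "(shifted i (\<zeta> i) ^^ Suc n) (p (ys ! n)) = 0"
      using p(1)[OF shifted_W_same[OF n y(1), of i], of i]
      by (simp add: \<zeta> p(2) shifted_power_comm)
    have "N = (N - Suc n) + Suc n" using N n by simp
    then have "(shifted i (\<zeta> i) ^^ N) (p (ys ! n)) = (shifted i (\<zeta> i) ^^ (N - Suc n)) ((shifted i (\<zeta> i) ^^ Suc n) (p (ys ! n)))"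
      by (metis comp_apply funpow_add)
    then show ?thesis by (simp only: 0 linear_op[OF linear_power[OF linear_shifted]])
  qed
  then show ?thesis using p(3)[OF y] by (auto simp: weight_space_def)
qed

lemma subspace_weight_space: "subspace (weight_space N \<zeta>)"
  unfolding weight_space_def subspace_def
  by (simp add: linear_op[OF linear_power[OF linear_shifted]])

text \<open>For a suitable \<open>i\<close>, \<open>shifted i (\<zeta> i)\<close> acts on the
  quotient of \<open>W (Suc n)\<close> by \<open>W n\<close> through a nonzero scalar, so none of
  its powers can send \<open>x\<close> into \<open>W n\<close>.\<close>

lemma weight_space_other:
  assumes n: "n < length ys" and \<zeta>: "mus ! n \<noteq> \<zeta>" and x: "x \<in> weight_space N \<zeta>" "x \<in> W (Suc n)"
  shows "x \<in> W n"
proof (rule ccontr)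
  assume "x \<notin> W n"
  obtain i where i: "\<zeta> i \<noteq> (mus ! n) i" using \<zeta> by (metis ext)
  have "(shifted i (\<zeta> i) ^^ k) x \<in> W (Suc n) \<and> (shifted i (\<zeta> i) ^^ k) x \<notin> W n" for k
    using \<open>x \<notin> W n\<close> x(2) by (induction k) (auto simp: shifted_W_other[OF n _ _ i])
  from this[of N] x(1) show False
    using subspace_0[OF subspace_W] by (simp add: weight_space_def)
qed

text \<open>A step of the flag adds one dimension exactly when its diagonal entry is
  \<open>\<zeta>\<close>: \<open>weight_space_vector\<close> provides the new vector in this case,
  \<open>weight_space_other\<close> excludes one otherwise.\<close>

lemma dim_weight_space_W:
  assumes N: "length ys \<le> N"
  shows "n \<le> length ys \<Longrightarrow> dim (weight_space N \<zeta> \<inter> W n) = count_list (take n mus) \<zeta>"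
proof (induction n)
  case 0
  have "weight_space N \<zeta> \<inter> W 0 \<subseteq> {0}" by (auto simp: W_def)
  then show ?case by simp
next
  case (Suc n)
  then have n: "n < length ys" and IH: "dim (weight_space N \<zeta> \<inter> W n) = count_list (take n mus) \<zeta>" by auto
  have count: "count_list (take (Suc n) mus) \<zeta> = count_list (take n mus) \<zeta> + (if mus ! n = \<zeta> then 1 else 0)"
    using n len by (simp add: take_Suc_conv_app_nth)
  show ?case
  proof (cases "mus ! n = \<zeta>")
    case False
    then have "weight_space N \<zeta> \<inter> W (Suc n) = weight_space N \<zeta> \<inter> W n"
      using weight_space_other[OF n False] W_mono by blast
    then show ?thesis using False IH count by simp
  next
    case True
    let ?G = "weight_space N \<zeta>"
    obtain y where y: "y \<in> ?G" "y \<in> W (Suc n)" "y \<notin> W n"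
      using weight_space_vector[OF n True N] by blast
    obtain k where k: "y - scale k (ys ! n) \<in> W n" using y n by (auto simp: W_Suc)
    have k0: "k \<noteq> 0" using k y(3) by auto
    have sub: "subspace (?G \<inter> W m)" for m
      using subspace_weight_space subspace_W by (rule subspace_inter)
    have "?G \<inter> W (Suc n) = span (insert y (?G \<inter> W n))"
    proof
      show "span (insert y (?G \<inter> W n)) \<subseteq> ?G \<inter> W (Suc n)"
        using y W_mono by (intro span_minimal sub) auto
      show "?G \<inter> W (Suc n) \<subseteq> span (insert y (?G \<inter> W n))"
      proof
        fix x assume x: "x \<in> ?G \<inter> W (Suc n)"
        then obtain l where l: "x - scale l (ys ! n) \<in> W n" using n by (auto simp: W_Suc)
        \<comment> \<open>This multiple of \<open>y\<close> cancels the coefficient of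
          \<open>ys ! n\<close> in \<open>x\<close>.\<close>
        have "x - scale (l / k) y = (x - scale l (ys ! n)) - scale (l / k) (y - scale k (ys ! n))"
          using k0 by (simp add: scale_right_diff_distrib)
        also have "\<dots> \<in> W n"
          by (rule subspace_diff[OF subspace_W l subspace_scale[OF subspace_W k]])
        finally have "x - scale (l / k) y \<in> ?G \<inter> W n"
          using x y(1) subspace_diff[OF subspace_weight_space _ subspace_scale[OF subspace_weight_space]] by blast
        then show "x \<in> span (insert y (?G \<inter> W n))"
          by (auto simp: span_breakdown_eq intro: span_base)
      qed
    qed
    then have "dim (?G \<inter> W (Suc n)) = dim (insert y (?G \<inter> W n))" by simp
    also have "\<dots> = dim (?G \<inter> W n) + 1"
      using y(3) sub by (simp add: dim_insert span_eq_iff[THEN iffD2, OF sub])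
    finally show ?thesis using True IH count by simp
  qed
qed

lemma dim_weight_space:
  assumes "span (set ys) = UNIV" "length ys \<le> N"
  shows "dim (weight_space N \<zeta>) = count_list mus \<zeta>"
  using dim_weight_space_W[OF assms(2) order_refl, of \<zeta>] assms(1) len by (simp add: W_def)

lemma length_eq_dim:
  assumes "span (set ys) = UNIV" shows "length ys = dim UNIV"
proof -
  have "dim (W n) = n" if "n \<le> length ys" for n
    using that
  proof (induction n)
    case (Suc n)
    then have "dim (insert (ys ! n) (set (take n ys))) = Suc n"
      using indep[of n] by (simp add: dim_insert W_def)
    then show ?case using Suc by (simp add: W_def take_Suc_conv_app_nth)
  qed (simp add: W_def)
  moreover have "W (length ys) = UNIV" using assms by (simp add: W_def)
  ultimately show ?thesis by (metis order_refl)
qed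

end

section \<open>Polynomials expanded at infinity\<close>

lemma map_poly_fls_const_add: "map_poly fls_const (p + q) = map_poly fls_const p + map_poly fls_const (q :: complex poly)"
  by (rule poly_eqI) (simp add: coeff_map_poly fls_plus_const)

lemma inf_expand_0 [simp]: "inf_expand 0 = 0"
  by (simp add: inf_expand_def)

lemma inf_expand_pCons: "inf_expand (pCons a p) = fls_const a + fls_X_inv * inf_expand p"
  by (simp add: inf_expand_def map_poly_pCons)

lemma inf_expand_1 [simp]: "inf_expand 1 = 1"
  by (simp add: inf_expand_pCons one_pCons)

lemma inf_expand_add: "inf_expand (p + q) = inf_expand p + inf_expand q"
  by (simp add: inf_expand_def map_poly_fls_const_add)

lemma inf_expand_smult: "inf_expand (smult c p) = fls_const c * inf_expand p"
  by (induction p) (simp_all add: inf_expand_pCons algebra_simps)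

lemma inf_expand_minus: "inf_expand (- p) = - inf_expand p"
  using inf_expand_add[of p "- p"] by (simp add: eq_neg_iff_add_eq_0 add.commute)

lemma inf_expand_diff: "inf_expand (p - q) = inf_expand p - inf_expand q"
  using inf_expand_add[of p "- q"] by (simp add: inf_expand_minus)

lemma inf_expand_mult: "inf_expand (p * q) = inf_expand p * inf_expand q"
  by (induction p) (simp_all add: inf_expand_pCons inf_expand_add inf_expand_smult algebra_simps)

lemma inf_expand_nth: "(inf_expand p) $$ n = (if n \<le> 0 then coeff p (nat (- n)) else 0)"
proof (induction p arbitrary: n)
  case (pCons a p)
  have "(inf_expand (pCons a p)) $$ n = (if n = 0 then a else 0) + (inf_expand p) $$ (n + 1)"
    by (simp add: inf_expand_pCons fls_X_inv_times_conv_shift)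
  also have "\<dots> = (if n \<le> 0 then coeff (pCons a p) (nat (- n)) else 0)"
  proof -
    have "nat (- n) = Suc (nat (- (n + 1)))" if "n < 0" using that by simp
    then show ?thesis using pCons.IH[of "n + 1"] by (cases "n = 0"; cases "n < 0") auto
  qed
  finally show ?case .
qed simp

lemma inf_expand_inject: "inf_expand p = inf_expand q \<longleftrightarrow> p = q"
proof
  assume "inf_expand p = inf_expand q"
  then have "(inf_expand p) $$ (- int n) = (inf_expand q) $$ (- int n)" for n by simp
  then show "p = q" by (intro poly_eqI) (simp add: inf_expand_nth)
qed simp

lemma inf_expand_eq_0: "inf_expand p = 0 \<longleftrightarrow> p = 0"
  using inf_expand_inject[of p 0] by simp

lemma inf_expand_mult_nth: "degree p \<le> d \<Longrightarrow> (inf_expand p * g) $$ n = (\<Sum>j\<le>d. coeff p j * g $$ (n + int j))"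
proof (induction d arbitrary: p n)
  case 0
  then obtain a where "p = [:a:]" by (metis degree_eq_zeroE le_zero_eq)
  then show ?case by (simp add: inf_expand_pCons)
next
  case (Suc d)
  obtain a q where p: "p = pCons a q" by (cases p)
  have q: "degree q \<le> d" using Suc.prems by (cases "q = 0") (auto simp: p)
  have "inf_expand p * g = fls_const a * g + fls_X_inv * (inf_expand q * g)"
    by (simp only: p inf_expand_pCons distrib_right mult.assoc)
  then have "(inf_expand p * g) $$ n = a * g $$ n + (inf_expand q * g) $$ (n + 1)"
    by (simp add: fls_X_inv_times_conv_shift)
  also have "\<dots> = (\<Sum>j\<le>Suc d. coeff p j * g $$ (n + int j))"
    by (simp add: Suc.IH[OF q] p sum.atMost_Suc_shift add.assoc del: sum.atMost_Suc)
  finally show ?case .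
qed

lemma shift_poly_mult: "shift_poly (p * q) c = shift_poly p c * shift_poly q c"
  by (simp add: shift_poly_def pcompose_mult)

lemma shift_poly_linear: "shift_poly [:- x, 1:] c = [:- (x + c), 1:]"
  by (simp add: shift_poly_def pcompose_pCons)

text \<open>A list keeps the multiplicities of the roots and also their order, on which the Newton
  basis depends.\<close>

definition root_poly :: "complex list \<Rightarrow> complex poly" where
  "root_poly xs = prod_list (map (\<lambda>x. [:- x, 1:]) xs)"

lemma root_poly_simps [simp]:
  "root_poly [] = 1" "root_poly (x # xs) = [:- x, 1:] * root_poly xs"
  "root_poly (xs @ ys) = root_poly xs * root_poly ys"
  by (simp_all add: root_poly_def)

lemma root_poly_nonzero: "root_poly xs \<noteq> 0"
  by (induction xs) (simp_all del: mult_pCons_left)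

lemma degree_root_poly: "degree (root_poly xs) = length xs"
  by (induction xs) (simp_all add: degree_mult_eq root_poly_nonzero del: mult_pCons_left)

lemma lead_coeff_root_poly: "lead_coeff (root_poly xs) = 1"
  by (induction xs) (simp_all add: lead_coeff_mult del: mult_pCons_left)

lemma ex_root_poly: "lead_coeff p = 1 \<Longrightarrow> \<exists>xs. p = root_poly xs"
proof (induction "degree p" arbitrary: p)
  case 0
  then obtain a where "p = [:a:]" by (metis degree_eq_zeroE)
  with 0 have "p = root_poly []" by (simp add: one_pCons)
  then show ?case by blast
next
  case (Suc d)
  then obtain x where "poly p x = 0"
    using fundamental_theorem_of_algebra[of p] by (auto simp: constant_degree)
  then obtain q where q: "p = [:- x, 1:] * q" by (auto simp: poly_eq_0_iff_dvd)
  have "q \<noteq> 0" using Suc.hyps q by auto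
  then have "degree p = Suc (degree q)" unfolding q by (subst degree_mult_eq) auto
  moreover have "lead_coeff q = 1" using Suc.prems unfolding q lead_coeff_mult by simp
  ultimately obtain xs where "q = root_poly xs" using Suc by auto
  then have "p = root_poly (x # xs)" using q by simp
  then show ?case by blast
qed

section \<open>Modes contracted with polynomials, and highest weight vectors\<close>

sublocale gauss_module \<subseteq> finite_dim_space scale
  using fin_dim by unfold_locales

context finite_dim_space begin

lemma comb_fun_add: "comb (\<lambda>i. g i + k i) p = comb g p + comb k p"
  and comb_fun_diff: "comb (\<lambda>i. g i - k i) p = comb g p - comb k p"
  and comb_fun_scale: "comb (\<lambda>i. scale c (g i)) p = scale c (comb g p)"
  and comb_fun_minus: "comb (\<lambda>i. - g i) p = - comb g p"
  by (simp_all add: comb_def scale_right_distrib scale_right_diff_distrib sum.distrib sum_subtractf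
       scale_sum_right sum_negf mult.commute)

lemma comb_fun_0 [simp]: "comb (\<lambda>i. 0) p = 0"
  by (simp add: comb_def)

lemma comb_mult: "comb (\<lambda>r. comb (\<lambda>i. g (r + i)) p) q = comb g (q * p)"
proof (induction q arbitrary: g)
  case (pCons a q)
  have "comb (\<lambda>r. comb (\<lambda>i. g (r + i)) p) (pCons a q)
      = scale a (comb g p) + comb (\<lambda>i. g (Suc i)) (q * p)"
    using pCons.IH[of "\<lambda>i. g (Suc i)"] by (simp add: comb_pCons)
  then show ?case by (simp add: comb_add comb_smult comb_pCons)
qed simp

lemma comb_pCons_0: "comb g (pCons 0 p) = comb (\<lambda>i. g (Suc i)) p"
  by (simp add: comb_pCons)

end

context gauss_module begin

lemmas A_linear = linear_op[OF linear_ops(1)]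
  and C_linear = linear_op[OF linear_ops(2)]
  and E_linear = linear_op[OF linear_ops(3)]
  and F_linear = linear_op[OF linear_ops(4)]
  and H_linear = linear_op[OF linear_ops(5)]
  and P_linear = linear_op[OF linear_ops(6)]

definition "Fc p v = comb (\<lambda>i. F i v) p"
definition "Ec p v = comb (\<lambda>i. E i v) p"

lemma linear_Fc: "operator (Fc p)"
  and linear_Ec: "operator (Ec p)"
  unfolding Vector_Spaces.linear_iff
  by (simp_all add: vector_space_axioms Fc_def Ec_def F_linear E_linear comb_fun_add comb_fun_scale)

lemmas Fc_linear = linear_op[OF linear_Fc] and Ec_linear = linear_op[OF linear_Ec]

lemma Fc_poly: "Fc (p + q) v = Fc p v + Fc q v" "Fc (p - q) v = Fc p v - Fc q v"
  "Fc (smult c p) v = scale c (Fc p v)" "Fc 0 v = 0"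
  by (simp_all add: Fc_def comb_add comb_diff comb_smult)

lemma Fc_monom: "Fc (monom 1 i) v = F i v"
  by (simp add: Fc_def comb_monom)

text \<open>\<open>pCons 0 p\<close> is u p(u): this is the mode form of the relation between d_1(u)
  and f.\<close>

lemma A_Fc: "A (Suc r) (Fc p v) = A r (Fc (pCons 0 p) v) + Fc p (A (Suc r) v) - Fc (pCons 0 p) (A r v)
    - scale eps (Fc p (A r v))"
proof -
  have "A (Suc r) (Fc p v) - A r (Fc (pCons 0 p) v) = comb (\<lambda>i. A (Suc r) (F i v) - A r (F (Suc i) v)) p"
    by (simp add: Fc_def linear_comb linear_ops comb_fun_diff comb_pCons_0)
  also have "\<dots> = Fc p (A (Suc r) v) - Fc (pCons 0 p) (A r v) - scale eps (Fc p (A r v))"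
    by (simp add: A_F Fc_def comb_fun_diff comb_fun_scale comb_pCons_0)
  finally show ?thesis by (simp add: algebra_simps)
qed

lemma F_Fc: "F j (Fc p v) = - Fc p (F j v)"
proof -
  have "F j (Fc p v) + Fc p (F j v) = comb (\<lambda>i. F j (F i v) + F i (F j v)) p"
    by (simp add: Fc_def linear_comb linear_ops comb_fun_add)
  then show ?thesis by (simp add: F_F eq_neg_iff_add_eq_0)
qed

lemma Fc_Fc: "Fc q (Fc p v) = - Fc p (Fc q v)"
  by (simp add: Fc_def[of q] F_Fc comb_fun_minus linear_comb[OF linear_Fc])

lemma Fc_Fc_same: "Fc p (Fc p v) = 0"
proof -
  have "scale 2 (Fc p (Fc p v)) = Fc p (Fc p v) + Fc p (Fc p v)"
    using scale_left_distrib[of 1 1 "Fc p (Fc p v)"] by simp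
  also have "\<dots> = 0" by (subst Fc_Fc) simp
  finally show ?thesis by simp
qed

lemma P_Fc: "P (Fc p v) = - Fc p (P v)"
  by (simp add: Fc_def linear_comb linear_ops P_F comb_fun_minus)

lemma E_Fc: "E r (Fc p v) + Fc p (E r v) = scale eps (comb (\<lambda>i. H (r + i) v) p)"
proof -
  have "E r (Fc p v) + Fc p (E r v) = comb (\<lambda>i. E r (F i v) + F i (E r v)) p"
    by (simp add: Fc_def linear_comb linear_ops comb_fun_add)
  then show ?thesis by (simp add: E_F comb_fun_scale)
qed

lemma Ec_Fc: "Ec q (Fc p v) + Fc p (Ec q v) = scale eps (comb (\<lambda>i. H i v) (q * p))"
proof -
  have "Ec q (Fc p v) + Fc p (Ec q v) = comb (\<lambda>r. E r (Fc p v) + Fc p (E r v)) q"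
    by (simp add: Ec_def linear_comb[OF linear_Fc] comb_fun_add)
  also have "\<dots> = scale eps (comb (\<lambda>r. comb (\<lambda>i. H (r + i) v) p) q)"
    by (simp add: E_Fc comb_fun_scale)
  finally show ?thesis using comb_mult[of "\<lambda>i. H i v" p q] by simp
qed

text \<open>The operators f[u^j p] anticommute with each other and so have a nonzero common kernel.
  By hypothesis they anticommute with every \<open>E r\<close>, and they always do so with every
  \<open>F r\<close> and with \<open>P\<close>. All \<open>j\<close> are treated together because
  passing \<open>A (Suc r)\<close> multiplies the polynomial by u. Hence the common kernel is a
  submodule, and irreducibility makes it everything.\<close>

lemma Fc_eq_0:
  assumes p: "\<And>i v. comb (\<lambda>j. H (i + j) v) p = 0"
  shows "Fc p v = 0"
proof -
  define g where "g j = Fc (monom 1 j * p)" for j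
  define N where "N = {m. \<forall>j. g j m = 0}"
  note g_linear = linear_op[OF linear_Fc, of "monom 1 j * p" for j, folded g_def]
  have g_Suc: "Fc (pCons 0 (monom 1 j * p)) = g (Suc j)" for j
    by (simp add: g_def monom_Suc)
  have g_E: "g j (E r m) = - E r (g j m)" for j r m
  proof -
    have "comb (\<lambda>i. H (r + i) m) (monom 1 j * p) = comb (\<lambda>i. H ((r + j) + i) m) p"
      by (simp add: comb_mult[of "\<lambda>i. H (r + i) m", symmetric] comb_monom add.assoc)
    then have "E r (g j m) + g j (E r m) = 0"
      using E_Fc[of r "monom 1 j * p" m] p by (simp add: g_def)
    then show ?thesis by (simp add: eq_neg_iff_add_eq_0 add.commute)
  qed
  obtain w :: 'v where "w \<noteq> 0" using nontrivial by blast
  obtain u where u: "u \<noteq> 0" "\<And>j. g j u = 0"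
  proof (rule ex_common_kernel[of g w])
    show "operator (g i)" for i unfolding g_def by (rule linear_Fc)
    show "g i (g j v) + g j (g i v) = 0" for i j v
      unfolding g_def by (subst Fc_Fc) simp
  qed (use \<open>w \<noteq> 0\<close> in auto)
  have "N = {0} \<or> N = UNIV"
  proof (rule irreducible)
    show "subspace N" unfolding N_def subspace_def by (simp add: g_linear)
    show "P m \<in> N" if "m \<in> N" for m
      using that by (simp add: N_def g_def) (metis P_Fc P_linear(4) minus_equation_iff minus_zero)
    show "F r m \<in> N" if "m \<in> N" for r m
      using that by (simp add: N_def g_def) (metis F_Fc F_linear(4) minus_equation_iff minus_zero)
    show "E r m \<in> N" if "m \<in> N" for r m
      using that by (simp add: N_def g_E E_linear)
    show "A r m \<in> N" if m: "m \<in> N" for r m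
    proof (induction r)
      case 0
      then show ?case using m by (simp add: A_0)
    next
      case (Suc r)
      have "g j (A (Suc r) m) = 0" for j
        using A_Fc[of r "monom 1 j * p" m, folded g_def] m Suc
        by (simp add: N_def g_Suc A_linear g_def[symmetric])
      then show ?case by (simp add: N_def)
    qed
  qed
  then have "N = UNIV" using u by (auto simp: N_def)
  then have "g 0 v = 0" by (auto simp: N_def)
  then show ?thesis by (simp add: g_def)
qed

lemma P_H: "P (H r v) = H r (P v)"
proof -
  have "scale eps (P (H r v)) = scale eps (H r (P v))"
    using arg_cong[OF E_F[of r 0 v], of P] E_F[of r 0 "P v"]
    by (auto simp: P_linear P_E P_F E_linear F_linear)
  then show ?thesis using eps_sq by auto
qed

text \<open>Schur's lemma: \<open>H i\<close> commutes with all the operators, so its eigenspaces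
  are submodules.\<close>

lemma H_scalar: obtains \<eta> where "\<And>i v. H i v = scale (\<eta> i) v"
proof -
  have "\<exists>c. \<forall>v. H i v = scale c v" for i
  proof -
    obtain w :: 'v where w: "w \<noteq> 0" using nontrivial by blast
    obtain u c where u: "u \<noteq> 0" "H i u = scale c u"
      using ex_eigenvector[OF linear_ops(5)[of i] subspace_UNIV _ UNIV_I w] by blast
    define N where "N = {v. H i v = scale c v}"
    have "N = {0} \<or> N = UNIV"
    proof (rule irreducible)
      show "subspace N" unfolding N_def subspace_def
        by (auto simp: H_linear scale_right_distrib mult.commute)
    qed (auto simp: N_def A_H[symmetric] H_E H_F P_H[symmetric] A_linear E_linear F_linear P_linear)
    then have "N = UNIV" using u by (auto simp: N_def)
    then show ?thesis by (auto simp: N_def)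
  qed
  then obtain \<eta> where "\<forall>i v. H i v = scale (\<eta> i) v" by metis
  then show ?thesis by (intro that) blast
qed

text \<open>The common kernel of the anticommuting \<open>E i\<close> is nonzero and stable under
  the commuting operators \<open>A r\<close> and \<open>P\<close>. Including \<open>P\<close>
  ensures that the subspaces built from the vector later are stable under it.\<close>

lemma ex_highest_weight_vector:
  obtains v \<alpha> \<pi> where "v \<noteq> 0" "\<And>i. E i v = 0" "\<And>r. A r v = scale (\<alpha> r) v" "P v = scale \<pi> v"
proof -
  define T where "T i = (case i of None \<Rightarrow> P | Some r \<Rightarrow> A r)" for i
  define W where "W = {v. \<forall>i. E i v = 0}"
  have sub: "subspace W" unfolding W_def subspace_def by (simp add: E_linear)
  obtain w :: 'v where w: "w \<noteq> 0" using nontrivial by blast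
  obtain u where u: "u \<noteq> 0" "\<And>i. E i u = 0"
    by (rule ex_common_kernel[of E w]) (use linear_ops E_E w in auto)
  have A_W: "A r x \<in> W" if x: "x \<in> W" for x r
  proof (induction r)
    case 0
    then show ?case using x by (simp add: A_0)
  next
    case (Suc r)
    have "E j (A (Suc r) x) = 0" for j
      using A_E[of j r x] Suc x by (simp add: W_def A_linear)
    then show ?case by (simp add: W_def)
  qed
  have P_W: "P x \<in> W" if "x \<in> W" for x
  proof -
    have "- E i (P x) = 0" for i using P_E[of i x] that by (simp add: W_def P_linear)
    then show ?thesis by (simp add: W_def)
  qed
  obtain v c where v: "v \<in> W" "v \<noteq> 0" "\<And>i. T i v = scale (c i) v"
  proof (rule ex_joint_eigenvector[of T W u])
    show "operator (T i)" for i
      by (auto simp: T_def linear_ops split: option.split)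
    show "T i (T j x) = T j (T i x)" for i j x
      by (auto simp: T_def P_A A_A split: option.split)
    show "T i x \<in> W" if "x \<in> W" for i x
      using that by (auto simp: T_def A_W P_W split: option.split)
    show "u \<in> W" using u by (simp add: W_def)
  qed (use u sub in auto)
  show ?thesis
    using v(1,2) v(3)[of None] v(3)[of "Some r" for r]
    by (intro that[of v "\<lambda>r. c (Some r)" "c None"]) (auto simp: W_def T_def)
qed

end

lemma poly_bezout:
  fixes p q :: "complex poly"
  assumes "coprime p q" "p \<noteq> 0"
  shows "\<exists>a b. a * p + b * q = 1"
proof -
  define R where "R m \<longleftrightarrow> m \<noteq> 0 \<and> (\<exists>a b. m = a * p + b * q)" for m
  have "p = 1 * p + 0 * q" "q = 0 * p + 1 * q" by simp_all
  then have "R p" using assms(2) unfolding R_def by blast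
  then obtain m where m: "R m" "\<And>r. R r \<Longrightarrow> degree m \<le> degree r"
    using ex_has_least_nat[of R p degree] by blast
  then obtain a b where ab: "m = a * p + b * q" and m0: "m \<noteq> 0" by (auto simp: R_def)
  have dvd: "m dvd x" if x: "x = c * p + d * q" for x c d
  proof (rule ccontr)
    assume "\<not> m dvd x"
    then have nz: "x mod m \<noteq> 0" by (simp add: dvd_eq_mod_eq_0)
    have "x mod m = x - x div m * m" by (simp add: minus_div_mult_eq_mod)
    also have "\<dots> = (c * p + d * q) - x div m * (a * p + b * q)"
      by (simp only: x[symmetric] ab[symmetric])
    also have "\<dots> = (c - x div m * a) * p + (d - x div m * b) * q"
      by (simp add: algebra_simps)
    finally have "R (x mod m)" using nz unfolding R_def by blast
    then have "degree m \<le> degree (x mod m)" by (rule m(2))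
    then show False using degree_mod_less[OF m0, of x] nz by simp
  qed
  have "m dvd p" "m dvd q" using dvd[of p 1 0] dvd[of q 0 1] by simp_all
  then have "is_unit m" using assms(1) coprime_common_divisor by blast
  then obtain c where "1 = m * c" by (auto simp: dvd_def)
  then have "(c * a) * p + (c * b) * q = 1" by (simp add: ab algebra_simps)
  then show ?thesis by blast
qed

context finite_dim_space begin

lemma span_image_subset:
  assumes "operator g" "subspace S" "\<And>y. y \<in> B \<Longrightarrow> g y \<in> S" "x \<in> span B"
  shows "g x \<in> S"
proof -
  have "span B \<subseteq> {x. g x \<in> S}"
    using assms(3) by (intro span_minimal subspace_preimage assms(1,2)) auto
  then show ?thesis using assms(4) by auto
qed

lemma span_Un_image:
  assumes g: "operator g" and x: "x \<in> span (S \<union> g ` T)"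
  obtains a b where "a \<in> span S" "b \<in> span T" "x = a + g b"
proof -
  let ?U = "{a + g b | a b. a \<in> span S \<and> b \<in> span T}"
  have "subspace ?U"
    unfolding subspace_def
  proof (intro conjI ballI allI)
    show "0 \<in> ?U" by (intro CollectI exI[of _ 0]) (simp add: span_zero linear_op(4)[OF g])
    fix x y assume "x \<in> ?U" "y \<in> ?U"
    then obtain a b a' b' where ab: "a \<in> span S" "b \<in> span T" "x = a + g b" "a' \<in> span S" "b' \<in> span T" "y = a' + g b'"
      by blast
    then have "x + y = (a + a') + g (b + b')" by (simp add: linear_op[OF g])
    then show "x + y \<in> ?U" using ab span_add by blast
    fix c
    have "scale c x = scale c a + g (scale c b)" using ab by (simp add: linear_op[OF g] scale_right_distrib)
    then show "scale c x \<in> ?U" using ab span_scale by blast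
  qed
  moreover have "S \<union> g ` T \<subseteq> ?U"
  proof
    fix y assume "y \<in> S \<union> g ` T"
    then consider "y \<in> S" | t where "t \<in> T" "y = g t" by blast
    then show "y \<in> ?U"
    proof cases
      case 1
      then have "y = y + g 0" "y \<in> span S" by (simp_all add: linear_op[OF g] span_base)
      then show ?thesis using span_zero by blast
    next
      case 2
      then have "y = 0 + g t" "t \<in> span T" by (simp_all add: span_base)
      then show ?thesis using span_zero by blast
    qed
  qed
  ultimately have "span (S \<union> g ` T) \<subseteq> ?U" by (rule span_minimal[rotated])
  then obtain a b where "a \<in> span S" "b \<in> span T" "x = a + g b" using x by blast
  then show ?thesis by (rule that)
qed

end

section \<open>Highest weight modules and the rationality of h\<close>

locale highest_weight_module = gauss_module scale eps A C D E F H P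
  for scale :: "complex \<Rightarrow> 'v::ab_group_add \<Rightarrow> 'v" and eps A C D E F H P +
  fixes v :: 'v and \<alpha> h :: "complex fps" and \<pi> :: complex
  assumes v_nonzero: "v \<noteq> 0" and E_v: "E i v = 0" and A_v: "A r v = scale (\<alpha> $ r) v"
    and P_v: "P v = scale \<pi> v" and h_0: "h $ 0 = 1"
    and H_h: "H i x = scale (h $ Suc i) x"
begin

abbreviation "hf \<equiv> fps_to_fls h"

lemma alpha_0: "\<alpha> $ 0 = 1"
proof -
  have "scale (\<alpha> $ 0 - 1) v = 0"
    using A_v[of 0] by (simp add: A_0 scale_left_diff_distrib)
  then show ?thesis using v_nonzero by simp
qed

lemma hf_nth: "hf $$ (int i) = h $ i"
  by simp

lemma comb_H: "comb (\<lambda>j. H (i + j) x) p = scale ((inf_expand p * hf) $$ (int i + 1)) x"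
proof -
  have "hf $$ (int i + 1 + int j) = h $ (Suc (i + j))" for j
    using hf_nth[of "Suc (i + j)"] by (simp add: algebra_simps)
  then show ?thesis
    by (simp add: inf_expand_mult_nth[OF order_refl] comb_def H_h scale_sum_left)
qed

lemma comb_H_0: "comb (\<lambda>i. H i x) p = scale ((inf_expand p * hf) $$ 1) x"
  using comb_H[of 0 x p] by simp

lemma polynomial_product:
  assumes "\<And>i. (inf_expand p * hf) $$ (int i + 1) = 0"
  obtains q where "inf_expand p * hf = inf_expand q"
proof
  let ?d = "degree p"
  let ?q = "\<Sum>m\<le>?d. monom ((inf_expand p * hf) $$ (- int m)) m"
  show "inf_expand p * hf = inf_expand ?q"
  proof (rule fls_eqI)
    fix n :: int
    show "(inf_expand p * hf) $$ n = (inf_expand ?q) $$ n"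
    proof (cases "n > 0")
      case True
      then obtain i where "n = int i + 1" by (metis add.commute zless_iff_Suc_zadd of_nat_Suc add_0)
      then show ?thesis using assms[of i] by (simp add: inf_expand_nth)
    next
      case False
      then obtain m where m: "n = - int m" by (metis int_cases2 of_nat_0_less_iff neq0_conv of_nat_0 minus_zero)
      have "coeff ?q m = (if m \<le> ?d then (inf_expand p * hf) $$ (- int m) else 0)"
        by (simp add: coeff_sum)
      moreover have "(inf_expand p * hf) $$ (- int m) = 0" if "m > ?d"
        unfolding inf_expand_mult_nth[OF order_refl] using that by (intro sum.neutral) auto
      ultimately show ?thesis by (simp add: m inf_expand_nth)
    qed
  qed
qed

text \<open>Finite dimension gives a nonzero p with f[p] v = 0, and bracketing with every
  \<open>E i\<close> shows that p(u) h(u) is a polynomial. A denominator of least degree makes the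
  fraction reduced, and the constant term 1 of h forces \<open>\<psi>\<close> to be monic of the
  same degree.\<close>

lemma ex_rational_h:
  obtains xs \<psi> where "inf_expand (root_poly xs) * hf = inf_expand \<psi>" "coprime (root_poly xs) \<psi>"
    "lead_coeff \<psi> = 1" "degree \<psi> = length xs"
proof -
  define R where "R p \<longleftrightarrow> p \<noteq> 0 \<and> (\<exists>q. inf_expand p * hf = inf_expand q)" for p
  obtain p where p: "p \<noteq> 0" "Fc p v = 0" unfolding Fc_def by (rule ex_comb_eq_0)
  have "(inf_expand p * hf) $$ (int i + 1) = 0" for i
    using E_Fc[of i p v] p(2) v_nonzero eps_sq by (auto simp: E_linear E_v Fc_linear comb_H)
  then obtain q where "inf_expand p * hf = inf_expand q" by (rule polynomial_product)
  with p have "R p" by (auto simp: R_def)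
  then obtain p where p: "R p" "\<And>q. R q \<Longrightarrow> degree p \<le> degree q"
    using ex_has_least_nat[of R p degree] by blast
  then obtain q where q: "inf_expand p * hf = inf_expand q" and p0: "p \<noteq> 0" by (auto simp: R_def)
  define \<phi> \<psi> where "\<phi> = smult (inverse (lead_coeff p)) p" and "\<psi> = smult (inverse (lead_coeff p)) q"
  have "lead_coeff \<phi> = 1" and deg: "degree \<phi> = degree p" using p0 by (simp_all add: \<phi>_def)
  from this(1) obtain xs where xs: "\<phi> = root_poly xs" using ex_root_poly by blast
  have eq: "inf_expand \<phi> * hf = inf_expand \<psi>" using q by (simp add: \<phi>_def \<psi>_def inf_expand_smult mult.assoc)
  have "coprime \<phi> \<psi>"
  proof (rule coprimeI)
    fix c assume "c dvd \<phi>" "c dvd \<psi>"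
    then obtain \<phi>' \<psi>' where c: "\<phi> = c * \<phi>'" "\<psi> = c * \<psi>'" by (auto simp: dvd_def)
    have nz: "c \<noteq> 0" "\<phi>' \<noteq> 0" using c xs root_poly_nonzero[of xs] by auto
    have "inf_expand c * (inf_expand \<phi>' * hf) = inf_expand c * inf_expand \<psi>'"
      using eq by (simp add: c inf_expand_mult mult.assoc)
    then have "R \<phi>'" using nz by (auto simp: R_def inf_expand_eq_0)
    then have "degree \<phi> \<le> degree \<phi>'" using p(2) deg by simp
    then have "degree c = 0" using nz by (simp add: c(1) degree_mult_eq)
    then show "is_unit c" using nz by (simp add: is_unit_iff_degree)
  qed
  have coeff_\<psi>: "coeff \<psi> m = (if m = length xs then 1 else 0)" if m: "m \<ge> length xs" for m
  proof -
    have "coeff \<psi> m = (inf_expand \<phi> * hf) $$ (- int m)"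
      by (simp add: eq inf_expand_nth)
    also have "\<dots> = (\<Sum>j\<le>length xs. coeff \<phi> j * hf $$ (- int m + int j))"
      by (rule inf_expand_mult_nth) (simp add: xs degree_root_poly)
    also have "\<dots> = (\<Sum>j\<le>length xs. if j = m then coeff \<phi> j else 0)"
      using m by (intro sum.cong) (auto simp: h_0)
    also have "\<dots> = (if m = length xs then 1 else 0)"
      using m lead_coeff_root_poly[of xs] by (auto simp: xs degree_root_poly)
    finally show ?thesis .
  qed
  have "degree \<psi> = length xs"
  proof (rule antisym)
    show "degree \<psi> \<le> length xs" by (rule degree_le) (simp add: coeff_\<psi>)
    show "length xs \<le> degree \<psi>" by (rule le_degree) (simp add: coeff_\<psi>)
  qed
  with coeff_\<psi>[of "length xs"] show ?thesis
    using eq \<open>coprime \<phi> \<psi>\<close> by (intro that[of xs \<psi>]) (simp_all add: xs)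
qed

end

section \<open>The Newton basis\<close>

locale highest_weight_roots = highest_weight_module +
  fixes xs :: "complex list" and \<psi> :: "complex poly"
  assumes h_eq: "inf_expand (root_poly xs) * fps_to_fls h = inf_expand \<psi>"
    and coprime: "coprime (root_poly xs) \<psi>"
begin

abbreviation "k \<equiv> length xs"

text \<open>Indices start at 0: \<open>g 0\<close> is the mode \<open>F 0\<close>, and
  \<open>g k\<close>, contracted with the whole of phi, vanishes.\<close>

definition "g i = Fc (root_poly (take i xs))"

lemma linear_g: "operator (g i)"
  unfolding g_def by (rule linear_Fc)

lemmas g_linear = linear_op[OF linear_g]

lemma g_g: "g i (g j x) = - g j (g i x)" and g_g_same: "g i (g i x) = 0"
  and P_g: "P (g i x) = - g i (P x)" and F_g: "F j (g i x) = - g i (F j x)"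
  by (simp_all add: g_def Fc_Fc[of "root_poly (take i xs)"] Fc_Fc_same P_Fc F_Fc)

lemma Fc_multiple: "Fc (r * root_poly xs) x = 0"
proof (rule Fc_eq_0)
  fix i y
  have "inf_expand (r * root_poly xs) * hf = inf_expand (r * \<psi>)"
    by (simp add: inf_expand_mult mult.assoc h_eq)
  then show "comb (\<lambda>j. H (i + j) y) (r * root_poly xs) = 0"
    by (simp add: comb_H inf_expand_nth)
qed

lemma g_last: "g k x = 0"
  using Fc_multiple[of 1 x] by (simp add: g_def)

lemma pCons_root_poly:
  "i < k \<Longrightarrow> pCons 0 (root_poly (take i xs)) = root_poly (take (Suc i) xs) + smult (xs ! i) (root_poly (take i xs))"
  by (simp add: take_Suc_conv_app_nth)

lemma A_g:
  assumes "i < k"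
  shows "A (Suc r) (g i x) = A r (g (Suc i) x) + scale (xs ! i) (A r (g i x)) + g i (A (Suc r) x)
    - g (Suc i) (A r x) - scale (xs ! i + eps) (g i (A r x))"
  using A_Fc[of r "root_poly (take i xs)" x]
  by (simp add: pCons_root_poly[OF assms] Fc_poly g_def A_linear scale_left_distrib)

text \<open>Factors enter in the order \<open>g (k - 1)\<close>, \<open>g (k - 2)\<close>, and so on
  down to \<open>g 0\<close>. By \<open>A_g\<close>, moving \<open>A\<close> past \<open>g i\<close>
  produces \<open>g (Suc i)\<close>, which must already preserve the span of the earlier part of the
  list.\<close>

primrec bs :: "nat \<Rightarrow> 'a list" where
  "bs 0 = [v]"
| "bs (Suc n) = bs n @ map (g (k - Suc n)) (bs n)"

text \<open>Multiplication by (u - a - eps) / (u - a), written in the inverse of u;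
  \<open>twist_nth_Suc\<close> puts it in the form of the recursion that \<open>A_g\<close> gives
  for the modes.\<close>

definition twist :: "complex \<Rightarrow> complex fps \<Rightarrow> complex fps" where
  "twist a \<mu> = \<mu> * (1 - fps_const (a + eps) * fps_X) * inverse (1 - fps_const a * fps_X)"

primrec ms :: "nat \<Rightarrow> complex fps list" where
  "ms 0 = [\<alpha>]"
| "ms (Suc n) = ms n @ map (twist (xs ! (k - Suc n))) (ms n)"

lemma twist_eq: "twist a \<mu> * (1 - fps_const a * fps_X) = \<mu> * (1 - fps_const (a + eps) * fps_X)"
proof -
  have "inverse (1 - fps_const a * fps_X) * (1 - fps_const a * fps_X) = 1"
    by (rule inverse_mult_eq_1) simp
  then show ?thesis unfolding twist_def by (simp only: mult.assoc mult_1_right)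
qed

lemma twist_nth_0: "(twist a \<mu>) $ 0 = \<mu> $ 0"
  by (simp add: twist_def)

lemma twist_nth_Suc: "(twist a \<mu>) $ Suc r =
    a * (twist a \<mu>) $ r + \<mu> $ Suc r - (a + eps) * \<mu> $ r"
proof -
  have *: "(x * (1 - fps_const c * fps_X)) $ Suc r = x $ Suc r - c * x $ r" for x :: "complex fps" and c
  proof -
    have "x * (1 - fps_const c * fps_X) = x - fps_const c * (fps_X * x)"
      by (simp only: right_diff_distrib mult_1_left mult_1_right mult_ac)
    then show ?thesis by simp
  qed
  show ?thesis using arg_cong[OF twist_eq[of a \<mu>], of "\<lambda>y. y $ Suc r"]
    unfolding * by (simp add: algebra_simps)
qed

lemma length_bs: "length (bs n) = 2 ^ n" and length_ms: "length (ms n) = 2 ^ n"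
  by (induction n) simp_all

lemma ms_nth_0: "\<mu> \<in> set (ms n) \<Longrightarrow> \<mu> $ 0 = 1"
  by (induction n arbitrary: \<mu>) (auto simp: alpha_0 twist_nth_0)

definition "V n = span (set (bs n))"

lemma subspace_V: "subspace (V n)" by (simp add: V_def)

lemma V_mono: "V n \<subseteq> V (Suc n)"
  unfolding V_def by (intro span_mono) auto

lemma V_into: "operator T \<Longrightarrow> subspace S \<Longrightarrow> (\<And>y. y \<in> set (bs n) \<Longrightarrow> T y \<in> S) \<Longrightarrow>
    x \<in> V n \<Longrightarrow> T x \<in> S"
  unfolding V_def by (rule span_image_subset)

lemma bs_V: "y \<in> set (bs n) \<Longrightarrow> y \<in> V n"
  by (simp add: V_def span_base)

lemma g_V_Suc: "x \<in> V n \<Longrightarrow> g (k - Suc n) x \<in> V (Suc n)"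
  by (rule V_into[OF linear_g subspace_V]) (auto intro!: bs_V)

lemma V_Suc_into:
  assumes T: "operator T" and S: "subspace S"
    and y: "\<And>y. y \<in> V n \<Longrightarrow> T y \<in> S" "\<And>y. y \<in> V n \<Longrightarrow> T (g (k - Suc n) y) \<in> S" and x: "x \<in> V (Suc n)"
  shows "T x \<in> S"
  by (rule V_into[OF T S _ x]) (auto simp: y bs_V)

text \<open>\<open>g l\<close> anticommutes past the other factors and squares to zero against its
  own copy; the base case is \<open>g k = 0\<close>.\<close>

lemma g_V: "n \<le> k \<Longrightarrow> k - n \<le> l \<Longrightarrow> l \<le> k \<Longrightarrow> x \<in> V n \<Longrightarrow> g l x \<in> V n"
proof (induction n arbitrary: x)
  case 0
  then have "l = k" by simp
  then show ?case by (simp add: g_last subspace_0[OF subspace_V])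
next
  case (Suc n)
  let ?i = "k - Suc n"
  have IH: "g l y \<in> V n" if "y \<in> V n" "l \<noteq> ?i" for y
    using Suc.prems that by (intro Suc.IH) auto
  show ?case
  proof (rule V_Suc_into[OF linear_g subspace_V _ _ Suc.prems(4)])
    fix y assume y: "y \<in> V n"
    show "g l y \<in> V (Suc n)"
      using IH[OF y] V_mono g_V_Suc[OF y] by (cases "l = ?i") auto
    show "g l (g ?i y) \<in> V (Suc n)"
    proof (cases "l = ?i")
      case True
      then show ?thesis using subspace_0[OF subspace_V] by (simp add: g_g_same)
    next
      case False
      then have "- g ?i (g l y) \<in> V (Suc n)"
        using y by (intro subspace_neg[OF subspace_V] g_V_Suc IH)
      then show ?thesis using g_g[of l ?i y] by simp
    qed
  qed
qed

text \<open>\<open>q\<close> is \<open>\<psi>' * rest\<close>, where \<open>\<psi>'\<close> inverts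
  \<open>\<psi>\<close> modulo phi and \<open>rest\<close> collects the roots after position
  \<open>i\<close>. For \<open>l > i\<close> the product with the prefix polynomial is a multiple of
  phi, so times h it is a polynomial. For \<open>l = i\<close> it becomes, up to a polynomial, 1 /
  (u - x_i), whose leading coefficient is 1.\<close>

lemma ex_dual_polynomial:
  assumes i: "i < k"
  obtains q where "\<And>l. i < l \<Longrightarrow> l \<le> k \<Longrightarrow> (inf_expand (q * root_poly (take l xs)) * hf) $$ 1 = 0"
    "(inf_expand (q * root_poly (take i xs)) * hf) $$ 1 = 1"
proof -
  let ?\<phi> = "root_poly xs"
  obtain c \<psi>' where bez: "c * ?\<phi> + \<psi>' * \<psi> = 1"
    using poly_bezout[OF coprime root_poly_nonzero] by blast
  define rest where "rest = root_poly (drop (Suc i) xs)"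
  have rest: "rest * root_poly (take (Suc i) xs) = ?\<phi>"
    by (metis append_take_drop_id mult.commute rest_def root_poly_simps(3))
  have zero: "(inf_expand (\<psi>' * rest * root_poly (take l xs)) * hf) $$ 1 = 0" if l: "i < l" "l \<le> k" for l
  proof -
    have "take l xs = take (Suc i) xs @ take (l - Suc i) (drop (Suc i) xs)"
      using l by (metis Suc_leI le_add_diff_inverse take_add)
    then obtain s where "root_poly (take l xs) = root_poly (take (Suc i) xs) * s" by (metis root_poly_simps(3))
    then have "\<psi>' * rest * root_poly (take l xs) = \<psi>' * s * ?\<phi>" by (simp add: mult_ac flip: rest)
    then have "inf_expand (\<psi>' * rest * root_poly (take l xs)) * hf = inf_expand (\<psi>' * s * \<psi>)"
      by (simp only: inf_expand_mult mult.assoc h_eq)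
    then show ?thesis by (simp add: inf_expand_nth)
  qed
  define Y where "Y = inf_expand (\<psi>' * rest * root_poly (take i xs)) * hf + inf_expand (c * (rest * root_poly (take i xs)))"
  have step: "[:- (xs ! i), 1:] * (rest * root_poly (take i xs)) = ?\<phi>"
    using rest i by (simp add: take_Suc_conv_app_nth mult_ac del: mult_pCons_left mult_pCons_right)
  have "inf_expand [:- (xs ! i), 1:] * Y
    = inf_expand (\<psi>' * ([:- (xs ! i), 1:] * (rest * root_poly (take i xs)))) * hf
      + inf_expand (c * ([:- (xs ! i), 1:] * (rest * root_poly (take i xs))))"
    unfolding Y_def inf_expand_mult by (simp only: distrib_left mult_ac)
  also have "\<dots> = inf_expand (\<psi>' * \<psi> + c * ?\<phi>)"
    unfolding step inf_expand_mult inf_expand_add by (simp only: mult.assoc h_eq)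
  finally have Y: "inf_expand [:- (xs ! i), 1:] * Y = 1"
    using bez by (simp add: add.commute)
  have Y_nth: "Y $$ (n + 1) - xs ! i * Y $$ n = (if n = 0 then 1 else 0)" for n
    using arg_cong[OF Y, of "\<lambda>y. y $$ n"]
    by (simp add: inf_expand_mult_nth[of _ 1] del: inf_expand_pCons)
  have "Y \<noteq> 0" using Y by auto
  \<comment> \<open>Comparing subdegrees shows that \<open>Y\<close> has no constant term; the
    recursion at \<open>n = 0\<close> then gives its first coefficient.\<close>
  have "fls_subdegree (inf_expand [:- (xs ! i), 1:]) = - 1"
    by (rule fls_subdegree_eqI) (auto simp: inf_expand_nth coeff_pCons split: nat.split)
  then have "fls_subdegree Y = 1"
    using arg_cong[OF Y, of fls_subdegree] \<open>Y \<noteq> 0\<close> by (subst (asm) fls_subdegree_mult) (auto simp: inf_expand_eq_0)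
  then have "Y $$ 0 = 0" by (intro fls_eq0_below_subdegree) simp
  then have "Y $$ 1 = 1" using Y_nth[of 0] by simp
  then have "(inf_expand (\<psi>' * rest * root_poly (take i xs)) * hf) $$ 1 = 1"
    by (simp add: Y_def inf_expand_nth)
  then show ?thesis using zero by (intro that)
qed

text \<open>The annihilation operator dual to \<open>g i\<close>. Only indices
  \<open>l \<ge> i\<close> are controlled, which suffices because \<open>bs\<close> reaches
  \<open>g i\<close> after all \<open>g l\<close> with \<open>l > i\<close>.\<close>

lemma ex_dual:
  assumes i: "i < k"
  obtains T where "operator T" "T v = 0"
    "\<And>l x. i < l \<Longrightarrow> l \<le> k \<Longrightarrow> T (g l x) = - g l (T x)" "\<And>x. T (g i x) = scale eps x - g i (T x)"
proof -
  obtain q where q: "\<And>l. i < l \<Longrightarrow> l \<le> k \<Longrightarrow> (inf_expand (q * root_poly (take l xs)) * hf) $$ 1 = 0"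
    "(inf_expand (q * root_poly (take i xs)) * hf) $$ 1 = 1"
    using ex_dual_polynomial[OF i] by blast
  show ?thesis
  proof (rule that[of "Ec q"])
    show "Ec q v = 0" by (simp add: Ec_def E_v)
    fix x
    show "Ec q (g i x) = scale eps x - g i (Ec q x)"
      using Ec_Fc[of q "root_poly (take i xs)" x] q(2) by (simp add: comb_H_0 g_def eq_diff_eq)
    show "Ec q (g l x) = - g l (Ec q x)" if "i < l" "l \<le> k" for l
      using Ec_Fc[of q "root_poly (take l xs)" x] q(1)[OF that] by (simp add: comb_H_0 g_def eq_neg_iff_add_eq_0)
  qed (rule linear_Ec)
qed

text \<open>The bound on \<open>n\<close> says that only factors \<open>g l\<close> with
  \<open>l > i\<close> occur in \<open>V n\<close>.\<close>

lemma dual_kills_V: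
  assumes T: "operator T" "T v = 0"
    "\<And>l x. i < l \<Longrightarrow> l \<le> k \<Longrightarrow> T (g l x) = - g l (T x)" and n: "n < k - i"
  shows "x \<in> V n \<Longrightarrow> T x = 0"
  using n
proof (induction n arbitrary: x)
  case 0
  have "T x \<in> {0}" by (rule V_into[OF T(1) _ _ 0(1)]) (auto simp: T(2))
  then show ?case by simp
next
  case (Suc n)
  have 0: "T y = 0" if "y \<in> V n" for y using Suc that by simp
  have "T x \<in> {0}"
    by (rule V_Suc_into[OF T(1) _ _ _ Suc.prems(1)]) (use Suc.prems 0 in \<open>simp_all add: T(3) g_linear\<close>)
  then show ?case by simp
qed

text \<open>The operator dual to the newest factor kills \<open>V n\<close> and strips this factor,
  so a relation involving a new vector becomes one among the vectors of \<open>bs n\<close>.\<close>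

lemma bs_independent: "n \<le> k \<Longrightarrow> m < length (bs n) \<Longrightarrow> bs n ! m \<notin> span (set (take m (bs n)))"
proof (induction n arbitrary: m)
  case 0
  then show ?case using v_nonzero by simp
next
  case (Suc n)
  let ?i = "k - Suc n"
  show ?case
  proof (cases "m < length (bs n)")
    case True
    then show ?thesis using Suc.IH[OF _ True] Suc.prems by (simp add: nth_append)
  next
    case False
    define j where "j = m - length (bs n)"
    have j: "m = length (bs n) + j" "j < length (bs n)" using False Suc.prems by (auto simp: j_def)
    have nth: "bs (Suc n) ! m = g ?i (bs n ! j)" using j by (simp add: nth_append)
    have take: "set (take m (bs (Suc n))) = set (bs n) \<union> g ?i ` set (take j (bs n))"
      using j by (simp add: take_map)
    show ?thesis
    proof
      assume "bs (Suc n) ! m \<in> span (set (take m (bs (Suc n))))"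
      then obtain a b where ab: "a \<in> span (set (bs n))" "b \<in> span (set (take j (bs n)))" "g ?i (bs n ! j) = a + g ?i b"
        unfolding nth take by (rule span_Un_image[OF linear_g])
      obtain T where T: "operator T" "T v = 0"
        "\<And>l x. ?i < l \<Longrightarrow> l \<le> k \<Longrightarrow> T (g l x) = - g l (T x)" "\<And>x. T (g ?i x) = scale eps x - g ?i (T x)"
        by (rule ex_dual[of ?i]) (use Suc.prems in auto)
      have kill: "T x = 0" if "x \<in> V n" for x
        using dual_kills_V[OF T(1-3), where n = n and x = x] Suc.prems that by simp
      have "span (set (take j (bs n))) \<subseteq> V n" unfolding V_def by (intro span_mono set_take_subset)
      then have "T b = 0" using ab(2) kill by blast
      moreover have "T (bs n ! j) = 0" using j by (intro kill bs_V) simp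
      moreover have "T a = 0" using ab(1) by (intro kill) (simp add: V_def)
      ultimately have "scale eps (bs n ! j) = scale eps b"
        using arg_cong[OF ab(3), of T] by (simp add: T(4) linear_op[OF T(1)] g_linear)
      then have "bs n ! j = b" using eps_sq by auto
      then show False using Suc.IH[OF _ j(2)] Suc.prems ab(2) by simp
    qed
  qed
qed

lemma A_V_if_triangular:
  assumes tri: "\<And>m r. m < length (bs n) \<Longrightarrow>
      A r (bs n ! m) - scale ((ms n ! m) $ r) (bs n ! m) \<in> span (set (take m (bs n)))"
    and x: "x \<in> V n"
  shows "A r x \<in> V n"
proof (rule V_into[OF linear_ops(1) subspace_V _ x])
  fix y assume "y \<in> set (bs n)"
  then obtain m where m: "m < length (bs n)" "y = bs n ! m" by (auto simp: in_set_conv_nth)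
  have "span (set (take m (bs n))) \<subseteq> V n" unfolding V_def by (intro span_mono set_take_subset)
  then have "A r y - scale ((ms n ! m) $ r) y \<in> V n" using tri[OF m(1)] m(2) by blast
  moreover have "scale ((ms n ! m) $ r) y \<in> V n"
    using m by (intro subspace_scale[OF subspace_V] bs_V) simp
  ultimately have "(A r y - scale ((ms n ! m) $ r) y) + scale ((ms n ! m) $ r) y \<in> V n"
    by (rule subspace_add[OF subspace_V])
  then show "A r y \<in> V n" by simp
qed

text \<open>Inside the induction over the factors, induct on \<open>r\<close> by means of
  \<open>A_g\<close>. The terms with \<open>g (Suc ?i)\<close> stay in \<open>V n\<close>, which
  precedes the new half of the list; what remains follows the recursion \<open>twist_nth_Suc\<close>
  of the diagonal entry.\<close>

lemma bs_triangular:
  "n \<le> k \<Longrightarrow> m < length (bs n) \<Longrightarrow> A r (bs n ! m) - scale ((ms n ! m) $ r) (bs n ! m) \<in> span (set (take m (bs n)))"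
proof (induction n arbitrary: m r)
  case 0
  then show ?case by (simp add: A_v)
next
  case (Suc n)
  let ?i = "k - Suc n"
  have i: "?i < k" "Suc ?i = k - n" using Suc.prems by auto
  have IH: "A r (bs n ! m) - scale ((ms n ! m) $ r) (bs n ! m) \<in> span (set (take m (bs n)))"
    if "m < length (bs n)" for m r
    using Suc.IH[OF _ that] Suc.prems by simp
  note A_V = A_V_if_triangular[OF IH]
  show ?case
  proof (cases "m < length (bs n)")
    case True
    then show ?thesis using IH[OF True] by (simp add: nth_append length_bs length_ms)
  next
    case False
    define j where "j = m - length (bs n)"
    have j: "m = length (bs n) + j" "j < length (bs n)" using False Suc.prems by (auto simp: j_def)
    let ?y = "bs n ! j" and ?\<mu> = "ms n ! j"
    let ?S = "span (set (bs n) \<union> g ?i ` set (take j (bs n)))"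
    have nth: "bs (Suc n) ! m = g ?i ?y" "ms (Suc n) ! m = twist (xs ! ?i) ?\<mu>"
      and take: "set (take m (bs (Suc n))) = set (bs n) \<union> g ?i ` set (take j (bs n))"
      using j by (simp_all add: nth_append take_map length_bs length_ms)
    have V_S: "V n \<subseteq> ?S" unfolding V_def by (intro span_mono) simp
    have g_S: "g ?i x \<in> ?S" if "x \<in> span (set (take j (bs n)))" for x
      by (rule span_image_subset[OF linear_g subspace_span _ that]) (auto intro: span_base)
    have y: "?y \<in> V n" using j by (intro bs_V) simp
    have g_V': "g (Suc ?i) x \<in> V n" if "x \<in> V n" for x
      using that i Suc.prems by (intro g_V) auto
    have "A r (g ?i ?y) - scale ((twist (xs ! ?i) ?\<mu>) $ r) (g ?i ?y) \<in> ?S"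
    proof (induction r)
      case 0
      have "?\<mu> $ 0 = 1" using j by (intro ms_nth_0[of _ n]) (simp add: length_bs length_ms)
      then show ?case by (simp add: A_0 twist_nth_0 span_zero)
    next
      case (Suc r)
      let ?t = "twist (xs ! ?i) ?\<mu>"
      have "A (Suc r) (g ?i ?y) - scale (?t $ Suc r) (g ?i ?y) =
        A r (g (Suc ?i) ?y) - g (Suc ?i) (A r ?y)
        + scale (xs ! ?i) (A r (g ?i ?y) - scale (?t $ r) (g ?i ?y))
        + g ?i (A (Suc r) ?y - scale (?\<mu> $ Suc r) ?y)
        - scale (xs ! ?i + eps) (g ?i (A r ?y - scale (?\<mu> $ r) ?y))"
        by (simp add: A_g[OF i(1)] twist_nth_Suc g_linear scale_right_diff_distrib scale_left_diff_distrib
             scale_left_distrib scale_right_distrib algebra_simps)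
      also have "\<dots> \<in> ?S"
      proof -
        have 1: "A r (g (Suc ?i) ?y) \<in> ?S" "g (Suc ?i) (A r ?y) \<in> ?S"
          using V_S A_V g_V' y by blast+
        have 2: "g ?i (A (Suc r) ?y - scale (?\<mu> $ Suc r) ?y) \<in> ?S"
          "g ?i (A r ?y - scale (?\<mu> $ r) ?y) \<in> ?S"
          using IH[OF j(2)] by (intro g_S; simp)+
        show ?thesis
          by (rule span_diff[OF span_add[OF span_add[OF span_diff[OF 1] span_scale[OF Suc]] 2(1)] span_scale[OF 2(2)]])
      qed
      finally show ?case .
    qed
    then show ?thesis unfolding nth take .
  qed
qed

end

section \<open>Shifted polynomials, spanning, and the lowest vector\<close>

lemma shift_poly_pCons_0: "shift_poly (pCons 0 p) c = [:- c, 1:] * shift_poly p c"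
  by (simp add: shift_poly_def pcompose_pCons)

lemma shift_poly_diff: "shift_poly (p - q) c = shift_poly p c - shift_poly q c"
  and shift_poly_smult: "shift_poly (smult a p) c = smult a (shift_poly p c)"
  and degree_shift_poly: "degree (shift_poly p c) = degree p"
  by (simp_all add: shift_poly_def pcompose_diff pcompose_smult degree_pcompose)

lemma shift_poly_eq_0: "shift_poly p c = 0 \<longleftrightarrow> p = 0"
  by (simp add: shift_poly_def pcompose_eq_0_iff)

lemma fls_subdegree_inf_expand: "p \<noteq> 0 \<Longrightarrow> fls_subdegree (inf_expand p) = - int (degree p)"
  by (rule fls_subdegree_eqI) (auto simp: inf_expand_nth coeff_eq_0)

context highest_weight_roots begin

abbreviation "\<phi> \<equiv> root_poly xs"

lemma A_V: "n \<le> k \<Longrightarrow> x \<in> V n \<Longrightarrow> A r x \<in> V n"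
  using A_V_if_triangular bs_triangular by blast

text \<open>Multiplication by u sends a Newton polynomial to the next one plus x_i times itself, and
  multiples of phi act by zero; so every mode of f is a linear combination of the
  \<open>g i\<close>. A general \<open>Q\<close> covers both membership in \<open>V k\<close> and
  vanishing.\<close>

lemma Fc_monom_induct:
  assumes Q: "\<And>i. i \<le> k \<Longrightarrow> Q (g i x)" and lin: "Q 0" "\<And>y z c. Q y \<Longrightarrow> Q z \<Longrightarrow> Q (y + scale c z)"
  shows "i \<le> k \<Longrightarrow> Q (Fc (monom 1 j * root_poly (take i xs)) x)"
proof (induction j arbitrary: i)
  case 0
  then show ?case using Q by (simp add: g_def)
next
  case (Suc j)
  show ?case
  proof (cases "i = k")
    case True
    then show ?thesis using lin(1) by (simp add: Fc_multiple)
  next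
    case False
    with Suc.prems have i: "i < k" by simp
    have "monom 1 (Suc j) * root_poly (take i xs) = monom 1 j * pCons 0 (root_poly (take i xs))"
      by (simp add: monom_Suc)
    also have "\<dots> = monom 1 j * root_poly (take (Suc i) xs) + smult (xs ! i) (monom 1 j * root_poly (take i xs))"
      by (simp add: pCons_root_poly[OF i] distrib_left)
    finally have "Fc (monom 1 (Suc j) * root_poly (take i xs)) x =
      Fc (monom 1 j * root_poly (take (Suc i) xs)) x + scale (xs ! i) (Fc (monom 1 j * root_poly (take i xs)) x)"
      by (simp add: Fc_poly)
    then show ?thesis using lin(2) Suc.IH[of i] Suc.IH[of "Suc i"] i by simp
  qed
qed

lemma F_induct:
  assumes "\<And>i. i \<le> k \<Longrightarrow> Q (g i x)" "Q 0" "\<And>y z c. Q y \<Longrightarrow> Q z \<Longrightarrow> Q (y + scale c z)"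
  shows "Q (F j x)"
  using Fc_monom_induct[of Q x 0 j, OF assms] by (simp add: Fc_monom)

lemma F_V: "x \<in> V k \<Longrightarrow> F j x \<in> V k"
  by (rule F_induct) (auto intro: g_V subspace_0 subspace_add subspace_scale subspace_V)

lemma E_V: "n \<le> k \<Longrightarrow> x \<in> V n \<Longrightarrow> E r x \<in> V n"
proof (induction n arbitrary: x)
  case 0
  show ?case by (rule V_into[OF linear_ops(3) subspace_V _ 0(2)]) (auto simp: E_v subspace_0[OF subspace_V])
next
  case (Suc n)
  let ?i = "k - Suc n"
  show ?case
  proof (rule V_Suc_into[OF linear_ops(3) subspace_V _ _ Suc.prems(2)])
    fix z assume z: "z \<in> V n"
    have Ez: "E r z \<in> V n" using Suc z by simp
    then show "E r z \<in> V (Suc n)" using V_mono by blast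
    define c where "c = eps * (inf_expand (root_poly (take ?i xs)) * hf) $$ (int r + 1)"
    have "E r (g ?i z) + g ?i (E r z) = scale c z"
      using E_Fc[of r "root_poly (take ?i xs)" z] by (simp add: g_def comb_H c_def)
    then have "E r (g ?i z) = scale c z - g ?i (E r z)" by (simp add: eq_diff_eq)
    moreover have "scale c z \<in> V (Suc n)"
      using z V_mono by (intro subspace_scale[OF subspace_V]) blast
    ultimately show "E r (g ?i z) \<in> V (Suc n)"
      using g_V_Suc[OF Ez] by (simp add: subspace_diff[OF subspace_V])
  qed
qed

lemma P_V: "x \<in> V n \<Longrightarrow> P x \<in> V n"
proof (induction n arbitrary: x)
  case 0
  show ?case
    by (rule V_into[OF linear_ops(6) subspace_V _ 0]) (simp add: P_v subspace_scale[OF subspace_V] bs_V)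
next
  case (Suc n)
  have Py: "P y \<in> V n" if "y \<in> V n" for y using Suc that by simp
  show ?case
  proof (rule V_Suc_into[OF linear_ops(6) subspace_V _ _ Suc.prems])
    fix y assume "y \<in> V n"
    then show "P y \<in> V (Suc n)" "P (g (k - Suc n) y) \<in> V (Suc n)"
      using Py V_mono by (auto simp: P_g intro: subspace_neg[OF subspace_V] g_V_Suc)
  qed
qed

lemma span_bs: "span (set (bs k)) = UNIV"
proof -
  have v: "v \<in> set (bs n)" for n by (induction n) auto
  have "V k = {0} \<or> V k = UNIV"
    by (rule irreducible) (auto simp: subspace_V P_V A_V E_V F_V)
  moreover have "V k \<noteq> {0}" using bs_V[OF v, of k] v_nonzero by auto
  ultimately show ?thesis by (simp add: V_def)
qed

lemma bs_nonempty: "bs n \<noteq> []" "ms n \<noteq> []"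
  using length_bs[of n] length_ms[of n] by fastforce+

text \<open>The last monomial of \<open>bs n\<close> applies all \<open>n\<close> available factors
  to \<open>v\<close>; \<open>w k\<close> is the lowest vector.\<close>

definition "w n = last (bs n)"
definition "\<beta> n = last (ms n)"

lemma w_simps: "w 0 = v" "w (Suc n) = g (k - Suc n) (w n)"
  and beta_simps: "\<beta> 0 = \<alpha>" "\<beta> (Suc n) = twist (xs ! (k - Suc n)) (\<beta> n)"
  by (simp_all add: w_def \<beta>_def bs_nonempty last_map)

lemma g_w: "n \<le> k \<Longrightarrow> k - n \<le> l \<Longrightarrow> l \<le> k \<Longrightarrow> g l (w n) = 0"
proof (induction n)
  case 0
  then have "l = k" by simp
  then show ?case by (simp only: g_last)
next
  case (Suc n)
  show ?case
  proof (cases "l = k - Suc n")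
    case True
    then show ?thesis by (simp add: w_simps g_g_same)
  next
    case False
    then have "g l (w n) = 0" using Suc by simp
    then show ?thesis using g_g[of l "k - Suc n" "w n"] by (simp add: w_simps g_linear)
  qed
qed

text \<open>The off-diagonal terms of \<open>A_g\<close> contain \<open>g (Suc ?i)\<close>, which
  kills \<open>w n\<close> by \<open>g_w\<close>, so the triangular action is diagonal on these
  vectors.\<close>

lemma A_w: "n \<le> k \<Longrightarrow> A r (w n) = scale ((\<beta> n) $ r) (w n)"
proof (induction n arbitrary: r)
  case 0
  then show ?case by (simp add: w_simps beta_simps A_v)
next
  case (Suc n)
  let ?i = "k - Suc n"
  have i: "?i < k" "Suc ?i = k - n" using Suc.prems by auto
  have IH: "A r (w n) = scale ((\<beta> n) $ r) (w n)" for r using Suc by simp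
  have 0: "g (Suc ?i) (w n) = 0" using Suc.prems i by (intro g_w) auto
  show ?case
  proof (induction r)
    case 0
    have "(\<beta> (Suc n)) $ 0 = 1"
      unfolding \<beta>_def by (rule ms_nth_0) (rule last_in_set[OF bs_nonempty(2)])
    then show ?case by (simp add: A_0)
  next
    case (Suc r)
    then show ?case
      using A_g[OF i(1), of r "w n"]
      by (simp add: w_simps beta_simps IH g_linear 0 A_linear twist_nth_Suc scale_left_distrib scale_left_diff_distrib)
  qed
qed

lemma P_w: "\<exists>c. P (w n) = scale c (w n)"
proof (induction n)
  case 0
  then show ?case by (auto simp: w_simps P_v)
next
  case (Suc n)
  then obtain c where "P (w n) = scale c (w n)" by blast
  then have "P (w (Suc n)) = scale (- c) (w (Suc n))"
    by (simp add: w_simps P_g g_linear)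
  then show ?case by blast
qed

lemma w_nonzero: "w k \<noteq> 0"
proof
  let ?m = "length (bs k) - 1"
  assume "w k = 0"
  then have "bs k ! ?m = 0" by (simp add: w_def last_conv_nth bs_nonempty)
  moreover have "?m < length (bs k)" by (simp add: bs_nonempty)
  ultimately show False using bs_independent[of k ?m] span_zero by simp
qed

lemma F_w: "F j (w k) = 0"
  by (rule F_induct) (simp_all add: g_w)

lemma C_w: "C r (w k) = 0"
proof -
  have "scale eps (C r (w k)) = 0"
    using C_eq[of r "w k"] by (simp add: A_w F_w A_linear F_linear)
  then show ?thesis using eps_sq by auto
qed

text \<open>The polynomials with \<open>N\<^sub>m / \<phi> = \<Sum>\<^sub>j h\<^sub>m\<^sub>+\<^sub>j\<^sub>+\<^sub>1 u\<^sup>-\<^sup>j\<^sup>-\<^sup>1\<close>.\<close>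

primrec tail_poly :: "nat \<Rightarrow> complex poly" where
  "tail_poly 0 = \<psi> - \<phi>"
| "tail_poly (Suc m) = pCons 0 (tail_poly m) - smult (h $ Suc m) \<phi>"

lemma inf_phi_nonzero: "inf_expand \<phi> \<noteq> 0"
  by (simp add: inf_expand_eq_0 root_poly_nonzero)

lemma tail_poly_nth: "(inf_expand (tail_poly m) / inf_expand \<phi>) $$ n = (if n \<le> 0 then 0 else h $ (m + nat n))"
proof (induction m arbitrary: n)
  case 0
  have "inf_expand (tail_poly 0) / inf_expand \<phi> = hf - 1"
    using inf_phi_nonzero by (simp add: inf_expand_diff h_eq[symmetric] diff_divide_distrib)
  then show ?case using h_0 by (auto simp: fps_to_fls_nth)
next
  case (Suc m)
  define T where "T = inf_expand (tail_poly m) / inf_expand \<phi>"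
  have "inf_expand (tail_poly (Suc m)) / inf_expand \<phi> = fls_X_inv * T - fls_const (h $ Suc m)"
    using inf_phi_nonzero
    by (simp add: T_def inf_expand_diff inf_expand_smult inf_expand_pCons diff_divide_distrib)
  then have "(inf_expand (tail_poly (Suc m)) / inf_expand \<phi>) $$ n
    = T $$ (n + 1) - (if n = 0 then h $ Suc m else 0)"
    by (simp add: fls_X_inv_times_conv_shift)
  then show ?case using Suc.IH[folded T_def] by (auto simp: nat_add_distrib)
qed

text \<open>The quotient by phi is a proper fraction, since its expansion has only negative powers
  of u.\<close>

lemma degree_tail_poly: "tail_poly m \<noteq> 0 \<Longrightarrow> degree (tail_poly m) < k"
proof (rule ccontr)
  assume nz: "tail_poly m \<noteq> 0" and "\<not> degree (tail_poly m) < k"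
  then have k: "k \<le> degree (tail_poly m)" by simp
  let ?j = "degree (tail_poly m)"
  let ?T = "inf_expand (tail_poly m) / inf_expand \<phi>"
  have "inf_expand (tail_poly m) = inf_expand \<phi> * ?T"
    using inf_phi_nonzero by simp
  then have "coeff (tail_poly m) ?j = (inf_expand \<phi> * ?T) $$ (- int ?j)"
    by (metis inf_expand_nth minus_minus nat_int neg_le_0_iff_le of_nat_0_le_iff)
  also have "\<dots> = (\<Sum>i\<le>k. coeff \<phi> i * ?T $$ (- int ?j + int i))"
    by (rule inf_expand_mult_nth) (simp add: degree_root_poly)
  also have "\<dots> = 0"
    using k by (intro sum.neutral) (auto simp: tail_poly_nth)
  finally show False using nz by simp
qed

text \<open>The eigenvalue of t_21(u) E_m on \<open>w k\<close>. On this vector \<open>C_E\<close>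
  becomes (u - eps) \<open>\<Gamma>\<close>_m = \<open>\<Gamma>\<close>_(m+1) + eps h_(m+1)
  \<open>\<beta>\<close>_k; the recursion of \<open>tail_poly\<close>, taken at u - eps and
  multiplied by eps \<open>\<beta>\<close>_k / phi(u - eps), is the same equation.\<close>

definition "\<Gamma> m = fls_const eps * fps_to_fls (\<beta> k) * inf_expand (shift_poly (tail_poly m) eps) / inf_expand (shift_poly \<phi> eps)"

lemma inf_shift_phi_nonzero: "inf_expand (shift_poly \<phi> eps) \<noteq> 0"
  by (simp add: inf_expand_eq_0 root_poly_nonzero shift_poly_eq_0)

lemma beta_nonzero: "\<beta> k \<noteq> 0"
proof -
  have "(\<beta> k) $ 0 = 1"
    unfolding \<beta>_def by (rule ms_nth_0) (rule last_in_set[OF bs_nonempty(2)])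
  then show ?thesis by auto
qed

text \<open>The fraction in \<open>\<Gamma>\<close> is proper, so the solution starts with the first
  negative power of u; this is the initial condition matching \<open>C_0\<close>.\<close>

lemma Gamma_low: "n \<le> 0 \<Longrightarrow> (\<Gamma> m) $$ n = 0"
proof (cases "tail_poly m = 0")
  case True
  then show ?thesis by (simp add: \<Gamma>_def shift_poly_def)
next
  case False
  assume n: "n \<le> 0"
  have eps: "eps \<noteq> 0" using eps_sq by auto
  have nz: "\<Gamma> m \<noteq> 0"
    using False eps beta_nonzero inf_shift_phi_nonzero
    by (simp add: \<Gamma>_def inf_expand_eq_0 shift_poly_eq_0)
  have "\<Gamma> m * inf_expand (shift_poly \<phi> eps) = fls_const eps * fps_to_fls (\<beta> k) * inf_expand (shift_poly (tail_poly m) eps)"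
    using inf_shift_phi_nonzero by (simp add: \<Gamma>_def)
  from arg_cong[OF this, of fls_subdegree]
  have "fls_subdegree (\<Gamma> m) - int k = int (subdegree (\<beta> k)) - int (degree (tail_poly m))"
    using nz False eps beta_nonzero inf_shift_phi_nonzero
    by (simp add: inf_expand_eq_0 shift_poly_eq_0 fls_subdegree_inf_expand degree_shift_poly root_poly_nonzero
        degree_root_poly fls_subdegree_fls_to_fps)
  then have "fls_subdegree (\<Gamma> m) > 0" using degree_tail_poly[OF False] by linarith
  then show ?thesis using n by (intro fls_eq0_below_subdegree) simp
qed

lemma Gamma_Suc: "(\<Gamma> m) $$ (int (Suc r)) = (\<Gamma> (Suc m)) $$ (int r) + eps * (\<Gamma> m) $$ (int r)
    + eps * (h $ Suc m * (\<beta> k) $ r)"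
proof -
  let ?S = "inf_expand (shift_poly \<phi> eps)" and ?N = "\<lambda>m. inf_expand (shift_poly (tail_poly m) eps)"
  have N: "?N (Suc m) = (fls_X_inv - fls_const eps) * ?N m - fls_const (h $ Suc m) * ?S"
    by (simp add: shift_poly_diff shift_poly_smult shift_poly_pCons_0 inf_expand_diff inf_expand_smult
        inf_expand_mult inf_expand_pCons fls_const_uminus del: mult_pCons_left)
  let ?G = "fls_const eps * fps_to_fls (\<beta> k)" and ?c = "fls_const (h $ Suc m)"
  have S: "\<Gamma> m * ?S = ?G * ?N m" for m
    using inf_shift_phi_nonzero by (simp add: \<Gamma>_def)
  have "\<Gamma> (Suc m) * ?S = (fls_X_inv - fls_const eps) * (?G * ?N m) - ?G * ?c * ?S"
    unfolding S N by (simp only: right_diff_distrib mult_ac)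
  also have "\<dots> = ((fls_X_inv - fls_const eps) * \<Gamma> m - fls_const eps * ?c * fps_to_fls (\<beta> k)) * ?S"
    unfolding S[symmetric] by (simp only: left_diff_distrib right_diff_distrib mult_ac)
  finally have "\<Gamma> (Suc m) * ?S = ((fls_X_inv - fls_const eps) * \<Gamma> m
    - fls_const eps * fls_const (h $ Suc m) * fps_to_fls (\<beta> k)) * ?S" .
  then have "\<Gamma> (Suc m) = (fls_X_inv - fls_const eps) * \<Gamma> m
    - fls_const eps * fls_const (h $ Suc m) * fps_to_fls (\<beta> k)"
    using inf_shift_phi_nonzero by simp
  from arg_cong[OF this, of "\<lambda>y. y $$ (int r)"]
  show ?thesis
    by (simp add: left_diff_distrib fls_X_inv_times_conv_shift mult.assoc algebra_simps)
qed

lemma C_E_w: "C r (E m (w k)) = scale ((\<Gamma> m) $$ (int r)) (w k)"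
proof (induction r arbitrary: m)
  case 0
  then show ?case by (simp add: C_0 Gamma_low)
next
  case (Suc r)
  have "C (Suc r) (E m (w k)) - C r (E (Suc m) (w k)) - scale eps (C r (E m (w k)))
    = scale (eps * (h $ Suc m * (\<beta> k) $ r)) (w k)"
    using C_E[of r m "w k"] by (simp add: C_w E_linear H_h A_w)
  then have "C (Suc r) (E m (w k)) = C r (E (Suc m) (w k)) + scale eps (C r (E m (w k)))
    + scale (eps * (h $ Suc m * (\<beta> k) $ r)) (w k)"
    by (simp add: algebra_simps)
  then show ?case
    unfolding Suc.IH Gamma_Suc by (simp only: scale_left_distrib scale_scale)
qed

text \<open>On \<open>w k\<close>, t_22 is t_11 plus eps times t_21 E_0. As eps squares to 1 and
  \<open>tail_poly 0\<close> is \<open>\<psi> - \<phi>\<close>, the t_11 part cancels against the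
  contribution of phi.\<close>

lemma D_w: "D r (w k) = scale ((fps_to_fls (\<beta> k) * inf_expand (shift_poly \<psi> eps) / inf_expand (shift_poly \<phi> eps)) $$ (int r)) (w k)"
proof -
  have "C r (E 0 (w k)) = scale eps (D r (w k) - A r (w k))"
    using C_E_0[of r "w k"] by (simp add: C_w E_linear)
  then have "scale eps (C r (E 0 (w k))) = D r (w k) - A r (w k)"
    by (simp add: eps_sq)
  then have "D r (w k) = A r (w k) + scale eps (C r (E 0 (w k)))" by simp
  then have D: "D r (w k) = scale ((\<beta> k) $ r + eps * (\<Gamma> 0) $$ (int r)) (w k)"
    by (simp add: C_E_w A_w scale_left_distrib)
  have "fls_const eps * \<Gamma> 0 = fps_to_fls (\<beta> k) * (inf_expand (shift_poly \<psi> eps) - inf_expand (shift_poly \<phi> eps)) / inf_expand (shift_poly \<phi> eps)"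
    using eps_sq by (simp add: \<Gamma>_def shift_poly_diff inf_expand_diff flip: mult.assoc)
  also have "\<dots> = fps_to_fls (\<beta> k) * inf_expand (shift_poly \<psi> eps) / inf_expand (shift_poly \<phi> eps) - fps_to_fls (\<beta> k)"
    using inf_shift_phi_nonzero by (simp add: right_diff_distrib diff_divide_distrib)
  finally have "fps_to_fls (\<beta> k) * inf_expand (shift_poly \<psi> eps) / inf_expand (shift_poly \<phi> eps)
    = fps_to_fls (\<beta> k) + fls_const eps * \<Gamma> 0" by simp
  then show ?thesis using D by simp
qed

end

section \<open>\<open>\<ell>\<close>-weights and the group ring\<close>

definition linear_ratio :: "complex \<Rightarrow> complex \<Rightarrow> complex fls" where
  "linear_ratio a b = inf_expand [:- a, 1:] / inf_expand [:- b, 1:]"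

lemma inf_expand_linear: "inf_expand [:- a, 1:] = fls_X_inv * fps_to_fls (1 - fps_const a * fps_X)"
proof (rule fls_eqI)
  fix n :: int
  consider "n < - 1" | "n = - 1" | "n = 0" | "n > 0" by linarith
  then show "(inf_expand [:- a, 1:]) $$ n = (fls_X_inv * fps_to_fls (1 - fps_const a * fps_X)) $$ n"
  proof cases
    case 1
    then have "nat (- n) = Suc (Suc (nat (- n - 2)))" by simp
    then show ?thesis using 1 by (simp add: inf_expand_nth fls_X_inv_times_conv_shift coeff_pCons)
  next
    case 4
    then have "nat (n + 1) = Suc (nat n)" "nat n \<noteq> 0" by auto
    then show ?thesis using 4 by (simp add: inf_expand_nth fls_X_inv_times_conv_shift)
  qed (simp_all add: inf_expand_nth fls_X_inv_times_conv_shift)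
qed

lemma linear_ratio_eq: "linear_ratio a b = fps_to_fls ((1 - fps_const a * fps_X) * inverse (1 - fps_const b * fps_X))"
proof -
  let ?f = "\<lambda>a. 1 - fps_const a * fps_X :: complex fps"
  have 1: "inverse (?f b) * ?f b = 1" by (rule inverse_mult_eq_1) simp
  have b: "inf_expand [:- b, 1:] \<noteq> 0" by (simp add: inf_expand_eq_0)
  have "fps_to_fls (?f a * inverse (?f b)) * inf_expand [:- b, 1:]
    = fls_X_inv * (fps_to_fls (?f a) * (fps_to_fls (inverse (?f b)) * fps_to_fls (?f b)))"
    unfolding inf_expand_linear fls_times_fps_to_fls by (simp only: mult_ac)
  also have "\<dots> = inf_expand [:- a, 1:]"
    by (simp only: 1 inf_expand_linear fls_times_fps_to_fls[symmetric] fps_one_to_fls mult_1_right)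
  finally show ?thesis using b by (simp add: linear_ratio_def field_simps)
qed

lemma linear_ratio_one_plus: "linear_ratio a b \<in> one_plus_series"
  unfolding linear_ratio_eq one_plus_series_def by (intro imageI) simp

lemma linear_ratio_inverse: "linear_ratio a b * linear_ratio b a = 1"
  by (simp add: linear_ratio_def inf_expand_eq_0)

lemma fps_to_fls_nth_nat: "(fps_to_fls f) $$ (int n) = f $ n"
  by simp

lemma fps_to_fls_one_plus: "f $ 0 = 1 \<Longrightarrow> fps_to_fls f \<in> one_plus_series"
  by (simp add: one_plus_series_def)

lemma lcomp_lw:
  assumes "f \<in> one_plus_series" "g \<in> one_plus_series"
  shows "lcomp (lw f g) One = f" "lcomp (lw f g) Two = g"
  using assms by (simp_all add: lw_def Abs_lweight_inverse split: ix.split)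

lemma lweight_eqI: "lcomp \<zeta> One = lcomp \<xi> One \<Longrightarrow> lcomp \<zeta> Two = lcomp \<xi> Two \<Longrightarrow> \<zeta> = \<xi>"
proof -
  assume "lcomp \<zeta> One = lcomp \<xi> One" "lcomp \<zeta> Two = lcomp \<xi> Two"
  then have "lcomp \<zeta> i = lcomp \<xi> i" for i by (cases i) simp_all
  then show ?thesis by (simp add: fun_eq_iff flip: lcomp_inject)
qed

lemma lcomp_add: "lcomp (\<zeta> + \<xi>) i = lcomp \<zeta> i * lcomp \<xi> i"
  by (simp add: plus_lweight.rep_eq)

lemma lcomp_0: "lcomp 0 i = 1"
  by (simp add: zero_lweight.rep_eq)

lemma lw_add:
  assumes "f \<in> one_plus_series" "g \<in> one_plus_series" "f' \<in> one_plus_series" "g' \<in> one_plus_series"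
  shows "lw f g + lw f' g' = lw (f * f') (g * g')"
  using assms by (intro lweight_eqI) (simp_all add: lcomp_add lcomp_lw one_plus_series_mult)

lemma basis_elt_mult: "basis_elt \<zeta> * basis_elt \<xi> = basis_elt (\<zeta> + \<xi>)"
  by (simp add: basis_elt_def mult_single)

lemma basis_elt_0: "basis_elt 0 = 1"
  by (simp add: basis_elt_def)

abbreviation diag_weight :: "complex fls \<Rightarrow> lweight" where
  "diag_weight q \<equiv> lw q q"

text \<open>The weight belonging to an eigenvalue \<open>\<mu>\<close> of d_1: since d_2 = d_1 h,
  its second component is \<open>\<mu> * h\<close>.\<close>

definition series_weight :: "complex fps \<Rightarrow> complex fps \<Rightarrow> lweight" where
  "series_weight h \<mu> = lw (fps_to_fls \<mu>) (fps_to_fls (\<mu> * h))"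

lemma lookup_sum_list_basis: "Poly_Mapping.lookup (sum_list (map basis_elt \<zeta>s)) \<xi> = int (count_list \<zeta>s \<xi>)"
  by (induction \<zeta>s) (auto simp: lookup_add basis_elt_def lookup_single)

lemma sum_list_basis_elt: "sum_list (map basis_elt \<zeta>s) = (\<Sum>\<zeta>\<in>set \<zeta>s. of_nat (count_list \<zeta>s \<zeta>) * basis_elt \<zeta>)"
proof (rule poly_mapping_eqI)
  fix \<xi>
  have scale: "of_nat n * basis_elt \<zeta> = Poly_Mapping.single \<zeta> (int n)" for n \<zeta>
  proof -
    have "of_nat n = Poly_Mapping.single (0 :: lweight) (int n)"
      by (induction n) (simp_all add: single_add)
    then show ?thesis by (simp only: basis_elt_def mult_single add_0 mult_1_right)
  qed
  have "Poly_Mapping.lookup (\<Sum>\<zeta>\<in>set \<zeta>s. of_nat (count_list \<zeta>s \<zeta>) * basis_elt \<zeta>) \<xi>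
      = (\<Sum>\<zeta>\<in>set \<zeta>s. if \<zeta> = \<xi> then int (count_list \<zeta>s \<zeta>) else 0)"
    unfolding lookup_sum scale lookup_single by (rule sum.cong) (auto simp: when_def)
  also have "\<dots> = int (count_list \<zeta>s \<xi>)" by (auto simp: count_list_0_iff)
  finally show "Poly_Mapping.lookup (sum_list (map basis_elt \<zeta>s)) \<xi>
      = Poly_Mapping.lookup (\<Sum>\<zeta>\<in>set \<zeta>s. of_nat (count_list \<zeta>s \<zeta>) * basis_elt \<zeta>) \<xi>"
    by (simp add: lookup_sum_list_basis)
qed

lemma count_list_map_inj: "inj f \<Longrightarrow> count_list (map f xs) (f x) = count_list xs x"
  by (induction xs) (auto dest: injD)

lemma inf_expand_shift_ratio:
  "inf_expand (shift_poly (root_poly xs) c) / inf_expand (root_poly xs) = (\<Prod>x\<leftarrow>xs. linear_ratio (x + c) x)"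
proof (induction xs)
  case Nil
  then show ?case by (simp add: shift_poly_def pcompose_1)
next
  case (Cons x xs)
  have "inf_expand (shift_poly (root_poly (x # xs)) c) / inf_expand (root_poly (x # xs))
    = linear_ratio (x + c) x * (inf_expand (shift_poly (root_poly xs) c) / inf_expand (root_poly xs))"
    by (simp only: root_poly_simps shift_poly_mult inf_expand_mult shift_poly_linear linear_ratio_def times_divide_times_eq)
  then show ?case using Cons by simp
qed

context highest_weight_roots begin

lemma fps_to_fls_twist: "fps_to_fls (twist a \<mu>) = fps_to_fls \<mu> * linear_ratio (a + eps) a"
  by (simp add: twist_def linear_ratio_eq mult.assoc flip: fls_times_fps_to_fls)

lemma series_weight_twist:
  assumes "\<mu> $ 0 = 1"
  shows "series_weight h (twist a \<mu>) = series_weight h \<mu> + diag_weight (linear_ratio (a + eps) a)"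
proof -
  have "fps_to_fls (twist a \<mu> * h) = fps_to_fls (\<mu> * h) * linear_ratio (a + eps) a"
    by (simp add: fls_times_fps_to_fls fps_to_fls_twist mult_ac)
  then show ?thesis using assms h_0 unfolding series_weight_def fps_to_fls_twist
    by (subst lw_add) (auto intro!: fps_to_fls_one_plus linear_ratio_one_plus)
qed

text \<open>Each doubling of \<open>ms\<close> multiplies the sum by one more factor.\<close>

lemma sum_list_series_weight:
  "n \<le> k \<Longrightarrow> (\<Sum>\<mu>\<leftarrow>ms n. basis_elt (series_weight h \<mu>))
    = basis_elt (series_weight h \<alpha>) * (\<Prod>x\<leftarrow>drop (k - n) xs. 1 + basis_elt (diag_weight (linear_ratio (x + eps) x)))"
proof (induction n)
  case 0
  then show ?case by simp
next
  case (Suc n)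
  let ?x = "xs ! (k - Suc n)" and ?f = "\<lambda>x. basis_elt (diag_weight (linear_ratio (x + eps) x))"
  have "k - Suc n < length xs" "Suc (k - Suc n) = k - n" using Suc.prems by auto
  then have drop: "drop (k - Suc n) xs = ?x # drop (k - n) xs" by (metis Cons_nth_drop_Suc)
  have "(\<Sum>\<mu>\<leftarrow>ms n. basis_elt (series_weight h (twist ?x \<mu>))) = (\<Sum>\<mu>\<leftarrow>ms n. basis_elt (series_weight h \<mu>) * ?f ?x)"
    by (intro arg_cong[of _ _ sum_list] map_cong refl) (simp add: series_weight_twist ms_nth_0 basis_elt_mult)
  also have "\<dots> = (\<Sum>\<mu>\<leftarrow>ms n. basis_elt (series_weight h \<mu>)) * ?f ?x"
    by (rule sum_list_mult_const)
  finally have "(\<Sum>\<mu>\<leftarrow>ms (Suc n). basis_elt (series_weight h \<mu>)) = (\<Sum>\<mu>\<leftarrow>ms n. basis_elt (series_weight h \<mu>)) * (1 + ?f ?x)"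
    by (simp add: comp_def distrib_left)
  then show ?case using Suc by (simp add: drop mult_ac)
qed

lemma beta_eq: "n \<le> k \<Longrightarrow> fps_to_fls (\<beta> n) = fps_to_fls \<alpha> * (\<Prod>x\<leftarrow>drop (k - n) xs. linear_ratio (x + eps) x)"
proof (induction n)
  case 0
  then show ?case by (simp add: beta_simps)
next
  case (Suc n)
  let ?x = "xs ! (k - Suc n)"
  have "k - Suc n < length xs" "Suc (k - Suc n) = k - n" using Suc.prems by auto
  then have drop: "drop (k - Suc n) xs = ?x # drop (k - n) xs" by (metis Cons_nth_drop_Suc)
  show ?case using Suc by (simp add: drop beta_simps fps_to_fls_twist mult_ac)
qed

lemma beta_last: "fps_to_fls (\<beta> k) = fps_to_fls \<alpha> * inf_expand (shift_poly \<phi> eps) / inf_expand \<phi>"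
  using beta_eq[of k] by (simp add: inf_expand_shift_ratio[symmetric])

lemma D_w_eq: "D r (w k) = scale ((fps_to_fls \<alpha> * inf_expand (shift_poly \<psi> eps) / inf_expand \<phi>) $$ (int r)) (w k)"
proof -
  have "fps_to_fls (\<beta> k) * inf_expand (shift_poly \<psi> eps) / inf_expand (shift_poly \<phi> eps)
    = fps_to_fls \<alpha> * inf_expand (shift_poly \<psi> eps) / inf_expand \<phi>"
    using inf_shift_phi_nonzero by (simp add: beta_last)
  then show ?thesis using D_w by simp
qed

end

section \<open>The q-character from the monomial basis\<close>

context irreducible_yangian_module begin

abbreviation "highest_weight_data \<equiv> highest_weight_roots scale (of_int (s One)) (t One One) (t Two One) (t Two Two) E_op F_op H_op parity"

lemma gauss_d_sum:
  assumes "\<And>i x. H_op i x = scale (h $ Suc i) x" "h $ 0 = 1"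
  shows "gauss_d t Two n v = (\<Sum>j\<le>n. scale (h $ (n - j)) (t One One j v))"
proof -
  have "(\<Sum>j<n. t One One j (H_op (n - 1 - j) v)) = (\<Sum>j<n. scale (h $ (n - j)) (t One One j v))"
    by (rule sum.cong) (auto simp: assms(1) t_scale Suc_diff_Suc)
  then show ?thesis
    by (simp add: gauss_d_eq assms(2) add.commute flip: lessThan_Suc_atMost)
qed

lemma t_Two_Two_highest:
  assumes "highest_weight_data v \<alpha> h \<pi> xs \<psi>"
  shows "t Two Two r v = scale ((\<alpha> * h) $ r) v"
proof -
  interpret hw: highest_weight_roots scale "of_int (s One)" "t One One" "t Two One" "t Two Two" E_op F_op H_op parity v \<alpha> h \<pi> xs \<psi>
    by fact
  have "t Two Two r v = gauss_d t Two r v"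
    by (subst t_Two_Two) (simp add: gauss_d_eq hw.E_v C_linear)
  also have "\<dots> = (\<Sum>j\<le>r. scale (h $ (r - j)) (scale (\<alpha> $ j) v))"
    by (simp add: gauss_d_sum[of h, OF hw.H_h hw.h_0] hw.A_v)
  also have "\<dots> = scale ((\<alpha> * h) $ r) v"
    by (simp add: fps_mult_nth atLeast0AtMost scale_sum_left mult.commute)
  finally show ?thesis .
qed

text \<open>All modes of d_1 and d_2 are linear combinations of the t_11 modes, with coefficients 0,
  1 or taken from \<open>h\<close>; commutation and triangularity on the monomial basis are
  inherited from t_11.\<close>

lemma qchar_eq_sum:
  assumes "highest_weight_data v \<alpha> h \<pi> xs \<psi>"
  shows "qchar scale t = sum_list (map basis_elt (map (series_weight h) (highest_weight_roots.ms (of_int (s One)) \<alpha> xs (length xs))))"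
proof -
  interpret hw: highest_weight_roots scale "of_int (s One)" "t One One" "t Two One" "t Two Two" E_op F_op H_op parity v \<alpha> h \<pi> xs \<psi>
    by fact
  \<comment> \<open>The pair \<open>(i, r)\<close> stands for the mode of d_i with index
    \<open>r + 1\<close>. Index 0 is left out, as in \<open>lweight_space\<close>.\<close>
  define T where "T = (\<lambda>(i, r). gauss_d t i (Suc r))"
  define c where "c = (\<lambda>i r j. case i of One \<Rightarrow> if j = Suc r then 1 else 0 | Two \<Rightarrow> h $ (Suc r - j))"
  define ev where "ev \<zeta> = (\<lambda>(i, r). (lcomp \<zeta> i) $$ (int (Suc r)))" for \<zeta>
  let ?ws = "map (series_weight h) (hw.ms hw.k)"
  have T_eq: "T (i, r) x = (\<Sum>j\<le>Suc r. scale (c i r j) (t One One j x))" for i r x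
  proof (cases i)
    case One
    have "(\<Sum>j\<le>Suc r. scale (c One r j) (t One One j x)) = (\<Sum>j\<le>Suc r. if j = Suc r then t One One j x else 0)"
      by (rule sum.cong) (auto simp: c_def)
    then show ?thesis using One by (simp add: T_def gauss_d_eq)
  next
    case Two
    then show ?thesis using gauss_d_sum[of h, OF hw.H_h hw.h_0] by (simp add: T_def c_def del: sum.atMost_Suc)
  qed
  have ev_series: "ev (series_weight h \<mu>) (i, r) = (\<Sum>j\<le>Suc r. c i r j * \<mu> $ j)"
    if "\<mu> $ 0 = 1" for \<mu> i r
  proof -
    have comps: "lcomp (series_weight h \<mu>) One = fps_to_fls \<mu>" "lcomp (series_weight h \<mu>) Two = fps_to_fls (\<mu> * h)"
      using that hw.h_0 by (simp_all add: series_weight_def lcomp_lw fps_to_fls_one_plus)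
    have nth: "(fps_to_fls f) $$ (int (Suc r)) = f $ Suc r" for f :: "complex fps" by (simp only: fps_to_fls_nth_nat)
    show ?thesis
    proof (cases i)
      case One
      have "(\<Sum>j\<le>Suc r. c One r j * \<mu> $ j) = (\<Sum>j\<le>Suc r. if j = Suc r then \<mu> $ j else 0)"
        by (rule sum.cong) (auto simp: c_def)
      then show ?thesis using One by (simp add: ev_def comps nth del: of_nat_Suc sum.atMost_Suc)
    next
      case Two
      then show ?thesis by (simp add: ev_def comps nth c_def fps_mult_nth atLeast0AtMost mult.commute del: of_nat_Suc sum.atMost_Suc)
    qed
  qed
  have triangular: "triangular_family scale T (hw.bs hw.k) (map ev ?ws)"
  proof (intro triangular_family.intro triangular_family_axioms.intro)
    show "finite_dim_space scale" by (rule finite_dim_space_axioms)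
    fix p q :: "ix \<times> nat" and x n
    obtain i r j m where pq: "p = (i, r)" "q = (j, m)" by (metis surj_pair)
    show "Vector_Spaces.linear scale scale (T p)"
      unfolding pq Vector_Spaces.linear_iff T_eq
      by (simp add: vector_space_axioms t_add t_scale scale_right_distrib sum.distrib scale_sum_right mult.commute
           del: sum.atMost_Suc)
    have "t One One k (\<Sum>j\<in>I. scale (a j) (t One One j x)) = (\<Sum>j\<in>I. scale (a j) (t One One j (t One One k x)))" for k I a
      by (simp add: A_linear A_A[of k])
    then have "T p (T q x) = (\<Sum>k\<le>Suc r. \<Sum>l\<le>Suc m. scale (c i r k * c j m l) (t One One l (t One One k x)))"
      unfolding pq T_eq by (simp add: scale_sum_right del: sum.atMost_Suc)
    moreover have "t One One k (\<Sum>j\<in>I. scale (a j) (t One One j x)) = (\<Sum>j\<in>I. scale (a j) (t One One k (t One One j x)))" for k I a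
      by (simp add: A_linear)
    then have "T q (T p x) = (\<Sum>l\<le>Suc m. \<Sum>k\<le>Suc r. scale (c i r k * c j m l) (t One One l (t One One k x)))"
      unfolding pq T_eq by (simp add: scale_sum_right mult.commute del: sum.atMost_Suc)
    ultimately show "T p (T q x) = T q (T p x)"
      by (simp only: sum.swap[of _ "{..Suc m}" "{..Suc r}"])
    show "length (map ev ?ws) = length (hw.bs hw.k)" by (simp add: hw.length_bs hw.length_ms)
    assume n: "n < length (hw.bs hw.k)"
    then show "hw.bs hw.k ! n \<notin> span (set (take n (hw.bs hw.k)))" by (rule hw.bs_independent[OF order_refl])
    let ?y = "hw.bs hw.k ! n" and ?\<mu> = "hw.ms hw.k ! n"
    have n': "n < length (hw.ms hw.k)" using n by (simp add: hw.length_bs hw.length_ms)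
    then have "?\<mu> $ 0 = 1" by (intro hw.ms_nth_0[of _ hw.k]) simp
    then have "T p ?y - scale ((map ev ?ws ! n) p) ?y
      = (\<Sum>j\<le>Suc r. scale (c i r j) (t One One j ?y - scale (?\<mu> $ j) ?y))"
      using n' unfolding pq T_eq
      by (simp add: ev_series scale_right_diff_distrib sum_subtractf scale_sum_left del: sum.atMost_Suc)
    also have "\<dots> \<in> span (set (take n (hw.bs hw.k)))"
      by (intro span_sum span_scale hw.bs_triangular[OF order_refl n])
    finally show "T p ?y - scale ((map ev ?ws ! n) p) ?y \<in> span (set (take n (hw.bs hw.k)))" .
  qed
  interpret tri: triangular_family scale T "hw.bs hw.k" "map ev ?ws" by (rule triangular)
  \<comment> \<open>The omitted coefficients all equal 1, so a weight is determined by the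
    others.\<close>
  have inj: "inj ev"
  proof (rule injI)
    fix \<zeta> \<xi> assume eq: "ev \<zeta> = ev \<xi>"
    have "lcomp \<zeta> i = lcomp \<xi> i" for i
    proof -
      have "lcomp \<zeta> i \<in> one_plus_series" "lcomp \<xi> i \<in> one_plus_series" using lcomp[of \<zeta>] lcomp[of \<xi>] by simp_all
      then obtain f g where fg: "lcomp \<zeta> i = fps_to_fls f" "lcomp \<xi> i = fps_to_fls g" "f $ 0 = 1" "g $ 0 = 1"
        by (auto simp: one_plus_series_def)
      have "f $ n = g $ n" for n
      proof (cases n)
        case (Suc r)
        then show ?thesis using fun_cong[OF eq, of "(i, r)"] by (simp only: ev_def fg prod.case fps_to_fls_nth_nat)
      qed (simp add: fg)
      then have "f = g" by (simp add: fps_eq_iff)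
      then show ?thesis using fg by simp
    qed
    then show "\<zeta> = \<xi>" by (intro lweight_eqI)
  qed
  have space: "lweight_space scale t \<zeta> = tri.weight_space (dim (UNIV :: 'v set)) (ev \<zeta>)" for \<zeta>
  proof -
    have "(\<forall>i. \<forall>r\<ge>1. ((\<lambda>w. gauss_d t i r w - scale ((lcomp \<zeta> i) $$ (int r)) w) ^^ N) x = 0) \<longleftrightarrow>
      (\<forall>p. (tri.shifted p (ev \<zeta> p) ^^ N) x = 0)" for N x
    proof -
      have "tri.shifted (i, r) (ev \<zeta> (i, r)) = (\<lambda>w. gauss_d t i (Suc r) w - scale ((lcomp \<zeta> i) $$ (int (Suc r))) w)" for i r
        by (rule ext, subst tri.shifted_def) (simp only: T_def ev_def prod.case)
      moreover have "(\<forall>r\<ge>1. Q r) \<longleftrightarrow> (\<forall>r. Q (Suc r))" for Q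
        by (auto dest: Suc_le_D)
      ultimately show ?thesis by (simp only: split_paired_All)
    qed
    then show ?thesis by (simp only: lweight_space_def tri.weight_space_def)
  qed
  \<comment> \<open>The exponent in \<open>lweight_space\<close> is the dimension of the module,
    which equals the length of the basis and hence is large enough for
    \<open>tri.dim_weight_space\<close>.\<close>
  have dim: "dim (lweight_space scale t \<zeta>) = count_list ?ws \<zeta>" for \<zeta>
    unfolding space using tri.dim_weight_space[OF hw.span_bs] tri.length_eq_dim[OF hw.span_bs]
    by (simp only: count_list_map_inj[OF inj] order_refl)
  have "{\<zeta>. lweight_space scale t \<zeta> \<noteq> {0}} = set ?ws"
  proof -
    have "lweight_space scale t \<zeta> \<noteq> {0} \<longleftrightarrow> count_list ?ws \<zeta> \<noteq> 0" for \<zeta>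
      unfolding dim[symmetric] space dim_eq_0
      using subspace_0[OF tri.subspace_weight_space] by blast
    then show ?thesis by (auto simp only: count_list_0_iff)
  qed
  then show ?thesis unfolding qchar_def sum_list_basis_elt dim by (simp only:)
qed

end

section \<open>Root multisets, subset sums and reduced fractions\<close>

lemma root_poly_mset_cong: "mset xs = mset ys \<Longrightarrow> root_poly xs = root_poly ys"
  unfolding root_poly_def by (simp flip: prod_mset_prod_list)

lemma root_poly_inject:
  "root_poly xs = root_poly ys \<Longrightarrow> mset xs = mset ys"
proof (induction xs arbitrary: ys)
  case Nil
  then have "length ys = 0" by (metis degree_root_poly list.size(3))
  then show ?case by simp
next
  case (Cons x xs)
  have "poly (root_poly ys) x = 0" using Cons.prems[symmetric] by simp
  moreover have "poly (root_poly zs) x = 0 \<Longrightarrow> x \<in> set zs" for zs by (induction zs) auto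
  ultimately have x: "x \<in> set ys" by blast
  then have ys: "mset ys = mset (x # remove1 x ys)" by simp
  have "[:- x, 1:] * root_poly xs = [:- x, 1:] * root_poly (remove1 x ys)"
    using Cons.prems root_poly_mset_cong[OF ys] by (simp del: mult_pCons_left)
  then have "root_poly xs = root_poly (remove1 x ys)" by (simp del: mult_pCons_left)
  then show ?case using Cons.IH ys by simp
qed

text \<open>The procedure allows every numbering of the roots; products over all of them depend only
  on the multiset of roots.\<close>

lemma prod_root_poly:
  fixes x :: "nat \<Rightarrow> complex" and G :: "complex \<Rightarrow> 'b :: comm_monoid_mult"
  assumes "(\<Prod>i\<in>{1..k}. [:- x i, 1:]) = root_poly zs"
  shows "(\<Prod>i\<in>{1..k}. G (x i)) = (\<Prod>z\<leftarrow>zs. G z)"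
proof -
  have list: "(\<Prod>i\<in>{1..k}. H (x i)) = (\<Prod>z\<leftarrow>map x [1..<Suc k]. H z)" for H :: "complex \<Rightarrow> 'c :: comm_monoid_mult"
    by (induction k) (simp_all add: mult.commute)
  have "root_poly (map x [1..<Suc k]) = root_poly zs"
    using assms unfolding list[of "\<lambda>x. [:- x, 1:]"] by (simp add: root_poly_def)
  then have "mset (map x [1..<Suc k]) = mset zs" by (rule root_poly_inject)
  then have "prod_mset (image_mset G (mset (map x [1..<Suc k]))) = prod_mset (image_mset G (mset zs))" by simp
  then show ?thesis unfolding list by (simp only: mset_map[symmetric] prod_mset_prod_list)
qed

lemma one_plus_series_prod: "(\<And>i. i \<in> I \<Longrightarrow> f i \<in> one_plus_series) \<Longrightarrow> prod f I \<in> one_plus_series"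
  by (induction I rule: infinite_finite_induct) (auto intro: one_plus_series_one one_plus_series_mult)

lemma linear_ratio_fps:
  obtains g where "linear_ratio a b = fps_to_fls g" "g $ 0 = 1" "g $ 1 = b - a"
proof
  let ?i = "inverse (1 - fps_const b * fps_X)"
  have "?i * (1 - fps_const b * fps_X) = 1" by (rule inverse_mult_eq_1) simp
  from arg_cong[OF this, of "\<lambda>y. y $ 1"] have i: "?i $ 1 = b" by simp
  show "linear_ratio a b = fps_to_fls ((1 - fps_const a * fps_X) * ?i)" by (rule linear_ratio_eq)
  show "((1 - fps_const a * fps_X) * ?i) $ 0 = 1" by simp
  show "((1 - fps_const a * fps_X) * ?i) $ 1 = b - a" using i by simp
qed

lemma lw_one: "lw 1 1 = 0"
  by (rule lweight_eqI) (simp_all add: lcomp_lw one_plus_series_one lcomp_0)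

lemma basis_elt_diag_prod:
  assumes "finite I" "\<And>i. i \<in> I \<Longrightarrow> f i \<in> one_plus_series"
  shows "basis_elt (diag_weight (prod f I)) = (\<Prod>i\<in>I. basis_elt (diag_weight (f i)))"
  using assms
proof (induction I rule: finite_induct)
  case empty
  then show ?case by (simp add: lw_one basis_elt_0)
next
  case (insert i I)
  then have "prod f I \<in> one_plus_series" by (intro one_plus_series_prod) auto
  moreover have "f i \<in> one_plus_series" using insert.prems by simp
  ultimately have "basis_elt (diag_weight (f i * prod f I)) = basis_elt (diag_weight (f i)) * basis_elt (diag_weight (prod f I))"
    by (simp add: basis_elt_mult lw_add)
  with insert show ?case by simp
qed

text \<open>Expand the product: a subset \<open>J\<close> records the factors from which the term
  other than 1 is taken.\<close>

lemma sum_Pow_basis_elt: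
  fixes x :: "nat \<Rightarrow> complex" and \<rho> :: "complex \<Rightarrow> complex fls"
  assumes zs: "(\<Prod>i\<in>{1..k}. [:- x i, 1:]) = root_poly zs" and \<rho>: "\<And>z. \<rho> z \<in> one_plus_series"
  shows "(\<Sum>J\<in>Pow {1..k}. basis_elt (diag_weight (\<Prod>i\<in>J. \<rho> (x i)))) = (\<Prod>z\<leftarrow>zs. 1 + basis_elt (diag_weight (\<rho> z)))"
proof -
  have "(\<Sum>J\<in>Pow {1..k}. basis_elt (diag_weight (\<Prod>i\<in>J. \<rho> (x i))))
    = (\<Sum>J\<in>Pow {1..k}. (\<Prod>i\<in>J. basis_elt (diag_weight (\<rho> (x i)))) * (\<Prod>i\<in>{1..k} - J. 1))"
    by (intro sum.cong refl) (auto simp: \<rho> finite_subset intro!: basis_elt_diag_prod)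
  also have "\<dots> = (\<Prod>i\<in>{1..k}. basis_elt (diag_weight (\<rho> (x i))) + 1)"
    by (rule prod_add[symmetric]) simp
  also have "\<dots> = (\<Prod>z\<leftarrow>zs. 1 + basis_elt (diag_weight (\<rho> z)))"
    unfolding prod_root_poly[OF zs, of "\<lambda>z. basis_elt (diag_weight (\<rho> z)) + 1"] by (simp only: add.commute)
  finally show ?thesis .
qed

lemma inf_expand_prod: "inf_expand (prod f J) = (\<Prod>i\<in>J. inf_expand (f i))"
  by (induction J rule: infinite_finite_induct) (simp_all add: inf_expand_mult)

lemma shift_poly_prod: "shift_poly (prod f J) c = (\<Prod>i\<in>J. shift_poly (f i) c)"
  by (simp add: shift_poly_def pcompose_prod)

lemma shift_ratio_prod:
  "inf_expand (shift_poly (\<Prod>i\<in>J. [:- x i, 1:]) c) / inf_expand (\<Prod>i\<in>J. [:- x i, 1:]) = (\<Prod>i\<in>J. linear_ratio (x i + c) (x i))"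
  "inf_expand (\<Prod>i\<in>J. [:- x i, 1:]) / inf_expand (shift_poly (\<Prod>i\<in>J. [:- x i, 1:]) c) = (\<Prod>i\<in>J. linear_ratio (x i) (x i + c))"
  by (simp_all only: shift_poly_prod shift_poly_linear inf_expand_prod linear_ratio_def prod_dividef)

lemma root_poly_ratio_one_plus:
  "length xs = length ys \<Longrightarrow> inf_expand (root_poly xs) / inf_expand (root_poly ys) \<in> one_plus_series"
proof (induction xs ys rule: list_induct2)
  case Nil
  then show ?case by (simp add: one_plus_series_one)
next
  case (Cons x xs y ys)
  have "inf_expand (root_poly (x # xs)) / inf_expand (root_poly (y # ys))
      = linear_ratio x y * (inf_expand (root_poly xs) / inf_expand (root_poly ys))"
    by (simp only: root_poly_simps inf_expand_mult linear_ratio_def times_divide_times_eq)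
  then show ?case using Cons.IH linear_ratio_one_plus one_plus_series_mult by metis
qed

lemma shift_root_poly: "shift_poly (root_poly xs) c = root_poly (map (\<lambda>x. x + c) xs)"
proof (induction xs)
  case Nil
  then show ?case by (simp add: shift_poly_def pcompose_1)
next
  case (Cons x xs)
  then show ?case by (simp only: root_poly_simps shift_poly_mult shift_poly_linear list.map)
qed

lemma poly_coprime_dvd:
  fixes p q r :: "complex poly"
  assumes "coprime p q" "p \<noteq> 0" "p dvd r * q" shows "p dvd r"
proof -
  obtain a b where "a * p + b * q = 1" using poly_bezout[OF assms(1,2)] by blast
  then have "r = r * (a * p + b * q)" by simp
  also have "\<dots> = p * (r * a) + (r * q) * b" by (simp add: algebra_simps)
  finally have r: "r = p * (r * a) + (r * q) * b" .
  show ?thesis by (subst r) (intro dvd_add dvd_mult2 dvd_refl assms(3))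
qed

lemma root_poly_eq_prod: "root_poly zs = (\<Prod>i\<in>{1..length zs}. [:- (zs ! (i - 1)), 1:])"
proof -
  have "(\<Prod>i\<in>{1..length zs}. [:- (zs ! (i - 1)), 1:]) = (\<Prod>i<length zs. [:- (zs ! i), 1:])"
    using prod.atLeast1_atMost_eq[of "\<lambda>i. [:- (zs ! (i - 1)), 1:]" "length zs"] by simp
  also have "\<dots> = root_poly zs"
    by (simp add: root_poly_def prod.list_conv_set_nth atLeast0LessThan)
  finally show ?thesis ..
qed

lemma monic_ratio_unique:
  fixes \<phi> \<psi> \<phi>' \<psi>' :: "complex poly"
  assumes "lead_coeff \<phi> = 1" "lead_coeff \<psi> = 1" "lead_coeff \<phi>' = 1" "lead_coeff \<psi>' = 1"
    and cop: "coprime \<phi> \<psi>" "coprime \<phi>' \<psi>'"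
    and eq: "inf_expand \<phi> / inf_expand \<psi> = inf_expand \<phi>' / inf_expand \<psi>'"
  shows "\<phi> = \<phi>'" "\<psi> = \<psi>'"
proof -
  have nz: "\<psi> \<noteq> 0" "\<psi>' \<noteq> 0" and nz': "\<phi> \<noteq> 0" "\<phi>' \<noteq> 0" using assms by auto
  then have "inf_expand (\<phi> * \<psi>') = inf_expand (\<phi>' * \<psi>)"
    using eq by (simp add: inf_expand_mult inf_expand_eq_0 field_simps)
  then have e: "\<phi> * \<psi>' = \<phi>' * \<psi>" by (simp only: inf_expand_inject)
  have "\<phi> dvd \<phi>' * \<psi>" "\<phi>' dvd \<phi> * \<psi>'" using e by (metis dvd_triv_left)+
  then have "\<phi> dvd \<phi>'" "\<phi>' dvd \<phi>"
    using poly_coprime_dvd cop nz' by blast+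
  then obtain c where c: "\<phi>' = \<phi> * c" and "degree \<phi>' \<le> degree \<phi>"
    using nz' by (auto intro: dvd_imp_degree_le)
  then have "degree c = 0" using nz' by (auto simp: degree_mult_eq)
  moreover have "lead_coeff c = 1" using assms(1,3) unfolding c lead_coeff_mult by simp
  ultimately have "c = 1" by (metis degree_eq_zeroE lead_coeff_pCons(2) one_pCons)
  then show phi: "\<phi> = \<phi>'" using c by simp
  have "\<phi>' \<noteq> 0" using assms(3) by auto
  then show "\<psi> = \<psi>'" using e phi by simp
qed

lemma prod_list_map_comp: "(\<Prod>z\<leftarrow>map f xs. G z) = (\<Prod>x\<leftarrow>xs. G (f x))"
  by (simp add: comp_def)

section \<open>The q-characters for both parity sequences\<close>

context irreducible_yangian_module begin

text \<open>As t_12 = d_1 e and d_1 has constant term 1, the modes of e on \<open>v\<close> are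
  recovered one after the other.\<close>

lemma E_op_eq_0:
  assumes "\<And>r. t One Two r v = 0" shows "E_op m v = 0"
proof (induction m rule: less_induct)
  case (less m)
  have "t One Two (Suc m) v = (\<Sum>k<Suc m. t One One k (E_op (m - k) v))"
    by (simp add: t_One_Two)
  also have "\<dots> = t One One 0 (E_op m v) + (\<Sum>k<m. t One One (Suc k) (E_op (m - Suc k) v))"
    by (subst sum.lessThan_Suc_shift) simp
  also have "\<dots> = E_op m v"
    using less by (simp add: A_0 A_linear)
  finally show ?case using assms by simp
qed

lemma highest_weight_structure:
  assumes v: "v \<noteq> 0" "\<And>i. E_op i v = 0" "\<And>r. t One One r v = scale (\<alpha> $ r) v" "parity v = scale \<pi> v"
  obtains h xs ys where "highest_weight_data v \<alpha> h \<pi> xs (root_poly ys)" "length ys = length xs"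
proof -
  obtain \<eta> where \<eta>: "\<And>i x. H_op i x = scale (\<eta> i) x" using H_scalar by blast
  define h where "h = Abs_fps (\<lambda>n. case n of 0 \<Rightarrow> 1 | Suc i \<Rightarrow> \<eta> i)"
  interpret hw: highest_weight_module scale "of_int (s One)" "t One One" "t Two One" "t Two Two" E_op F_op H_op parity v \<alpha> h \<pi>
    by (intro highest_weight_module.intro highest_weight_module_axioms.intro gauss_module_axioms)
       (simp_all add: v \<eta> h_def)
  obtain xs \<psi> where xs: "inf_expand (root_poly xs) * fps_to_fls h = inf_expand \<psi>" "coprime (root_poly xs) \<psi>"
    "lead_coeff \<psi> = 1" "degree \<psi> = length xs"
    by (rule hw.ex_rational_h)
  obtain ys where ys: "\<psi> = root_poly ys" using xs(3) ex_root_poly by blast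
  have "highest_weight_data v \<alpha> h \<pi> xs (root_poly ys)"
    using xs ys hw.highest_weight_module_axioms
    by (intro highest_weight_roots.intro highest_weight_roots_axioms.intro) simp_all
  moreover have "length ys = length xs" using xs(4) ys by (simp add: degree_root_poly)
  ultimately show ?thesis by (rule that)
qed

lemma qchar_product:
  assumes "highest_weight_data v \<alpha> h \<pi> xs \<psi>"
  shows "qchar scale t = basis_elt (series_weight h \<alpha>) *
    (\<Prod>x\<leftarrow>xs. 1 + basis_elt (diag_weight (linear_ratio (x + of_int (s One)) x)))"
proof -
  interpret hw: highest_weight_roots scale "of_int (s One)" "t One One" "t Two One" "t Two Two" E_op F_op H_op parity v \<alpha> h \<pi> xs \<psi>
    by fact
  show ?thesis
    using hw.sum_list_series_weight[of "length xs"] by (simp add: qchar_eq_sum[OF assms] comp_def)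
qed

text \<open>The lowest vector is a highest weight vector for the relabelled generators.\<close>

lemma qchar_relabel:
  assumes hw: "highest_weight_data v \<alpha> h \<pi> xs (root_poly ys)" and len: "length ys = length xs"
  shows "qchar scale (relabel t) =
    basis_elt (lw (fps_to_fls \<alpha> * inf_expand (shift_poly (root_poly ys) (of_int (s One))) / inf_expand (root_poly xs))
      (fps_to_fls \<alpha> * inf_expand (shift_poly (root_poly xs) (of_int (s One))) / inf_expand (root_poly xs))) *
    (\<Prod>y\<leftarrow>ys. 1 + basis_elt (diag_weight (linear_ratio y (y + of_int (s One)))))"
proof -
  let ?eps = "of_int (s One) :: complex"
  interpret hw: highest_weight_roots scale ?eps "t One One" "t Two One" "t Two Two" E_op F_op H_op parity v \<alpha> h \<pi> xs "root_poly ys"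
    by fact
  let ?w = "hw.w hw.k"
  interpret R: irreducible_yangian_module scale "s \<circ> flip" gr "relabel t"
  proof (intro irreducible_yangian_module.intro irreducible_yangian_module_axioms.intro)
    show "yangian_module scale (s \<circ> flip) gr (relabel t)" by (rule yangian_module_relabel)
    show "s \<circ> flip \<in> S11" using s_S11 by (auto simp: S11_def)
    show "finite_dim scale" by (rule fin_dim)
    have "is_submodule scale gr (relabel t) N \<longleftrightarrow> is_submodule scale gr t N" for N
      unfolding is_submodule_def relabel_def by (metis flip_flip)
    then show "irreducible_module scale gr (relabel t)"
      using irreducible by (simp add: irreducible_module_def)
  qed
  have eps': "of_int ((s \<circ> flip) One) = - ?eps"
    by (rule sign_cases) (use s_S11 in \<open>auto simp: S11_def\<close>)
  \<comment> \<open>The eigenvalue on the lowest vector of the old t_22, which is the new t_11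
    (\<open>D_w_eq\<close>).\<close>
  define \<delta>f where "\<delta>f = fps_to_fls \<alpha> * inf_expand (shift_poly (root_poly ys) ?eps) / inf_expand (root_poly xs)"
  have "\<delta>f \<in> one_plus_series"
    using root_poly_ratio_one_plus[of "map (\<lambda>y. y + ?eps) ys" xs] len hw.alpha_0
    by (auto simp: \<delta>f_def shift_root_poly simp flip: times_divide_eq_right intro!: one_plus_series_mult fps_to_fls_one_plus)
  then obtain \<delta> where \<delta>: "\<delta>f = fps_to_fls \<delta>" by (auto simp: one_plus_series_def)
  have D: "relabel t One One r ?w = scale (\<delta> $ r) ?w" for r
    using hw.D_w_eq[of r] by (simp add: relabel_def \<delta> fps_to_fls_nth_nat flip: \<delta>f_def)
  \<comment> \<open>The new t_12 is the old t_21, which kills the lowest vector.\<close>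
  have "relabel t One Two r ?w = 0" for r
    using hw.C_w by (simp add: relabel_def)
  then have E: "R.E_op m ?w = 0" for m by (rule R.E_op_eq_0)
  obtain \<pi>' where \<pi>': "parity ?w = scale \<pi>' ?w" using hw.P_w by blast
  obtain h' xs' ys' where hw': "R.highest_weight_data ?w \<delta> h' \<pi>' xs' (root_poly ys')" "length ys' = length xs'"
    by (rule R.highest_weight_structure[OF hw.w_nonzero E D \<pi>'])
  interpret hw': highest_weight_roots scale "of_int ((s \<circ> flip) One)" "relabel t One One" "relabel t Two One" "relabel t Two Two"
    R.E_op R.F_op R.H_op parity ?w \<delta> h' \<pi>' xs' "root_poly ys'"
    by (rule hw'(1))
  let ?\<beta> = "hw.\<beta> hw.k"
  \<comment> \<open>The new t_22 is the old t_11, whose eigenvalue is known; this determines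
    \<open>h'\<close>.\<close>
  have "\<delta> * h' = ?\<beta>"
  proof (rule fps_ext)
    fix r
    have "scale ((\<delta> * h') $ r) ?w = scale (?\<beta> $ r) ?w"
      using R.t_Two_Two_highest[OF hw'(1), of r] hw.A_w[OF order_refl, of r] by (simp only: relabel_def flip.simps)
    then show "(\<delta> * h') $ r = ?\<beta> $ r" using hw.w_nonzero by simp
  qed
  then have \<delta>h: "\<delta>f * fps_to_fls h' = fps_to_fls \<alpha> * inf_expand (shift_poly (root_poly xs) ?eps) / inf_expand (root_poly xs)"
    by (simp add: \<delta> hw.beta_last flip: fls_times_fps_to_fls)
  have \<alpha>_nz: "fps_to_fls \<alpha> \<noteq> 0" using hw.alpha_0 by auto
  have nz: "inf_expand (root_poly zs) \<noteq> 0" "inf_expand (shift_poly (root_poly zs) c) \<noteq> 0" for zs c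
    by (simp_all add: inf_expand_eq_0 root_poly_nonzero shift_poly_eq_0)
  have "inf_expand (root_poly ys') / inf_expand (root_poly xs') = fps_to_fls h'"
    using hw'.h_eq nz by (simp add: field_simps)
  also have "fps_to_fls h' = inf_expand (shift_poly (root_poly xs) ?eps) / inf_expand (shift_poly (root_poly ys) ?eps)"
    using \<delta>h \<alpha>_nz nz unfolding \<delta>f_def by (simp add: field_simps)
  finally have ratio: "inf_expand (root_poly ys') / inf_expand (root_poly xs')
    = inf_expand (root_poly (map (\<lambda>x. x + ?eps) xs)) / inf_expand (root_poly (map (\<lambda>y. y + ?eps) ys))"
    by (simp only: shift_root_poly)
  \<comment> \<open>A Bezout identity survives the shift of the variable. So the fraction for
    \<open>h'\<close> is reduced, and its denominator has as roots the elements of \<open>ys\<close>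
    shifted by s_1.\<close>
  have "coprime (shift_poly (root_poly ys) ?eps) (shift_poly (root_poly xs) ?eps)"
  proof -
    obtain a b where "a * root_poly xs + b * root_poly ys = 1"
      using poly_bezout[OF hw.coprime root_poly_nonzero] by blast
    then have "shift_poly (a * root_poly xs + b * root_poly ys) ?eps = 1" by (simp add: shift_poly_def pcompose_1)
    then have "shift_poly a ?eps * shift_poly (root_poly xs) ?eps + shift_poly b ?eps * shift_poly (root_poly ys) ?eps = 1"
      by (simp add: shift_poly_def pcompose_add pcompose_mult)
    then show ?thesis by (metis coprimeI dvd_add dvd_mult)
  qed
  then have cop: "coprime (root_poly (map (\<lambda>x. x + ?eps) xs)) (root_poly (map (\<lambda>y. y + ?eps) ys))"
    by (simp only: shift_root_poly coprime_commute)
  have "root_poly xs' = root_poly (map (\<lambda>y. y + ?eps) ys)"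
    by (rule monic_ratio_unique(2)[OF _ _ _ _ _ cop ratio])
       (simp_all add: lead_coeff_root_poly coprime_commute hw'.coprime)
  then have "mset xs' = mset (map (\<lambda>y. y + ?eps) ys)" by (rule root_poly_inject)
  then have "prod_mset (image_mset G (mset xs')) = prod_mset (image_mset G (mset (map (\<lambda>y. y + ?eps) ys)))"
    for G :: "complex \<Rightarrow> lweight \<Rightarrow>\<^sub>0 int" by simp
  then have prod: "(\<Prod>x\<leftarrow>xs'. G x) = (\<Prod>y\<leftarrow>ys. G (y + ?eps))" for G :: "complex \<Rightarrow> lweight \<Rightarrow>\<^sub>0 int"
    by (simp only: mset_map[symmetric] prod_mset_prod_list prod_list_map_comp)
  have "qchar scale (relabel t) = basis_elt (series_weight h' \<delta>) *
    (\<Prod>x\<leftarrow>xs'. 1 + basis_elt (diag_weight (linear_ratio (x + of_int ((s \<circ> flip) One)) x)))"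
    by (rule R.qchar_product[OF hw'(1)])
  \<comment> \<open>The sign for the new sequence is opposite, so the root y + s_1 contributes (u -
    y) / (u - y - s_1).\<close>
  also have "\<dots> = basis_elt (series_weight h' \<delta>) * (\<Prod>y\<leftarrow>ys. 1 + basis_elt (diag_weight (linear_ratio y (y + ?eps))))"
    unfolding prod eps' by simp
  finally show ?thesis
    unfolding series_weight_def fls_times_fps_to_fls \<delta>[symmetric] \<delta>h by (simp only: \<delta>f_def)
qed

end

section \<open>The procedure\<close>

theorem mainTheorem5:
  fixes s :: "ix \<Rightarrow> int"
    and scale :: "complex \<Rightarrow> 'v::ab_group_add \<Rightarrow> 'v"
    and gr :: "bit \<Rightarrow> 'v set"
    and t :: "ix \<Rightarrow> ix \<Rightarrow> nat \<Rightarrow> 'v \<Rightarrow> 'v"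
  assumes "s \<in> S11"
    and "yangian_module scale s gr t"
    and "finite_dim scale"
    and "irreducible_module scale gr t"
  shows "(\<nexists>run. run 0 = (qchar scale t, 0) \<and> (\<forall>n. q_step s (run n) (run (Suc n)))) \<and>
    (\<forall>Q R. (q_step s)\<^sup>*\<^sup>* (qchar scale t, 0) (Q, R) \<longrightarrow>
       (if Q = 0 then R = qchar scale (relabel t) else (\<exists>S. q_step s (Q, R) S)))"
proof -
  interpret Y: irreducible_yangian_module scale s gr t
    using assms by (intro irreducible_yangian_module.intro irreducible_yangian_module_axioms.intro)
  let ?eps = "of_int (s One) :: complex" and ?\<chi> = "qchar scale t" and ?\<chi>' = "qchar scale (relabel t)"
  obtain v a \<pi> where v: "v \<noteq> 0" "\<And>i. Y.E_op i v = 0" "\<And>r. t One One r v = scale (a r) v" "Y.parity v = scale \<pi> v"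
    using Y.ex_highest_weight_vector by blast
  define \<alpha> where "\<alpha> = Abs_fps a"
  have \<alpha>: "t One One r v = scale (\<alpha> $ r) v" for r by (simp add: \<alpha>_def v)
  obtain h xs ys where hw: "Y.highest_weight_data v \<alpha> h \<pi> xs (root_poly ys)" and len: "length ys = length xs"
    by (rule Y.highest_weight_structure[OF v(1,2) \<alpha> v(4)])
  interpret hw: highest_weight_roots scale ?eps "t One One" "t Two One" "t Two Two" Y.E_op Y.F_op Y.H_op Y.parity v \<alpha> h \<pi> xs "root_poly ys"
    by (rule hw)
  let ?\<zeta> = "series_weight h \<alpha>" and ?\<zeta>s = "map (series_weight h) (hw.ms hw.k)"
  have comps: "lcomp ?\<zeta> One = fps_to_fls \<alpha>" "lcomp ?\<zeta> Two = fps_to_fls \<alpha> * fps_to_fls h"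
  proof -
    have "fps_to_fls \<alpha> \<in> one_plus_series" "fps_to_fls (\<alpha> * h) \<in> one_plus_series"
      using hw.alpha_0 hw.h_0 by (simp_all add: fps_to_fls_one_plus del: fls_times_fps_to_fls)
    then show "lcomp ?\<zeta> One = fps_to_fls \<alpha>" "lcomp ?\<zeta> Two = fps_to_fls \<alpha> * fps_to_fls h"
      by (simp_all only: series_weight_def lcomp_lw fls_times_fps_to_fls)
  qed
  have nz: "fps_to_fls \<alpha> \<noteq> 0" "fps_to_fls h \<noteq> 0" "inf_expand (root_poly zs) \<noteq> 0" for zs
    using hw.alpha_0 hw.h_0 by (auto simp: inf_expand_eq_0 root_poly_nonzero)
  have h_ratio: "fps_to_fls h = inf_expand (root_poly ys) / inf_expand (root_poly xs)"
    using hw.h_eq nz by (simp add: field_simps)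
  have \<chi>_sum: "?\<chi> = sum_list (map basis_elt ?\<zeta>s)" by (rule Y.qchar_eq_sum[OF hw])
  have pos: "Poly_Mapping.lookup ?\<chi> \<xi> > 0 \<longleftrightarrow> \<xi> \<in> set ?\<zeta>s" for \<xi>
    unfolding \<chi>_sum lookup_sum_list_basis using count_list_0_iff[of ?\<zeta>s \<xi>] by auto
  have top: "Poly_Mapping.lookup ?\<chi> ?\<zeta> > 0"
  proof -
    have "\<alpha> \<in> set (hw.ms n)" for n by (induction n) auto
    then show ?thesis unfolding pos by simp
  qed
  have A_weight: "A_weight s x = diag_weight (linear_ratio x (x + ?eps))" for x
    by (simp add: A_weight_def linear_ratio_def Let_def)
  \<comment> \<open>Each factor introduced by \<open>twist\<close> is inverse to some
    \<open>A_weight\<close>, so every weight of the module is obtained from \<open>?\<zeta>\<close>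
    by dividing by such elements.\<close>
  have below: "\<exists>as. ?\<zeta> = \<xi> + sum_list (map (A_weight s) as)" if "Poly_Mapping.lookup ?\<chi> \<xi> > 0" for \<xi>
  proof -
    have "\<exists>as. ?\<zeta> = series_weight h \<mu> + sum_list (map (A_weight s) as)" if "\<mu> \<in> set (hw.ms n)" for \<mu> n
      using that
    proof (induction n arbitrary: \<mu>)
      case 0
      then show ?case by (auto intro: exI[of _ "[]"])
    next
      case (Suc n)
      then consider "\<mu> \<in> set (hw.ms n)" | \<nu> x where "\<nu> \<in> set (hw.ms n)" "\<mu> = hw.twist x \<nu>" by auto
      then show ?case
      proof cases
        case 1
        then show ?thesis by (rule Suc.IH)
      next
        case (2 \<nu> x)
        then obtain as where as: "?\<zeta> = series_weight h \<nu> + sum_list (map (A_weight s) as)" using Suc.IH by blast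
        have "diag_weight (linear_ratio (x + ?eps) x) + A_weight s x = 0"
          by (simp add: A_weight lw_add linear_ratio_one_plus linear_ratio_inverse lw_one)
        then have "series_weight h \<nu> = series_weight h \<mu> + A_weight s x"
          using 2 by (simp add: hw.series_weight_twist hw.ms_nth_0 add.assoc)
        then have "?\<zeta> = series_weight h \<mu> + sum_list (map (A_weight s) (x # as))"
          using as by (simp add: add.assoc)
        then show ?thesis by blast
      qed
    qed
    then show ?thesis using that unfolding pos by auto
  qed
  \<comment> \<open>Otherwise a nonempty product of elements \<open>A_weight s x\<close> would be 1.
    This is impossible because the first nonconstant coefficient of such a product is its number of
    factors times s_1.\<close>
  have maximal: "\<not> lw_greater s \<xi> ?\<zeta>" if \<xi>: "Poly_Mapping.lookup ?\<chi> \<xi> > 0" for \<xi>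
  proof
    assume "lw_greater s \<xi> ?\<zeta>"
    then obtain as where as: "as \<noteq> []" "\<xi> = ?\<zeta> + sum_list (map (A_weight s) as)" by (auto simp: lw_greater_def)
    obtain bs where bs: "?\<zeta> = \<xi> + sum_list (map (A_weight s) bs)" using below[OF \<xi>] by blast
    have "sum_list (map (A_weight s) (as @ bs)) = 0" using as(2) bs by (simp add: ac_simps)
    moreover have "(lcomp (sum_list (map (A_weight s) cs)) One) $$ 1 = of_nat (length cs) * ?eps
      \<and> (lcomp (sum_list (map (A_weight s) cs)) One) $$ 0 = 1" for cs
    proof -
      have "\<exists>f. lcomp (sum_list (map (A_weight s) cs)) One = fps_to_fls f \<and> f $ 0 = 1
        \<and> f $ 1 = of_nat (length cs) * ?eps"
      proof (induction cs)
        case Nil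
        then show ?case by (intro exI[of _ 1]) (simp add: lcomp_0)
      next
        case (Cons x cs)
        then obtain f where f: "lcomp (sum_list (map (A_weight s) cs)) One = fps_to_fls f" "f $ 0 = 1"
          "f $ 1 = of_nat (length cs) * ?eps" by blast
        obtain g where g: "linear_ratio x (x + ?eps) = fps_to_fls g" "g $ 0 = 1" "g $ 1 = (x + ?eps) - x"
          by (rule linear_ratio_fps)
        have "lcomp (sum_list (map (A_weight s) (x # cs))) One = fps_to_fls (g * f)"
          using f(1) g(1) linear_ratio_one_plus[of x "x + ?eps"]
          by (simp add: lcomp_add A_weight lcomp_lw fls_times_fps_to_fls)
        then show ?case using f g by (intro exI[of _ "g * f"]) (simp add: algebra_simps)
      qed
      then show ?thesis by (metis fps_to_fls_nth_nat of_nat_0 of_nat_1)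
    qed
    ultimately have "of_nat (length (as @ bs)) * ?eps = (lcomp 0 One) $$ 1" by metis
    then have "of_nat (length (as @ bs)) * ?eps = 0" by (simp add: lcomp_0)
    moreover have "?eps \<noteq> 0" using Y.eps_sq by auto
    ultimately have "(of_nat (length (as @ bs)) :: complex) = 0" by (metis mult_eq_0_iff)
    then have "length (as @ bs) = 0" by (simp only: of_nat_eq_0_iff)
    then show False using as(1) by simp
  qed
  have unique: "\<xi> = ?\<zeta>" if \<xi>: "Poly_Mapping.lookup ?\<chi> \<xi> > 0"
    and max: "\<And>\<nu>. Poly_Mapping.lookup ?\<chi> \<nu> > 0 \<Longrightarrow> \<not> lw_greater s \<nu> \<xi>" for \<xi>
  proof -
    obtain as where as: "?\<zeta> = \<xi> + sum_list (map (A_weight s) as)" using below[OF \<xi>] by blast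
    show ?thesis
    proof (cases "as = []")
      case True
      then show ?thesis using as by simp
    next
      case False
      then have "lw_greater s ?\<zeta> \<xi>" using as by (auto simp: lw_greater_def)
      then show ?thesis using max[OF top] by simp
    qed
  qed
  have step1: "(\<Sum>J\<in>Pow {1..k}. basis_elt ?\<zeta> *
             basis_elt (lw (inf_expand (shift_poly (\<Prod>i\<in>J. [:- x i, 1:]) ?eps) / inf_expand (\<Prod>i\<in>J. [:- x i, 1:]))
                           (inf_expand (shift_poly (\<Prod>i\<in>J. [:- x i, 1:]) ?eps) / inf_expand (\<Prod>i\<in>J. [:- x i, 1:])))) = ?\<chi>"
    if "(\<Prod>i\<in>{1..k}. [:- x i, 1:]) = root_poly xs" for x :: "nat \<Rightarrow> complex" and k
    unfolding shift_ratio_prod Y.qchar_product[OF hw] sum_distrib_left[symmetric]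
      sum_Pow_basis_elt[OF that, of "\<lambda>z. linear_ratio (z + ?eps) z", OF linear_ratio_one_plus] ..
  have step2: "(\<Sum>J\<in>Pow {1..k}.
             basis_elt (lw (lcomp ?\<zeta> Two * (inf_expand (shift_poly (root_poly ys) ?eps) / inf_expand (root_poly ys)))
                           (lcomp ?\<zeta> One * (inf_expand (shift_poly (root_poly xs) ?eps) / inf_expand (root_poly xs)))) *
             basis_elt (lw (inf_expand (\<Prod>i\<in>J. [:- x i, 1:]) / inf_expand (shift_poly (\<Prod>i\<in>J. [:- x i, 1:]) ?eps))
                           (inf_expand (\<Prod>i\<in>J. [:- x i, 1:]) / inf_expand (shift_poly (\<Prod>i\<in>J. [:- x i, 1:]) ?eps)))) = ?\<chi>'"
    if "(\<Prod>i\<in>{1..k}. [:- x i, 1:]) = root_poly ys" for x :: "nat \<Rightarrow> complex" and k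
  proof -
    have "lcomp ?\<zeta> Two * (inf_expand (shift_poly (root_poly ys) ?eps) / inf_expand (root_poly ys))
      = fps_to_fls \<alpha> * inf_expand (shift_poly (root_poly ys) ?eps) / inf_expand (root_poly xs)"
      unfolding comps h_ratio using nz by simp
    moreover have "lcomp ?\<zeta> One * (inf_expand (shift_poly (root_poly xs) ?eps) / inf_expand (root_poly xs))
      = fps_to_fls \<alpha> * inf_expand (shift_poly (root_poly xs) ?eps) / inf_expand (root_poly xs)"
      unfolding comps by simp
    ultimately show ?thesis
      unfolding shift_ratio_prod sum_distrib_left[symmetric] Y.qchar_relabel[OF hw len]
        sum_Pow_basis_elt[OF that, of "\<lambda>z. linear_ratio z (z + ?eps)", OF linear_ratio_one_plus] by (simp only:)
  qed
  have only: "S = (0, ?\<chi>')" if "q_step s z S" "z = (?\<chi>, 0)" for z S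
    using that
  proof (induction rule: q_step.induct)
    case (1 \<zeta> \<phi> \<psi> k a b \<phi>J \<psi>J Q R)
    have QR: "Q = ?\<chi>" "R = 0" using 1(12) by (simp_all only: prod.inject)
    have \<zeta>: "\<zeta> = ?\<zeta>" using 1(1,2) unfolding QR by (rule unique)
    have "inf_expand \<phi> / inf_expand \<psi> = inf_expand (root_poly xs) / inf_expand (root_poly ys)"
      using 1(6) nz unfolding \<zeta> comps h_ratio by simp
    from monic_ratio_unique[OF 1(3,4) lead_coeff_root_poly lead_coeff_root_poly 1(5) hw.coprime this]
    have \<phi>: "\<phi> = root_poly xs" and \<psi>: "\<psi> = root_poly ys" .
    \<comment> \<open>In the procedure the roots of phi are the numbers \<open>- a i\<close>,
      whereas \<open>xs\<close> lists the roots themselves.\<close>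
    have a: "(\<lambda>J. \<Prod>i\<in>J. [:a i, 1:]) = (\<lambda>J. \<Prod>i\<in>J. [:- (- a i), 1:])" by simp
    have xs: "(\<Prod>i\<in>{1..k}. [:- (- a i), 1:]) = root_poly xs" using 1(8) by (simp add: \<phi>)
    have ys: "(\<Prod>i\<in>{1..k}. [:- b i, 1:]) = root_poly ys" using 1(9) by (simp add: \<psi>)
    show ?case
      unfolding QR \<zeta> 1(10,11) a \<phi> \<psi> step1[OF xs] step2[OF ys] by simp
  qed
  have exists: "\<exists>S. q_step s (?\<chi>, 0) S"
  proof (rule exI, rule q_step.intros[where \<zeta> = ?\<zeta> and \<phi> = "root_poly xs" and \<psi> = "root_poly ys" and k = hw.k
      and a = "\<lambda>i. - (xs ! (i - 1))" and b = "\<lambda>i. ys ! (i - 1)"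
      and \<phi>J = "\<lambda>J. \<Prod>i\<in>J. [:- (xs ! (i - 1)), 1:]" and \<psi>J = "\<lambda>J. \<Prod>i\<in>J. [:- (ys ! (i - 1)), 1:]"])
    show "lcomp ?\<zeta> One / lcomp ?\<zeta> Two = inf_expand (root_poly xs) / inf_expand (root_poly ys)"
      unfolding comps h_ratio using nz by simp
    show "root_poly xs = (\<Prod>i\<in>{1..hw.k}. [:- (xs ! (i - 1)), 1:])" by (rule root_poly_eq_prod)
    show "root_poly ys = (\<Prod>i\<in>{1..hw.k}. [:- (ys ! (i - 1)), 1:])" using root_poly_eq_prod[of ys] by (simp add: len)
    show "lead_coeff (root_poly xs) = 1" "lead_coeff (root_poly ys) = 1" by (rule lead_coeff_root_poly)+
  qed (use top maximal in \<open>simp_all add: degree_root_poly hw.coprime\<close>)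
  \<comment> \<open>A pass needs a weight with positive coefficient.\<close>
  have stop: "\<not> q_step s (0, R) S" for R S
    by (auto elim: q_step.cases)
  have "?\<chi> \<noteq> 0" using top by auto
  show ?thesis
  proof (intro conjI allI impI)
    show "\<nexists>run. run 0 = (?\<chi>, 0) \<and> (\<forall>n. q_step s (run n) (run (Suc n)))"
    proof
      assume "\<exists>run. run 0 = (?\<chi>, 0) \<and> (\<forall>n. q_step s (run n) (run (Suc n)))"
      then obtain run where run: "run 0 = (?\<chi>, 0)" "\<And>n. q_step s (run n) (run (Suc n))" by blast
      have "run 1 = (0, ?\<chi>')" using only[OF run(2)[of 0] run(1)] by simp
      then show False using run(2)[of 1] stop by simp
    qed
    fix Q R assume "(q_step s)\<^sup>*\<^sup>* (?\<chi>, 0) (Q, R)"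
    then have "(Q, R) = (?\<chi>, 0) \<or> (Q, R) = (0, ?\<chi>')"
    proof (induction "(Q, R)" arbitrary: Q R rule: rtranclp_induct)
      case (step y)
      then show ?case using only[OF step(2)] stop by (cases y) auto
    qed simp
    then show "if Q = 0 then R = ?\<chi>' else (\<exists>S. q_step s (Q, R) S)"
      using exists \<open>?\<chi> \<noteq> 0\<close> by auto
  qed
qed

end
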